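(* The symmetric bilinear pairing $\langle\phi_1,\phi_2\rangle_{\cal BH}$ on ${\cal BH}\times{\cal BH}$ is $SU(2)\times SU(2)$-invariant and $\mathfrak{gl}(2,\mathbb H_{\mathbb C})$-invariant (with respect to $\rho'$), is independent of the choice of $R>0$, and satisfies the orthogonality relations $$\langle\phi^{(1)}_{l,m,n},\tilde\phi^{(1)}_{l',m',n'}\rangle_{\cal BH}=\langle\tilde\phi^{(1)}_{l,m,n},\phi^{(1)}_{l',m',n'}\rangle_{\cal BH}=2l\,\delta_{ll'}\delta_{mm'}\delta_{nn'},$$ $$\langle\phi^{(2)}_{l,m,n},\tilde\phi^{(2)}_{l',m',n'}\rangle_{\cal BH}=\langle\tilde\phi^{(2)}_{l,m,n},\phi^{(2)}_{l',m',n'}\rangle_{\cal BH}=-2l\,\delta_{ll'}\delta_{mm'}\delta_{nn'},$$ while $$\langle\phi^{(\alpha)}_{l,m,n},\phi^{(\alpha')}_{l',m',n'}\rangle_{\cal BH}=\langle\tilde\phi^{(\alpha)}_{l,m,n},\tilde\phi^{(\alpha')}_{l',m',n'}\rangle_{\cal BH}=0\quad\text{for all }\alpha,\alpha'\in\{1,2\},$$ $$\langle\phi^{(\alpha)}_{l,m,n},\tilde\phi^{(\alpha')}_{l',m',n'}\rangle_{\cal BH}=\langle\tilde\phi^{(\alpha)}_{l,m,n},\phi^{(\alpha')}_{l',m',n'}\rangle_{\cal BH}=0\quad\text{if }\alpha\ne\alpha'.$$ The pairing is also invariant under the inversion: for all $\phi_1,\phi_2\in{\cal BH}$, $$\Bigl\langle\rho'\bigl(\begin{smallmatrix}0&1\\1&0\end{smallmatrix}\bigr)\phi_1,\rho'\bigl(\begin{smallmatrix}0&1\\1&0\end{smallmatrix}\bigr)\phi_2\Bigr\rangle_{\cal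 BH}=\langle\phi_1,\phi_2\rangle_{\cal BH}.$$
   Context: $\mathbb H_{\mathbb C}=\mathbb C\otimes_{\mathbb R}\mathbb H$ is identified with $2\times2$ complex matrices $Z=\bigl(\begin{smallmatrix} z_{11}&z_{12}\\ z_{21}&z_{22}\end{smallmatrix}\bigr)=z^0e_0+z^1e_1+z^2e_2+z^3e_3$, with $e_0=1$, $e_1=\bigl(\begin{smallmatrix}0&-i\\-i&0\end{smallmatrix}\bigr)$, $e_2=\bigl(\begin{smallmatrix}0&-1\\1&0\end{smallmatrix}\bigr)$, $e_3=\bigl(\begin{smallmatrix}-i&0\\0&i\end{smallmatrix}\bigr)$; $\mathbb H$ is the subset with real $z^j$. $N(Z)=\det Z$; $\square=\sum_{j=0}^3\partial^2/(\partial z^j)^2$. For $l=0,\frac12,1,\dots$ and $m,n\in\mathbb Z+l$, $-l\le m,n\le l$, $$t^l_{n\,\underline{m}}(Z)=\frac1{2\pi i}\oint (sz_{11}+z_{21})^{l-m}(sz_{12}+z_{22})^{l+m}s^{-l+n}\,\frac{ds}s$$ (counterclockwise loop around $0$). ${\cal BH}=\{f\in\mathbb C[z_{11},z_{12},z_{21},z_{22},N(Z)^{-1}];\ \square\square f=0\}$; it is spanned by the functions ($l=0,\frac12,1,\dots$) $\phi^{(1)}_{l,m,n}=t^l_{n\,\underline m}(Z)$, $\tilde\phi^{(1)}_{l,m,n}=t^l_{m\,\underline n}(Z^{-1})$ ($-l\le m,n\le l$), $\phi^{(2)}_{l,m,n}=N(Z)t^{l-1}_{n\,\underline m}(Z)$,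 $\tilde\phi^{(2)}_{l,m,n}=N(Z)^{-1}t^{l-1}_{m\,\underline n}(Z^{-1})$ ($-l+1\le m,n\le l-1$), the only coincidence being $\phi^{(1)}_{0,0,0}=\tilde\phi^{(1)}_{0,0,0}=1$. ${\cal BH}^+$ is the span of the $\phi^{(\alpha)}_{l,m,n}$, ${\cal BH}^-$ the span of the $\tilde\phi^{(\alpha)}_{l,m,n}$, $\alpha=1,2$. Definition of the pairing. Let $S^3_R=\{X\in\mathbb H;N(X)=R^2\}$ with Euclidean volume element $dS$. The symmetric bilinear pairing $\langle\cdot,\cdot\rangle_{\cal BH}$ is defined by $$\langle\phi^{(1)}_{l,m,n},\tilde\phi^{(1)}_{l',m',n'}\rangle_{\cal BH}=\frac{2l(2l+1)}{2\pi^2}\int_{X\in S^3_R}\phi^{(1)}_{l,m,n}(X)\,\tilde\phi^{(1)}_{l',m',n'}(X)\,\frac{dS}{R^3},$$ $$\langle\phi^{(2)}_{l,m,n},\tilde\phi^{(2)}_{l',m',n'}\rangle_{\cal BH}=-\frac{2l(2l-1)}{2\pi^2}\int_{X\in S^3_R}\phi^{(2)}_{l,m,n}(X)\,\tilde\phi^{(2)}_{l',m',n'}(X)\,\frac{dS}{R^3},$$ $\langle\phi^{(\alpha)}_{l,m,n},\tilde\phi^{(\alpha')}_{l',m',n'}\rangle_{\cal BH}=0$ if $\alpha\ne\alpha'$, extended to ${\cal BH}^-\times{\cal BH}^+$ by symmetry and declared to be zero on ${\cal BH}^+\times{\cal BH}^+$ and ${\cal BH}^-\times{\cal BH}^-$.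 $\rho'$: $(\rho'(h)f)(Z)=f\bigl((aZ+b)(cZ+d)^{-1}\bigr)$, $h^{-1}=\bigl(\begin{smallmatrix}a&b\\c&d\end{smallmatrix}\bigr)\in GL(2,\mathbb H_{\mathbb C})$; $\mathfrak{gl}(2,\mathbb H_{\mathbb C})$ acts by differentiation, and $\rho'\bigl(\begin{smallmatrix}0&1\\1&0\end{smallmatrix}\bigr)\phi(Z)=\phi(Z^{-1})$. $SU(2)\times SU(2)$ is the group of diagonal $\bigl(\begin{smallmatrix}a&0\\0&d\end{smallmatrix}\bigr)$, $a,d\in\mathbb H$, $N(a)=N(d)=1$. Lie-algebra invariance means $\langle\rho'(X)\phi_1,\phi_2\rangle+\langle\phi_1,\rho'(X)\phi_2\rangle=0$. *)

theory Defs
  imports "HOL-Complex_Analysis.Complex_Analysis" "HOL-Library.Function_Algebras"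
begin

unbundle no fps_syntax

type_synonym HC = "complex^2^2"

definition smul :: "complex \<Rightarrow> HC \<Rightarrow> HC" where
  "smul c A = (\<chi> i j. c * A $ i $ j)"

text \<open>The coordinates \<open>z\<^sup>0, \<dots>, z\<^sup>3\<close> are indexed by the numeral type \<open>4\<close>, whose elements are
  \<open>0, 1, 2, 3\<close>.\<close>

definition e :: "4 \<Rightarrow> HC" where
  "e j = (if j = 0 then vector [vector [1, 0], vector [0, 1]]
     else if j = 1 then vector [vector [0, - \<i>], vector [- \<i>, 0]]
     else if j = 2 then vector [vector [0, - 1], vector [1, 0]]
     else vector [vector [- \<i>, 0], vector [0, \<i>]])"

definition quat :: "real^4 \<Rightarrow> HC" where
  "quat x = (\<Sum>j\<in>UNIV. smul (complex_of_real (x $ j)) (e j))"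

definition HR :: "HC set" where
  "HR = range quat"

definition partial :: "4 \<Rightarrow> (HC \<Rightarrow> complex) \<Rightarrow> HC \<Rightarrow> complex" where
  "partial j f Z = deriv (\<lambda>t. f (Z + smul t (e j))) 0"

definition box :: "(HC \<Rightarrow> complex) \<Rightarrow> HC \<Rightarrow> complex" where
  "box f Z = (\<Sum>j\<in>UNIV. partial j (partial j f) Z)"

text \<open>A function on the domain \<open>{Z. det Z \<noteq> 0}\<close> is represented by its extension by \<open>0\<close> to all
  matrices, so that equality and linear structure of functions are those of the domain.\<close>

definition on_units :: "(HC \<Rightarrow> complex) \<Rightarrow> HC \<Rightarrow> complex" where
  "on_units f = (\<lambda>Z. if det Z = 0 then 0 else f Z)"

text \<open>The algebra \<open>\<complex>[z\<^sub>1\<^sub>1, z\<^sub>1\<^sub>2, z\<^sub>2\<^sub>1, z\<^sub>2\<^sub>2, N(Z)\<^sup>-\<^sup>1]\<close>, where \<open>N(Z) = det Z\<close>.\<close>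

inductive_set regular_functions :: "(HC \<Rightarrow> complex) set" where
  const: "on_units (\<lambda>Z. c) \<in> regular_functions"
| coord: "on_units (\<lambda>Z. Z $ i $ j) \<in> regular_functions"
| inv_norm: "on_units (\<lambda>Z. inverse (det Z)) \<in> regular_functions"
| add: "f \<in> regular_functions \<Longrightarrow> g \<in> regular_functions \<Longrightarrow> (\<lambda>Z. f Z + g Z) \<in> regular_functions"
| mult: "f \<in> regular_functions \<Longrightarrow> g \<in> regular_functions \<Longrightarrow> (\<lambda>Z. f Z * g Z) \<in> regular_functions"

definition BH :: "(HC \<Rightarrow> complex) set" where
  "BH = {f \<in> regular_functions. \<forall>Z. det Z \<noteq> 0 \<longrightarrow> box (box f) Z = 0}"

definition half_integers :: "real set" where
  "half_integers = {real k / 2 | k :: nat. True}"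

text \<open>The indices \<open>m \<in> \<int> + l\<close> with \<open>-l \<le> m \<le> l\<close>; empty for \<open>l < 0\<close>.\<close>

definition weights :: "real \<Rightarrow> real set" where
  "weights l = {m. m - l \<in> \<int> \<and> - l \<le> m \<and> m \<le> l}"

text \<open>\<open>tcoeff l n m\<close> is $t^l_{n\,\underline{m}}$: the underlined index comes last. For
  \<open>n, m \<in> weights l\<close> the floors below are taken of integers.\<close>

definition tcoeff :: "real \<Rightarrow> real \<Rightarrow> real \<Rightarrow> HC \<Rightarrow> complex" where
  "tcoeff l n m Z = 1 / (2 * complex_of_real pi * \<i>) *
     contour_integral (circlepath 0 1)
       (\<lambda>s. (s * Z $ 1 $ 1 + Z $ 2 $ 1) ^ nat \<lfloor>l - m\<rfloor> * (s * Z $ 1 $ 2 + Z $ 2 $ 2) ^ nat \<lfloor>l + m\<rfloor>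
            * s powi \<lfloor>- l + n\<rfloor> / s)"

definition indices :: "nat \<Rightarrow> (real \<times> real \<times> real) set" where
  "indices \<alpha> = {(l, m, n). l \<in> half_integers \<and>
     (if \<alpha> = 1 then m \<in> weights l \<and> n \<in> weights l
      else m \<in> weights (l - 1) \<and> n \<in> weights (l - 1))}"

definition phi :: "nat \<Rightarrow> real \<Rightarrow> real \<Rightarrow> real \<Rightarrow> HC \<Rightarrow> complex" where
  "phi \<alpha> l m n = on_units (\<lambda>Z. if \<alpha> = 1 then tcoeff l n m Z else det Z * tcoeff (l - 1) n m Z)"

definition phi_t :: "nat \<Rightarrow> real \<Rightarrow> real \<Rightarrow> real \<Rightarrow> HC \<Rightarrow> complex" where
  "phi_t \<alpha> l m n = on_units (\<lambda>Z. if \<alpha> = 1 then tcoeff l m n (matrix_inv Z)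
     else inverse (det Z) * tcoeff (l - 1) m n (matrix_inv Z))"

definition cspan :: "(HC \<Rightarrow> complex) set \<Rightarrow> (HC \<Rightarrow> complex) set" where
  "cspan = module.span (\<lambda>c f Z. c * f Z)"

definition BH_plus :: "(HC \<Rightarrow> complex) set" where
  "BH_plus = cspan {phi \<alpha> l m n | \<alpha> l m n. \<alpha> \<in> {1, 2} \<and> (l, m, n) \<in> indices \<alpha>}"

definition BH_minus :: "(HC \<Rightarrow> complex) set" where
  "BH_minus = cspan {phi_t \<alpha> l m n | \<alpha> l m n. \<alpha> \<in> {1, 2} \<and> (l, m, n) \<in> indices \<alpha>}"

definition S3 :: "real \<Rightarrow> HC set" where
  "S3 R = {X \<in> HR. det X = complex_of_real (R\<^sup>2)}"

text \<open>The Euclidean surface measure \<open>dS\<close>: the cone from the origin over a set \<open>A \<subseteq> S3 R\<close>, cut off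
  at radius \<open>R\<close>, has four-dimensional volume \<open>\<integral>\<^sub>0\<^sup>R (r/R)\<^sup>3 S(A) dr = (R/4) S(A)\<close>. So \<open>dS\<close> is the image
  of \<open>4/R\<close> times the Lebesgue measure of the ball under the radial projection.\<close>

definition dS :: "real \<Rightarrow> HC measure" where
  "dS R = distr (density (restrict_space lborel (ball 0 R - {0})) (\<lambda>_. ennreal (4 / R)))
     (restrict_space borel (S3 R)) (\<lambda>x :: real^4. quat ((R / norm x) *\<^sub>R x))"

definition bilinear_on :: "(HC \<Rightarrow> complex) set \<Rightarrow> ((HC \<Rightarrow> complex) \<Rightarrow> (HC \<Rightarrow> complex) \<Rightarrow> complex) \<Rightarrow> bool" where
  "bilinear_on V B \<longleftrightarrow> (\<forall>f\<in>V. \<forall>g\<in>V. \<forall>h\<in>V. \<forall>c.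
     B (\<lambda>Z. f Z + g Z) h = B f h + B g h \<and> B (\<lambda>Z. c * f Z) h = c * B f h \<and>
     B h (\<lambda>Z. f Z + g Z) = B h f + B h g \<and> B h (\<lambda>Z. c * f Z) = c * B h f)"

definition symmetric_on :: "(HC \<Rightarrow> complex) set \<Rightarrow> ((HC \<Rightarrow> complex) \<Rightarrow> (HC \<Rightarrow> complex) \<Rightarrow> complex) \<Rightarrow> bool" where
  "symmetric_on V B \<longleftrightarrow> (\<forall>f\<in>V. \<forall>g\<in>V. B f g = B g f)"

definition is_BH_pairing :: "real \<Rightarrow> ((HC \<Rightarrow> complex) \<Rightarrow> (HC \<Rightarrow> complex) \<Rightarrow> complex) \<Rightarrow> bool" where
  "is_BH_pairing R B \<longleftrightarrow>
     bilinear_on BH B \<and> symmetric_on BH B \<and>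
     (\<forall>(l, m, n) \<in> indices 1. \<forall>(l', m', n') \<in> indices 1.
        B (phi 1 l m n) (phi_t 1 l' m' n') =
          complex_of_real (2 * l * (2 * l + 1) / (2 * pi\<^sup>2)) *
          (\<integral>X. phi 1 l m n X * phi_t 1 l' m' n' X / complex_of_real (R ^ 3) \<partial>dS R)) \<and>
     (\<forall>(l, m, n) \<in> indices 2. \<forall>(l', m', n') \<in> indices 2.
        B (phi 2 l m n) (phi_t 2 l' m' n') =
          - complex_of_real (2 * l * (2 * l - 1) / (2 * pi\<^sup>2)) *
          (\<integral>X. phi 2 l m n X * phi_t 2 l' m' n' X / complex_of_real (R ^ 3) \<partial>dS R)) \<and>
     (\<forall>\<alpha> \<in> {1, 2}. \<forall>\<alpha>' \<in> {1, 2}. \<alpha> \<noteq> \<alpha>' \<longrightarrow>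
        (\<forall>(l, m, n) \<in> indices \<alpha>. \<forall>(l', m', n') \<in> indices \<alpha>'.
           B (phi \<alpha> l m n) (phi_t \<alpha>' l' m' n') = 0)) \<and>
     (\<forall>f\<in>BH_plus. \<forall>g\<in>BH_plus. B f g = 0) \<and>
     (\<forall>f\<in>BH_minus. \<forall>g\<in>BH_minus. B f g = 0)"

text \<open>The last condition only fixes a junk value outside \<open>BH \<times> BH\<close>, so that \<open>THE\<close> applies to a
  function on the whole type.\<close>

definition BH_pairing :: "real \<Rightarrow> (HC \<Rightarrow> complex) \<Rightarrow> (HC \<Rightarrow> complex) \<Rightarrow> complex" where
  "BH_pairing R = (THE B. is_BH_pairing R B \<and> (\<forall>f g. f \<notin> BH \<or> g \<notin> BH \<longrightarrow> B f g = 0))"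

text \<open>A \<open>2 \<times> 2\<close> matrix over \<open>HC\<close> is a complex matrix indexed by \<open>2 + 2\<close>; the matrix product of the
  library then is the product of block matrices.\<close>

type_synonym HC22 = "complex^(2+2)^(2+2)"

definition blocks :: "HC \<Rightarrow> HC \<Rightarrow> HC \<Rightarrow> HC \<Rightarrow> HC22" where
  "blocks a b c d = (\<chi> i j. case i of
      Inl p \<Rightarrow> (case j of Inl q \<Rightarrow> a $ p $ q | Inr q \<Rightarrow> b $ p $ q)
    | Inr p \<Rightarrow> (case j of Inl q \<Rightarrow> c $ p $ q | Inr q \<Rightarrow> d $ p $ q))"

definition block_a :: "HC22 \<Rightarrow> HC" where "block_a h = (\<chi> p q. h $ Inl p $ Inl q)"
definition block_b :: "HC22 \<Rightarrow> HC" where "block_b h = (\<chi> p q. h $ Inl p $ Inr q)"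
definition block_c :: "HC22 \<Rightarrow> HC" where "block_c h = (\<chi> p q. h $ Inr p $ Inl q)"
definition block_d :: "HC22 \<Rightarrow> HC" where "block_d h = (\<chi> p q. h $ Inr p $ Inr q)"

text \<open>\<open>f\<close> vanishes on singular matrices, so the result is \<open>0\<close> wherever the argument of \<open>f\<close> is
  undefined or singular.\<close>

definition rho :: "HC22 \<Rightarrow> (HC \<Rightarrow> complex) \<Rightarrow> HC \<Rightarrow> complex" where
  "rho h f = on_units (\<lambda>Z.
     let k = matrix_inv h; a = block_a k; b = block_b k; c = block_c k; d = block_d k in
     if det (c ** Z + d) = 0 then 0 else f ((a ** Z + b) ** matrix_inv (c ** Z + d)))"

definition mexp :: "HC22 \<Rightarrow> HC22" where
  "mexp X = (\<Sum>k. (((**) X) ^^ k) (mat 1) /\<^sub>R fact k)"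

definition drho :: "HC22 \<Rightarrow> (HC \<Rightarrow> complex) \<Rightarrow> HC \<Rightarrow> complex" where
  "drho X f Z = vector_derivative (\<lambda>t :: real. rho (mexp (t *\<^sub>R X)) f Z) (at 0)"

definition SU2_SU2 :: "HC22 set" where
  "SU2_SU2 = {blocks a 0 0 d | a d. a \<in> HR \<and> d \<in> HR \<and> det a = 1 \<and> det d = 1}"

definition inversion :: HC22 where
  "inversion = blocks 0 (mat 1) (mat 1) 0"

end

theory Submission
  imports Defs
begin

text \<open>
The functions \<open>E (k,p,q,r) = N(Z)\<^sup>k S(p,q,r)(Z)\<close> carry the whole proof. Here \<open>S(p,q,r)\<close> is the sum of
\<open>\<Prod> z\<^sub>i\<^sub>j\<^sup>a / a!\<close> over all \<open>2 \<times> 2\<close> matrices \<open>(a)\<close> of natural numbers with column sums \<open>p, q\<close> and row sums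
\<open>r, p+q-r\<close>. Up to the factor \<open>p! q!\<close> it is the matrix coefficient \<open>t\<^sup>l\<close> with \<open>p = l-m\<close>, \<open>q = l+m\<close>,
\<open>r = l-n\<close> (lemma \<open>tcoeff_eq\<close>). Throughout, \<open>d = p+q\<close> is the degree \<open>2l\<close> of \<open>S(p,q,r)\<close>.

Multiplication by a coordinate and differentiation act on the \<open>E\<close> by formulas with at most two terms.
Hence the \<open>E\<close> span the regular functions, and since \<open>\<box> E (k,\<dots>) = 4k(k+d+1) E (k-1,\<dots>)\<close>, the space \<open>BH\<close>
is the span of those with \<open>k \<in> {0, 1, -d, -d-1}\<close> (\<open>BH_eq\<close>). The values \<open>k = 0, 1\<close> are the
\<open>\<phi>\<^sup>(\<^sup>\<alpha>\<^sup>)\<close>; because \<open>Z\<^sup>-\<^sup>1\<close> is the adjugate divided by \<open>N(Z)\<close>, the values \<open>k = -d, -d-1\<close> are the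
functions with a tilde, and \<open>\<phi>\<close> is exchanged with its partner by an involution \<open>dual\<close> on the indices (\<open>phi_eq\<close>).

Left and right multiplication by unit quaternions preserve \<open>dS\<close>. Differentiating this invariance along
one-parameter groups gives ladder relations between the integrals of products \<open>E i * E j\<close>. They force the
integral to vanish unless \<open>j\<close> is \<open>dual i\<close> up to the exponent of the determinant, and they reduce the
remaining values to the area of the sphere (\<open>schur\<close>). For \<open>j = dual i\<close> the powers of the determinant
contribute \<open>R\<^sup>0\<close>, so after division by \<open>R\<^sup>3\<close> nothing depends on \<open>R\<close>. The orthogonality also gives the linear
independence of the \<open>E\<close>, hence coordinates, and the pairing is the unique bilinear form with
\<open>\<langle>E i, E (dual i)\<rangle> = b(k,d) w(p,q,r)\<close> and \<open>\<langle>E i, E j\<rangle> = 0\<close> for all other \<open>j\<close> (\<open>BH_pairing_eq\<close>), where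
\<open>w\<close> is \<open>wt\<close>, \<open>b\<close> is \<open>level_const\<close>, \<open>b(k,d) = d\<close> for \<open>k \<in> {0, -d}\<close> and \<open>b(k,d) = -(d+2)\<close> for \<open>k \<in> {1, -d-1}\<close>.

The invariance statements are then checked on the \<open>E\<close>. Translations by unit quaternions keep \<open>k\<close> and \<open>d\<close>,
and for fixed \<open>(k,d)\<close> the pairing is a constant times the integral over the unit sphere
(\<open>SU2_invariance\<close>). The inversion permutes the \<open>E\<close> up to sign (\<open>inversion_invariance\<close>). An element of the
Lie algebra with blocks \<open>A, B, C, D\<close> acts as the derivative along \<open>Z \<mapsto> Z(CZ+D) - (AZ+B)\<close> (\<open>drho_eq\<close>). Skew
symmetry of each matrix unit is a cancellation between two coefficients: in the blocks \<open>A\<close> and \<open>D\<close> only \<open>w\<close>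
enters, while for \<open>B\<close> and \<open>C\<close> it is the identity \<open>k/(d+1) b(k-1,d+1) + (2-k)/(d+2) b(k,d) = 0\<close> and its mirror image
(\<open>level_const_trans\<close>, \<open>level_const_spec\<close>). These identities determine \<open>b\<close> up to a common factor and
explain the factors \<open>2l\<close> and \<open>-2l\<close>.
\<close>

(* The dollar sign is reserved for vector components. *)
unbundle no Formal_Power_Series.fps_syntax

section \<open>Divided-power polynomials in the matrix entries\<close>

text \<open>Exponents are integers and the value at a negative exponent is \<open>0\<close>, so that the recursions below
  hold without boundary cases.\<close>
definition dpow :: "int \<Rightarrow> complex \<Rightarrow> complex" where
  "dpow n z = (if n < 0 then 0 else z ^ nat n / fact (nat n))"

lemma dpow_neg [simp]: "n < 0 \<Longrightarrow> dpow n z = 0"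
  by (simp add: dpow_def)

lemma dpow_0 [simp]: "dpow 0 z = 1"
  by (simp add: dpow_def)

lemma dpow_int: "dpow (int m) z = z ^ m / fact m"
  by (simp add: dpow_def)

lemma dpow_mult: "z * dpow n z = of_int (n + 1) * dpow (n + 1) z"
proof (cases "n < 0")
  case True
  then show ?thesis by (cases "n = -1") auto
next
  case False
  then obtain m where n: "n = int m" by (metis linorder_not_less zero_le_imp_eq_int)
  have "dpow (n + 1) z = z ^ Suc m / fact (Suc m)" using n dpow_int[of "Suc m" z] by (simp add: add.commute)
  moreover have "(1 + of_nat m :: complex) \<noteq> 0" by (metis of_nat_Suc of_nat_neq_0)
  ultimately show ?thesis using n
    by (simp add: dpow_int field_simps del: of_nat_Suc) (simp add: algebra_simps)
qed

lemma dpow_deriv: "(dpow n has_field_derivative dpow (n - 1) z) (at z)"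
proof (cases "n \<le> 0")
  case True
  then have "dpow n = (\<lambda>z. if n < 0 then 0 else 1)" by (auto simp: dpow_def fun_eq_iff)
  with True show ?thesis by auto
next
  case False
  then obtain m where n: "n = int (Suc m)" by (metis gr0_conv_Suc linorder_not_less zero_less_imp_eq_int)
  have "((\<lambda>z. z ^ Suc m / fact (Suc m)) has_field_derivative (of_nat (Suc m) * z ^ m / fact (Suc m))) (at z)"
    by (rule derivative_eq_intros refl)+ (auto, metis of_nat_Suc of_nat_neq_0)
  also have "of_nat (Suc m) * z ^ m / fact (Suc m) = dpow (n - 1) z"
  proof -
    have "complex_of_nat (Suc m) * z ^ m / fact (Suc m) = z ^ m / fact m"
      unfolding fact_Suc of_nat_mult by (rule mult_divide_mult_cancel_left[OF of_nat_neq_0])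
    moreover have "n - 1 = int m" using n by simp
    ultimately show ?thesis by (simp only: dpow_int)
  qed
  finally show ?thesis unfolding n dpow_int[abs_def] .
qed

text \<open>The exponents are the entries of a \<open>2 \<times> 2\<close> matrix with column sums \<open>p, q\<close> and row sums \<open>r, p+q-r\<close>;
  such matrices form a one-parameter family, parametrised by the upper left entry \<open>a\<close>.\<close>
definition sterm :: "int \<Rightarrow> int \<Rightarrow> int \<Rightarrow> HC \<Rightarrow> int \<Rightarrow> complex" where
  "sterm p q r Z a = dpow a (Z$1$1) * dpow (r - a) (Z$1$2) * dpow (p - a) (Z$2$1) * dpow (q - r + a) (Z$2$2)"

definition S :: "int \<Rightarrow> int \<Rightarrow> int \<Rightarrow> HC \<Rightarrow> complex" where
  "S p q r Z = (\<Sum>a\<in>{0..r}. sterm p q r Z a)"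

lemma sterm_0: "a < 0 \<or> a > r \<or> a > p \<or> a < r - q \<Longrightarrow> sterm p q r Z a = 0"
  by (auto simp: sterm_def)

text \<open>Terms outside the admissible range vanish, so the range of summation may be enlarged at will. This
  makes shifts of the summation index painless.\<close>
lemma S_range:
  assumes "l \<le> max 0 (r - q)" "min r p \<le> h"
  shows "S p q r Z = (\<Sum>a\<in>{l..h}. sterm p q r Z a)"
proof -
  have "S p q r Z = (\<Sum>a\<in>{max 0 (r-q)..min r p}. sterm p q r Z a)"
    unfolding S_def by (intro sum.mono_neutral_right) (auto intro: sterm_0)
  also have "\<dots> = (\<Sum>a\<in>{l..h}. sterm p q r Z a)"
    using assms by (intro sum.mono_neutral_left) (auto intro!: sterm_0)
  finally show ?thesis .
qed

lemma S_eq_0: "p < 0 \<or> q < 0 \<or> r < 0 \<or> r > p + q \<Longrightarrow> S p q r Z = 0"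
  unfolding S_def by (intro sum.neutral) (auto intro!: sterm_0)

lemma sum_int_shift:
  "(\<Sum>a\<in>{l..h}. f (a + 1)) = (\<Sum>a\<in>{l+1..h+1::int}. f a)"
  by (rule sum.reindex_bij_witness[of _ "\<lambda>a. a - 1" "\<lambda>a. a + 1"]) auto

lemma sum_int_reflect:
  "(\<Sum>a\<in>{l..h}. f (c - a)) = (\<Sum>a\<in>{c-h..c-l::int}. f a)"
  by (rule sum.reindex_bij_witness[of _ "\<lambda>a. c - a" "\<lambda>a. c - a"]) auto

text \<open>Exchanging columns or rows permutes the \<open>S(p,q,r)\<close>. One identity proved for the first column or
  row therefore yields its three companions.\<close>
definition swapcols :: "HC \<Rightarrow> HC" where "swapcols Z = vector [vector [Z$1$2, Z$1$1], vector [Z$2$2, Z$2$1]]"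
definition swaprows :: "HC \<Rightarrow> HC" where "swaprows Z = vector [vector [Z$2$1, Z$2$2], vector [Z$1$1, Z$1$2]]"

lemma swapcols_simps [simp]: "swapcols Z $1$1 = Z$1$2" "swapcols Z $1$2 = Z$1$1"
  "swapcols Z $2$1 = Z$2$2" "swapcols Z $2$2 = Z$2$1" "det (swapcols Z) = - det Z"
  by (auto simp: swapcols_def det_2)

lemma swaprows_simps [simp]: "swaprows Z $1$1 = Z$2$1" "swaprows Z $1$2 = Z$2$2"
  "swaprows Z $2$1 = Z$1$1" "swaprows Z $2$2 = Z$1$2" "det (swaprows Z) = - det Z"
  by (auto simp: swaprows_def det_2)

lemma S_swapcols [simp]: "S p q r (swapcols Z) = S q p r Z"
proof -
  have "sterm p q r (swapcols Z) a = sterm q p r Z (r - a)" for a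
    by (simp add: sterm_def algebra_simps)
  then have "S p q r (swapcols Z) = (\<Sum>a\<in>{0..r}. sterm q p r Z (r - a))"
    by (simp add: S_def)
  also have "\<dots> = S q p r Z" by (subst sum_int_reflect) (simp add: S_def)
  finally show ?thesis .
qed

lemma S_swaprows [simp]: "S p q r (swaprows Z) = S p q (p + q - r) Z"
proof -
  have "sterm p q r (swaprows Z) a = sterm p q (p + q - r) Z (p - a)" for a
    by (simp add: sterm_def algebra_simps)
  then have "S p q r (swaprows Z) = (\<Sum>a\<in>{r-q..r}. sterm p q (p+q-r) Z (p - a))"
    by (subst S_range[where l="r-q" and h=r]) auto
  also have "\<dots> = S p q (p+q-r) Z" by (subst sum_int_reflect, subst S_range[where l="p - r" and h="p+q-r"]) (auto simp: algebra_simps)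
  finally show ?thesis .
qed

lemma sterm_mult11: "Z$1$1 * sterm p q r Z a = of_int (a+1) * sterm (p+1) q (r+1) Z (a+1)"
proof -
  have e: "r + 1 - (a + 1) = r - a" "p + 1 - (a + 1) = p - a" "q - (r + 1) + (a + 1) = q - r + a" by auto
  show ?thesis unfolding sterm_def e by (simp add: mult.assoc[symmetric] dpow_mult del: of_int_add)
qed

lemma sterm_mult12: "Z$1$2 * sterm p q r Z a = of_int (r-a+1) * sterm p (q+1) (r+1) Z a"
proof -
  have e: "r + 1 - a = r - a + 1" "q + 1 - (r + 1) + a = q - r + a" by auto
  have "Z$1$2 * sterm p q r Z a = (Z$1$2 * dpow (r - a) (Z$1$2)) * (dpow a (Z$1$1) * dpow (p - a) (Z$2$1) * dpow (q - r + a) (Z$2$2))"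
    by (simp add: sterm_def)
  then show ?thesis unfolding dpow_mult sterm_def e by (simp only: ac_simps)
qed

lemma sterm_mult21: "Z$2$1 * sterm p q r Z a = of_int (p-a+1) * sterm (p+1) q r Z a"
proof -
  have e: "p + 1 - a = p - a + 1" by auto
  have "Z$2$1 * sterm p q r Z a = (Z$2$1 * dpow (p - a) (Z$2$1)) * (dpow a (Z$1$1) * dpow (r - a) (Z$1$2) * dpow (q - r + a) (Z$2$2))"
    by (simp add: sterm_def)
  then show ?thesis unfolding dpow_mult sterm_def e by (simp only: ac_simps)
qed

text \<open>Multiplication of a term by \<open>z\<^sub>1\<^sub>1\<close> or \<open>z\<^sub>1\<^sub>2\<close> raises an exponent \<open>n\<close> at the cost of a factor \<open>n+1\<close>; the
  two factors add up to the first row sum \<open>r+1\<close>.\<close>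
lemma S_row1: "Z$1$1 * S (p-1) q r Z + Z$1$2 * S p (q-1) r Z = of_int (r+1) * S p q (r+1) Z"
proof -
  have "Z$1$1 * S (p-1) q r Z = (\<Sum>a\<in>{-1..r+1}. Z$1$1 * sterm (p-1) q r Z a)"
    by (subst S_range[where l="-1" and h="r+1"]) (auto simp: sum_distrib_left)
  also have "\<dots> = (\<Sum>a\<in>{-1..r+1}. of_int (a+1) * sterm p q (r+1) Z (a+1))"
    by (intro sum.cong refl, subst sterm_mult11) (simp add: algebra_simps)
  also have "\<dots> = (\<Sum>a\<in>{0..r+2}. of_int a * sterm p q (r+1) Z a)"
    by (subst sum_int_shift) (simp add: algebra_simps)
  finally have 1: "Z$1$1 * S (p-1) q r Z = (\<Sum>a\<in>{0..r+2}. of_int a * sterm p q (r+1) Z a)" .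
  have "Z$1$2 * S p (q-1) r Z = (\<Sum>a\<in>{0..r+2}. Z$1$2 * sterm p (q-1) r Z a)"
    by (subst S_range[where l="0" and h="r+2"]) (auto simp: sum_distrib_left)
  also have "\<dots> = (\<Sum>a\<in>{0..r+2}. of_int (r+1-a) * sterm p q (r+1) Z a)"
    by (intro sum.cong refl, subst sterm_mult12) (simp add: algebra_simps)
  finally have 2: "Z$1$2 * S p (q-1) r Z = (\<Sum>a\<in>{0..r+2}. of_int (r+1-a) * sterm p q (r+1) Z a)" .
  have "of_int (r+1) * S p q (r+1) Z = (\<Sum>a\<in>{0..r+2}. of_int (r+1) * sterm p q (r+1) Z a)"
    by (subst S_range[where l="0" and h="r+2"]) (auto simp: sum_distrib_left)
  then show ?thesis unfolding 1 2 by (simp add: sum.distrib[symmetric] algebra_simps)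
qed

lemma S_row2: "Z$2$1 * S (p-1) q r Z + Z$2$2 * S p (q-1) r Z = of_int (p+q-r) * S p q r Z"
  using S_row1[of "swaprows Z" p q "p+q-r-1"] by (simp add: algebra_simps)

lemma S_col1: "Z$1$1 * S p q (r-1) Z + Z$2$1 * S p q r Z = of_int (p+1) * S (p+1) q r Z"
proof -
  have "Z$1$1 * S p q (r-1) Z = (\<Sum>a\<in>{-1..r}. Z$1$1 * sterm p q (r-1) Z a)"
    by (subst S_range[where l="-1" and h="r"]) (auto simp: sum_distrib_left)
  also have "\<dots> = (\<Sum>a\<in>{-1..r}. of_int (a+1) * sterm (p+1) q r Z (a+1))"
    by (intro sum.cong refl, subst sterm_mult11) (simp add: algebra_simps)
  also have "\<dots> = (\<Sum>a\<in>{0..r+1}. of_int a * sterm (p+1) q r Z a)"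
    by (subst sum_int_shift) (simp add: algebra_simps)
  finally have 1: "Z$1$1 * S p q (r-1) Z = (\<Sum>a\<in>{0..r+1}. of_int a * sterm (p+1) q r Z a)" .
  have "Z$2$1 * S p q r Z = (\<Sum>a\<in>{0..r+1}. Z$2$1 * sterm p q r Z a)"
    by (subst S_range[where l="0" and h="r+1"]) (auto simp: sum_distrib_left)
  also have "\<dots> = (\<Sum>a\<in>{0..r+1}. of_int (p+1-a) * sterm (p+1) q r Z a)"
    by (intro sum.cong refl, subst sterm_mult21) (simp add: algebra_simps)
  finally have 2: "Z$2$1 * S p q r Z = (\<Sum>a\<in>{0..r+1}. of_int (p+1-a) * sterm (p+1) q r Z a)" .
  have "of_int (p+1) * S (p+1) q r Z = (\<Sum>a\<in>{0..r+1}. of_int (p+1) * sterm (p+1) q r Z a)"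
    by (subst S_range[where l="0" and h="r+1"]) (auto simp: sum_distrib_left)
  then show ?thesis unfolding 1 2 by (simp add: sum.distrib[symmetric] algebra_simps)
qed

lemma S_col2: "Z$1$2 * S p q (r-1) Z + Z$2$2 * S p q r Z = of_int (q+1) * S p (q+1) r Z"
  using S_col1[of "swapcols Z" q p r] by simp

text \<open>This is the decomposition of (coordinate) tensor (degree \<open>d\<close>) into degree \<open>d+1\<close> and, with a factor
  \<open>N(Z)\<close>, degree \<open>d-1\<close>. It follows by eliminating \<open>z\<^sub>1\<^sub>2 S(p+1,q-1,r)\<close> from row and column relations.\<close>
lemma S_mult11: "of_int (p+q+1) * (Z$1$1 * S p q r Z)
    = of_int ((r+1)*(p+1)) * S (p+1) q (r+1) Z + det Z * S p (q-1) r Z"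
proof -
  have r1: "Z$1$1 * S p q r Z + Z$1$2 * S (p+1) (q-1) r Z = of_int (r+1) * S (p+1) q (r+1) Z"
    using S_row1[of Z "p+1" q r] by simp
  have c1: "Z$1$1 * S p (q-1) r Z + Z$2$1 * S p (q-1) (r+1) Z = of_int (p+1) * S (p+1) (q-1) (r+1) Z"
    using S_col1[of Z p "q-1" "r+1"] by simp
  have c2: "Z$1$1 * S p (q-1) (r-1) Z + Z$2$1 * S p (q-1) r Z = of_int (p+1) * S (p+1) (q-1) r Z"
    using S_col1[of Z p "q-1" "r"] by simp
  have c3: "Z$1$2 * S p (q-1) (r-1) Z + Z$2$2 * S p (q-1) r Z = of_int q * S p q r Z"
    using S_col2[of Z p "q-1" r] by simp
  have "of_int (p+1) * (Z$1$2 * S (p+1) (q-1) r Z) =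
     Z$1$2 * (Z$1$1 * S p (q-1) (r-1) Z + Z$2$1 * S p (q-1) r Z)"
    unfolding c2 by (simp add: algebra_simps)
  also have "\<dots> = Z$1$1 * (of_int q * S p q r Z) - det Z * S p (q-1) r Z"
    unfolding c3[symmetric] by (simp add: det_2 algebra_simps)
  finally have A: "of_int (p+1) * (Z$1$2 * S (p+1) (q-1) r Z) = Z$1$1 * (of_int q * S p q r Z) - det Z * S p (q-1) r Z" .
  have "of_int ((r+1)*(p+1)) * S (p+1) q (r+1) Z = of_int (p+1) * (Z$1$1 * S p q r Z + Z$1$2 * S (p+1) (q-1) r Z)"
    unfolding r1 by (simp add: algebra_simps)
  with A show ?thesis by (simp add: algebra_simps)
qed

lemma S_mult12: "of_int (p+q+1) * (Z$1$2 * S p q r Z)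
    = of_int ((r+1)*(q+1)) * S p (q+1) (r+1) Z - det Z * S (p-1) q r Z"
  using S_mult11[of q p "swapcols Z" r] by (simp add: algebra_simps)

lemma S_mult21: "of_int (p+q+1) * (Z$2$1 * S p q r Z)
    = of_int ((p+q-r+1)*(p+1)) * S (p+1) q r Z - det Z * S p (q-1) (r-1) Z"
  using S_mult11[of p q "swaprows Z" "p+q-r"] by (simp add: algebra_simps)

lemma S_mult22: "of_int (p+q+1) * (Z$2$2 * S p q r Z)
    = of_int ((p+q-r+1)*(q+1)) * S p (q+1) r Z + det Z * S (p-1) q (r-1) Z"
  using S_mult12[of p q "swaprows Z" "p+q-r"] by (simp add: algebra_simps)

definition adj :: "HC \<Rightarrow> HC" where "adj Z = vector [vector [Z$2$2, - Z$1$2], vector [- Z$2$1, Z$1$1]]"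

lemma adj_simps [simp]: "adj Z $1$1 = Z$2$2" "adj Z $1$2 = - Z$1$2"
  "adj Z $2$1 = - Z$2$1" "adj Z $2$2 = Z$1$1" "det (adj Z) = det Z"
  by (auto simp: adj_def det_2)

definition sg :: "int \<Rightarrow> complex" where "sg n = (if even n then 1 else -1)"

lemma sg_add: "sg (m + n) = sg m * sg n" and sg_0 [simp]: "sg 0 = 1" and sg_1 [simp]: "sg 1 = -1"
   and sg_minus: "sg (- n) = sg n" and sg_diff: "sg (m - n) = sg m * sg n" and sg_sq [simp]: "sg n * sg n = 1"
  by (auto simp: sg_def)

lemma dpow_minus: "dpow n (- z) = sg n * dpow n z"
  by (auto simp: dpow_def sg_def even_nat_iff power_minus_odd power_minus_even)

text \<open>The adjugate exchanges the diagonal entries and negates the others. In terms of the exponents this is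
  a reflection that exchanges row sums and column sums.\<close>
lemma S_adj: "S p q r (adj Z) = sg (p + r) * S (p+q-r) r q Z"
proof -
  have *: "sterm p q r (adj Z) a = sg (p + r) * sterm (p+q-r) r q Z (q - r + a)" for a
    by (simp add: sterm_def dpow_minus sg_diff sg_add algebra_simps sg_def)
  have "S p q r (adj Z) = (\<Sum>a\<in>{r-q..r}. sg (p+r) * sterm (p+q-r) r q Z (q-r+a))"
    by (subst S_range[where l="r-q" and h=r]) (auto simp: *)
  also have "\<dots> = sg (p+r) * (\<Sum>a\<in>{0..q}. sterm (p+q-r) r q Z a)"
    unfolding sum_distrib_left[symmetric]
    by (intro arg_cong2[where f="(*)"] refl sum.reindex_bij_witness[of _ "\<lambda>a. a - (q-r)" "\<lambda>a. q-r+a"]) auto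
  finally show ?thesis by (simp add: S_def)
qed

section \<open>The functions E and their derivatives\<close>

interpretation fs: vector_space "\<lambda>c (f :: HC \<Rightarrow> complex) Z. c * f Z"
  by unfold_locales (auto simp: fun_eq_iff algebra_simps)

lemma cspan_eq: "cspan = fs.span" by (simp add: cspan_def)

type_synonym idx = "int \<times> int \<times> int \<times> int"

fun E :: "idx \<Rightarrow> HC \<Rightarrow> complex" where
  "E (k, p, q, r) = on_units (\<lambda>Z. det Z powi k * S p q r Z)"

declare E.simps [simp del]

lemma E_unit: "det Z \<noteq> 0 \<Longrightarrow> E (k,p,q,r) Z = det Z powi k * S p q r Z"
  by (simp add: E.simps on_units_def)

lemma E_sing: "det Z = 0 \<Longrightarrow> E i Z = 0"
  by (cases i) (simp add: E.simps on_units_def)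

lemma entry_has_derivative: "((\<lambda>Z::HC. Z$i$j) has_derivative (\<lambda>V. V$i$j)) (at Z)"
  by (intro bounded_linear_imp_has_derivative bounded_linear_compose[OF bounded_linear_vec_nth bounded_linear_vec_nth])

lemma dpow_entry_has_derivative:
  "((\<lambda>Z::HC. dpow n (Z$i$j)) has_derivative (\<lambda>V. dpow (n-1) (Z$i$j) * V$i$j)) (at Z)"
  by (rule has_derivative_compose[OF entry_has_derivative dpow_deriv[unfolded has_field_derivative_def]])

text \<open>The differential of \<open>S(p,q,r)\<close>: a divided power differentiates to the previous divided power, so the
  partial derivatives of \<open>S\<close> are again functions \<open>S\<close>.\<close>
definition S_diff :: "int \<Rightarrow> int \<Rightarrow> int \<Rightarrow> HC \<Rightarrow> HC \<Rightarrow> complex" where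
  "S_diff p q r Z V = S (p-1) q (r-1) Z * V$1$1 + S p (q-1) (r-1) Z * V$1$2
                  + S (p-1) q r Z * V$2$1 + S p (q-1) r Z * V$2$2"

lemma sterm_has_derivative:
  "((\<lambda>Z. sterm p q r Z a) has_derivative (\<lambda>V. sterm (p-1) q (r-1) Z (a-1) * V$1$1 + sterm p (q-1) (r-1) Z a * V$1$2
                  + sterm (p-1) q r Z a * V$2$1 + sterm p (q-1) r Z a * V$2$2)) (at Z)"
proof -
  have e: "r - 1 - (a - 1) = r - a" "p - 1 - (a - 1) = p - a" "q - (r - 1) + (a - 1) = q - r + a"
    "r - 1 - a = r - a - 1" "p - 1 - a = p - a - 1" "q - 1 - r + a = q - r + a - 1"
    "q - 1 - (r - 1) + a = q - r + a" by auto
  have "((\<lambda>Z. sterm p q r Z a) has_derivative (\<lambda>V.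
     dpow a (Z$1$1) * dpow (r - a) (Z$1$2) * dpow (p - a) (Z$2$1) * (dpow (q - r + a - 1) (Z$2$2) * V$2$2)
   + (dpow a (Z$1$1) * dpow (r - a) (Z$1$2) * (dpow (p - a - 1) (Z$2$1) * V$2$1)
     + (dpow a (Z$1$1) * (dpow (r - a - 1) (Z$1$2) * V$1$2) + (dpow (a - 1) (Z$1$1) * V$1$1) * dpow (r - a) (Z$1$2))
        * dpow (p - a) (Z$2$1)) * dpow (q - r + a) (Z$2$2))) (at Z)"
    unfolding sterm_def
    by (intro has_derivative_mult dpow_entry_has_derivative)
  then show ?thesis unfolding sterm_def e
    apply (rule has_derivative_eq_rhs) apply (rule ext) subgoal by algebra done
qed

lemma S_has_derivative: "(S p q r has_derivative S_diff p q r Z) (at Z)"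
proof -
  have 1: "(\<Sum>a\<in>{0..r}. sterm (p-1) q (r-1) Z (a-1)) = S (p-1) q (r-1) Z"
    using sum_int_shift[of "\<lambda>a. sterm (p-1) q (r-1) Z (a-1)" "-1" "r-1"]
    by (subst S_range[where l="-1" and h="r-1"]) auto
  have 2: "(\<Sum>a\<in>{0..r}. sterm p (q-1) (r-1) Z a) = S p (q-1) (r-1) Z"
    by (subst S_range[where l="0" and h="r"]) auto
  have d: "((\<lambda>Z. \<Sum>a\<in>{0..r}. sterm p q r Z a) has_derivative
     (\<lambda>V. \<Sum>a\<in>{0..r}. sterm (p-1) q (r-1) Z (a-1) * V$1$1 + sterm p (q-1) (r-1) Z a * V$1$2
                  + sterm (p-1) q r Z a * V$2$1 + sterm p (q-1) r Z a * V$2$2)) (at Z)"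
    by (intro has_derivative_sum sterm_has_derivative)
  have e: "(\<lambda>Z. \<Sum>a\<in>{0..r}. sterm p q r Z a) = S p q r" by (rule ext) (simp only: S_def)
  have f: "(\<Sum>a\<in>{0..r}. sterm (p-1) q (r-1) Z (a-1) * V$1$1 + sterm p (q-1) (r-1) Z a * V$1$2
                  + sterm (p-1) q r Z a * V$2$1 + sterm p (q-1) r Z a * V$2$2) = S_diff p q r Z V" for V
    by (simp only: sum.distrib sum_distrib_right[symmetric] 1 2 S_def[symmetric] S_diff_def)
  show ?thesis using d unfolding e f .
qed

definition ddet :: "HC \<Rightarrow> HC \<Rightarrow> complex" where
  "ddet Z V = Z$2$2 * V$1$1 - Z$2$1 * V$1$2 - Z$1$2 * V$2$1 + Z$1$1 * V$2$2"

lemma det_has_derivative: "((det :: HC \<Rightarrow> complex) has_derivative ddet Z) (at Z)"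
proof -
  have "((\<lambda>Z :: HC. Z$1$1 * Z$2$2 - Z$1$2 * Z$2$1) has_derivative ddet Z) (at Z)"
    by (rule has_derivative_eq_rhs[OF has_derivative_diff[OF
          has_derivative_mult[OF entry_has_derivative entry_has_derivative]
          has_derivative_mult[OF entry_has_derivative entry_has_derivative]]])
       (simp add: fun_eq_iff algebra_simps ddet_def)
  then show ?thesis by (simp add: det_2[abs_def])
qed

lemma det_powi_has_derivative:
  assumes "det (Z::HC) \<noteq> 0"
  shows "((\<lambda>Z. det Z powi k) has_derivative (\<lambda>V. of_int k * det Z powi (k-1) * ddet Z V)) (at Z)"
proof -
  have "((\<lambda>x. x powi k) has_field_derivative of_int k * det Z powi (k-1) * 1) (at (det Z))"
    using assms by (intro DERIV_power_int DERIV_ident) simp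
  then show ?thesis
    using has_derivative_compose[OF det_has_derivative[of Z], of "\<lambda>x. x powi k"]
    by (simp add: has_field_derivative_def)
qed

lemma open_units: "open {Z :: HC. det Z \<noteq> 0}"
proof -
  have "continuous_on UNIV (det :: HC \<Rightarrow> complex)"
    by (rule has_derivative_continuous_on) (use det_has_derivative in \<open>auto intro: has_derivative_at_withinI\<close>)
  then show ?thesis
    by (intro open_Collect_neq) (auto intro: continuous_intros)
qed

lemma on_units_has_derivative:
  assumes "(f has_derivative D) (at Z)" "det Z \<noteq> 0"
  shows "(on_units f has_derivative D) (at Z)"
  by (rule has_derivative_transform_within_open[OF assms(1) open_units]) (use assms in \<open>auto simp: on_units_def\<close>)

definition dE :: "idx \<Rightarrow> HC \<Rightarrow> HC \<Rightarrow> complex" where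
  "dE i Z V = (case i of (k,p,q,r) \<Rightarrow> of_int k * det Z powi (k-1) * ddet Z V * S p q r Z + det Z powi k * S_diff p q r Z V)"

lemma E_has_derivative: "det Z \<noteq> 0 \<Longrightarrow> (E i has_derivative dE i Z) (at Z)"
proof (cases i)
  case (fields k p q r)
  assume Z: "det Z \<noteq> 0"
  have "((\<lambda>Z. det Z powi k * S p q r Z) has_derivative dE i Z) (at Z)"
    by (rule has_derivative_eq_rhs[OF has_derivative_mult[OF det_powi_has_derivative[OF Z] S_has_derivative]])
       (simp add: fun_eq_iff algebra_simps dE_def fields)
  then show ?thesis unfolding fields E.simps by (intro on_units_has_derivative Z)
qed

text \<open>Operators on the span of the \<open>E\<close> are described by formal combinations rather than functions, so that
  their coefficients can be computed with before linear independence is known.\<close>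
definition lin :: "(complex \<times> idx) list \<Rightarrow> HC \<Rightarrow> complex" where
  "lin xs Z = (\<Sum>(c, i)\<leftarrow>xs. c * E i Z)"

definition U :: "2 \<Rightarrow> 2 \<Rightarrow> HC" where "U a b = (\<chi> i j. if i = a \<and> j = b then 1 else 0)"

abbreviation (input) ci :: "int \<Rightarrow> complex" where "ci \<equiv> of_int"

text \<open>The vector fields \<open>U\<close>, \<open>UZ\<close>, \<open>ZU\<close> and \<open>ZUZ\<close>, with \<open>U\<close> a matrix unit, span the image of the Lie
  algebra. The four operators below are their actions on \<open>E (k,p,q,r)\<close>.\<close>
fun trans_op :: "2 \<Rightarrow> 2 \<Rightarrow> idx \<Rightarrow> (complex \<times> idx) list" where
  "trans_op a b (k,p,q,r) = (
     if a = 1 \<and> b = 1 then [(ci (k*(p+q-r+1)*(q+1)) / ci (p+q+1), (k-1,p,q+1,r)), (ci (k+p+q+1) / ci (p+q+1), (k,p-1,q,r-1))]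
     else if a = 1 then [(- ci (k*(p+q-r+1)*(p+1)) / ci (p+q+1), (k-1,p+1,q,r)), (ci (k+p+q+1) / ci (p+q+1), (k,p,q-1,r-1))]
     else if b = 1 then [(- ci (k*(r+1)*(q+1)) / ci (p+q+1), (k-1,p,q+1,r+1)), (ci (k+p+q+1) / ci (p+q+1), (k,p-1,q,r))]
     else [(ci (k*(r+1)*(p+1)) / ci (p+q+1), (k-1,p+1,q,r+1)), (ci (k+p+q+1) / ci (p+q+1), (k,p,q-1,r))])"

fun left_op :: "2 \<Rightarrow> 2 \<Rightarrow> idx \<Rightarrow> (complex \<times> idx) list" where
  "left_op a b (k,p,q,r) = (
     if a = 1 \<and> b = 1 then [(ci (k + r), (k,p,q,r))]
     else if a = 1 then [(ci (r+1), (k,p,q,r+1))]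
     else if b = 1 then [(ci (p+q-r+1), (k,p,q,r-1))]
     else [(ci (k+p+q-r), (k,p,q,r))])"

fun right_op :: "2 \<Rightarrow> 2 \<Rightarrow> idx \<Rightarrow> (complex \<times> idx) list" where
  "right_op a b (k,p,q,r) = (
     if a = 1 \<and> b = 1 then [(ci (k + p), (k,p,q,r))]
     else if a = 1 then [(ci (p+1), (k,p+1,q-1,r))]
     else if b = 1 then [(ci (q+1), (k,p-1,q+1,r))]
     else [(ci (k+q), (k,p,q,r))])"

fun spec_op :: "2 \<Rightarrow> 2 \<Rightarrow> idx \<Rightarrow> (complex \<times> idx) list" where
  "spec_op a b (k,p,q,r) = (
     if a = 1 \<and> b = 1 then [(ci ((k+p+q)*(r+1)*(p+1)) / ci (p+q+1), (k,p+1,q,r+1)), (ci (k-1) / ci (p+q+1), (k+1,p,q-1,r))]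
     else if a = 1 then [(ci ((k+p+q)*(p+q-r+1)*(p+1)) / ci (p+q+1), (k,p+1,q,r)), (- ci (k-1) / ci (p+q+1), (k+1,p,q-1,r-1))]
     else if b = 1 then [(ci ((k+p+q)*(r+1)*(q+1)) / ci (p+q+1), (k,p,q+1,r+1)), (- ci (k-1) / ci (p+q+1), (k+1,p-1,q,r))]
     else [(ci ((k+p+q)*(p+q-r+1)*(q+1)) / ci (p+q+1), (k,p,q+1,r)), (ci (k-1) / ci (p+q+1), (k+1,p-1,q,r-1))])"

declare trans_op.simps [simp del] left_op.simps [simp del] right_op.simps [simp del] spec_op.simps [simp del]

lemma two_neq_one [simp]: "(2::2) \<noteq> 1" "(1::2) \<noteq> 2" by auto

lemma U_simps [simp]: "U a b $ i $ j = (if i = a \<and> j = b then 1 else 0)" by (simp add: U_def)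

lemma mult_2_entry: "(A ** (B::HC)) $ i $ j = A$i$1 * B$1$j + A$i$2 * B$2$j"
  by (simp add: matrix_matrix_mult_def UNIV_2 sum_2)

lemma powi_minus_1: "(x::complex) \<noteq> 0 \<Longrightarrow> x powi k = x * x powi (k-1)"
  by (metis power_int_minus_mult mult.commute)

lemma powi_plus_1: "(x::complex) \<noteq> 0 \<Longrightarrow> x powi (k+1) = x * x powi k"
  by (simp add: power_int_add)

lemma matrix_entries_eqI:
  "(A :: HC)$1$1 = B$1$1 \<Longrightarrow> A$1$2 = B$1$2 \<Longrightarrow> A$2$1 = B$2$1 \<Longrightarrow> A$2$2 = B$2$2 \<Longrightarrow> A = B"
  by (simp add: vec_eq_iff forall_2)

context
  fixes k p q r :: int and Z :: HC
  assumes Z: "det Z \<noteq> 0" and pq: "p + q + 1 \<noteq> 0"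
begin

private lemma N: "det Z powi k = det Z * det Z powi (k-1)" using Z by (rule powi_minus_1)
private lemma N': "det Z powi (k+1) = det Z * (det Z * det Z powi (k-1))" using Z N by (simp add: powi_plus_1)

private lemma frac:
  assumes "ci (p+q+1) * x = a * y + u * v" shows "x = a / ci (p+q+1) * y + (u / ci (p+q+1) * v + 0)"
proof -
  have "ci (p+q+1) \<noteq> 0" using pq by (metis of_int_eq_0_iff)
  with assms show ?thesis by (simp add: field_simps del: of_int_add)
qed

private lemmas pre = lin_def E_unit[OF Z] list.map sum_list.Cons sum_list.Nil prod.case simp_thms if_True if_False
   one_neq_zero two_neq_one
private lemmas post = dE_def ddet_def S_diff_def N N' mult_2_entry

lemma trans_op_dE: "dE (k,p,q,r) Z (U a b) = lin (trans_op a b (k,p,q,r)) Z"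
proof -
  have "dE (k,p,q,r) Z (U 1 1) = lin (trans_op 1 1 (k,p,q,r)) Z"
    apply (simp only: pre trans_op.simps)
    apply (rule frac)
    apply (simp add: post del: mult_cancel_left mult_cancel_right)
    using S_mult22[of p q Z r] det_2[of Z] by (simp del: mult_cancel_left mult_cancel_right, algebra)
  moreover have "dE (k,p,q,r) Z (U 1 2) = lin (trans_op 1 2 (k,p,q,r)) Z"
    apply (simp only: pre trans_op.simps)
    apply (rule frac)
    apply (simp add: post del: mult_cancel_left mult_cancel_right)
    using S_mult21[of p q Z r] det_2[of Z] by (simp del: mult_cancel_left mult_cancel_right, algebra)
  moreover have "dE (k,p,q,r) Z (U 2 1) = lin (trans_op 2 1 (k,p,q,r)) Z"
    apply (simp only: pre trans_op.simps)
    apply (rule frac)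
    apply (simp add: post del: mult_cancel_left mult_cancel_right)
    using S_mult12[of p q Z r] det_2[of Z] by (simp del: mult_cancel_left mult_cancel_right, algebra)
  moreover have "dE (k,p,q,r) Z (U 2 2) = lin (trans_op 2 2 (k,p,q,r)) Z"
    apply (simp only: pre trans_op.simps)
    apply (rule frac)
    apply (simp add: post del: mult_cancel_left mult_cancel_right)
    using S_mult11[of p q Z r] det_2[of Z] by (simp del: mult_cancel_left mult_cancel_right, algebra)
  ultimately show ?thesis
    using exhaust_2[of a] exhaust_2[of b] by auto
qed

lemma left_op_dE: "dE (k,p,q,r) Z (U b a ** Z) = lin (left_op a b (k,p,q,r)) Z"
proof -
  have "dE (k,p,q,r) Z (U 1 1 ** Z) = lin (left_op 1 1 (k,p,q,r)) Z"
    apply (simp only: pre left_op.simps)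
    apply (simp add: post del: mult_cancel_left mult_cancel_right)
    using S_row1[of Z p q "r-1"] det_2[of Z] by (simp del: mult_cancel_left mult_cancel_right, algebra)
  moreover have "dE (k,p,q,r) Z (U 2 1 ** Z) = lin (left_op 1 2 (k,p,q,r)) Z"
    apply (simp only: pre left_op.simps)
    apply (simp add: post)
    using S_row1[of Z p q r] det_2[of Z] by (simp add: algebra_simps)
  moreover have "dE (k,p,q,r) Z (U 1 2 ** Z) = lin (left_op 2 1 (k,p,q,r)) Z"
    apply (simp only: pre left_op.simps)
    apply (simp add: post)
    using S_row2[of Z p q "r-1"] det_2[of Z] by (simp add: algebra_simps)
  moreover have "dE (k,p,q,r) Z (U 2 2 ** Z) = lin (left_op 2 2 (k,p,q,r)) Z"
    apply (simp only: pre left_op.simps)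
    apply (simp add: post del: mult_cancel_left mult_cancel_right)
    using S_row2[of Z p q r] det_2[of Z] by (simp del: mult_cancel_left mult_cancel_right, algebra)
  ultimately show ?thesis
    using exhaust_2[of a] exhaust_2[of b] by auto
qed

lemma right_op_dE: "dE (k,p,q,r) Z (Z ** U a b) = lin (right_op a b (k,p,q,r)) Z"
proof -
  have "dE (k,p,q,r) Z (Z ** U 1 1) = lin (right_op 1 1 (k,p,q,r)) Z"
    apply (simp only: pre right_op.simps)
    apply (simp add: post del: mult_cancel_left mult_cancel_right)
    using S_col1[of Z "p-1" q r] det_2[of Z] by (simp del: mult_cancel_left mult_cancel_right, algebra)
  moreover have "dE (k,p,q,r) Z (Z ** U 1 2) = lin (right_op 1 2 (k,p,q,r)) Z"
    apply (simp only: pre right_op.simps)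
    apply (simp add: post)
    using S_col1[of Z p "q-1" r] det_2[of Z] by (simp add: algebra_simps)
  moreover have "dE (k,p,q,r) Z (Z ** U 2 1) = lin (right_op 2 1 (k,p,q,r)) Z"
    apply (simp only: pre right_op.simps)
    apply (simp add: post)
    using S_col2[of Z "p-1" q r] det_2[of Z] by (simp add: algebra_simps)
  moreover have "dE (k,p,q,r) Z (Z ** U 2 2) = lin (right_op 2 2 (k,p,q,r)) Z"
    apply (simp only: pre right_op.simps)
    apply (simp add: post del: mult_cancel_left mult_cancel_right)
    using S_col2[of Z p "q-1" r] det_2[of Z] by (simp del: mult_cancel_left mult_cancel_right, algebra)
  ultimately show ?thesis
    using exhaust_2[of a] exhaust_2[of b] by auto
qed

lemma spec_op_dE: "dE (k,p,q,r) Z (Z ** U a b ** Z) = lin (spec_op a b (k,p,q,r)) Z"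
proof -
  have "dE (k,p,q,r) Z (Z ** U 1 1 ** Z) = lin (spec_op 1 1 (k,p,q,r)) Z"
    apply (simp only: pre spec_op.simps)
    apply (rule frac)
    apply (simp add: post del: mult_cancel_left mult_cancel_right)
    using S_mult11[of p q Z r] S_row1[of Z p q "r-1"] S_row1[of Z p q r] S_mult21[of p q Z "r+1"] det_2[of Z] by (simp del: mult_cancel_left mult_cancel_right, algebra)
  moreover have "dE (k,p,q,r) Z (Z ** U 1 2 ** Z) = lin (spec_op 1 2 (k,p,q,r)) Z"
    apply (simp only: pre spec_op.simps)
    apply (rule frac)
    apply (simp add: post del: mult_cancel_left mult_cancel_right)
    using S_mult21[of p q Z r] S_row2[of Z p q "r-1"] S_row2[of Z p q r] S_mult11[of p q Z "r-1"] det_2[of Z] by (simp del: mult_cancel_left mult_cancel_right, algebra)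
  moreover have "dE (k,p,q,r) Z (Z ** U 2 1 ** Z) = lin (spec_op 2 1 (k,p,q,r)) Z"
    apply (simp only: pre spec_op.simps)
    apply (rule frac)
    apply (simp add: post del: mult_cancel_left mult_cancel_right)
    using S_mult12[of p q Z r] S_row1[of Z p q "r-1"] S_row1[of Z p q r] S_mult22[of p q Z "r+1"] det_2[of Z] by (simp del: mult_cancel_left mult_cancel_right, algebra)
  moreover have "dE (k,p,q,r) Z (Z ** U 2 2 ** Z) = lin (spec_op 2 2 (k,p,q,r)) Z"
    apply (simp only: pre spec_op.simps)
    apply (rule frac)
    apply (simp add: post del: mult_cancel_left mult_cancel_right)
    using S_mult22[of p q Z r] S_row2[of Z p q "r-1"] S_row2[of Z p q r] S_mult12[of p q Z "r-1"] det_2[of Z] by (simp del: mult_cancel_left mult_cancel_right, algebra)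
  ultimately show ?thesis
    using exhaust_2[of a] exhaust_2[of b] by auto
qed

end

section \<open>Linear combinations of the functions E\<close>

definition II :: "idx set" where
  "II = {(k,p,q,r). 0 \<le> p \<and> 0 \<le> q \<and> 0 \<le> r \<and> r \<le> p + q}"

text \<open>The index set \<open>II\<close> consists of the integer column and row sums that occur for matrices of natural
  numbers; for all other indices
  some exponent is negative in every term.\<close>
lemma E_outside: "i \<notin> II \<Longrightarrow> E i = (\<lambda>Z. 0)"
  by (cases i) (auto simp: fun_eq_iff E.simps on_units_def II_def S_eq_0)

lemma span_zero': "(\<lambda>Z. 0) \<in> fs.span B"
  using fs.span_zero[of B] unfolding zero_fun_def .
lemma E_in_span: "E i \<in> fs.span (E ` II)"
proof (cases "i \<in> II")
  case True
  then show ?thesis by (intro fs.span_base) auto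
next
  case False
  show ?thesis unfolding E_outside[OF False] by (rule span_zero')
qed

lemma lin_Nil [simp]: "lin [] = (\<lambda>Z. 0)" by (simp add: lin_def fun_eq_iff)
lemma lin_Cons: "lin (x # xs) = (\<lambda>Z. fst x * E (snd x) Z + lin xs Z)"
  by (auto simp: lin_def fun_eq_iff split: prod.splits)
lemma lin_append: "lin (xs @ ys) = (\<lambda>Z. lin xs Z + lin ys Z)"
  by (auto simp: lin_def fun_eq_iff)

lemmas span_add' = fs.span_add[unfolded plus_fun_def]

lemma span_induct_E [consumes 1, case_names zero step]:
  assumes "f \<in> fs.span (E ` A)" "P (\<lambda>Z. 0)"
    "\<And>c i g. i \<in> A \<Longrightarrow> g \<in> fs.span (E ` A) \<Longrightarrow> P g \<Longrightarrow> P (\<lambda>Z. c * E i Z + g Z)"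
  shows "P f"
proof -
  have "f \<in> fs.span (E ` A) \<and> P f"
    using assms(1)
  proof (induction rule: fs.span_induct_alt)
    case base
    show ?case using assms(2) unfolding zero_fun_def by (simp add: span_zero')
  next
    case (step c x y)
    then obtain i where i: "i \<in> A" "x = E i" by blast
    have "(\<lambda>Z. c * E i Z + y Z) \<in> fs.span (E ` A)"
      using step i by (intro span_add'[OF fs.span_scale[OF fs.span_base]]) auto
    with assms(3)[of i y c] step i show ?case unfolding plus_fun_def by simp
  qed
  then show ?thesis ..
qed

lemma lin_in_span: "(\<And>c i. (c, i) \<in> set xs \<Longrightarrow> c = 0 \<or> i \<in> A \<or> E i = (\<lambda>Z. 0)) \<Longrightarrow> lin xs \<in> fs.span (E ` A)"
proof (induction xs)
  case Nil
  then show ?case by (simp add: fs.span_zero span_zero')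
next
  case (Cons x xs)
  obtain c i where x: "x = (c, i)" by (cases x)
  have "c = 0 \<or> i \<in> A \<or> E i = (\<lambda>Z. 0)" using Cons.prems[of c i] x by simp
  then have "(\<lambda>Z. c * E i Z) \<in> fs.span (E ` A)"
  proof (elim disjE)
    assume "c = 0"
    then have "(\<lambda>Z. c * E i Z) = (\<lambda>Z. 0)" by (simp add: fun_eq_iff)
    then show ?thesis by (simp add: fs.span_zero span_zero')
  next
    assume "i \<in> A"
    then show ?thesis by (intro fs.span_scale fs.span_base) auto
  next
    assume "E i = (\<lambda>Z. 0)"
    then have "(\<lambda>Z. c * E i Z) = (\<lambda>Z. 0)" by (simp add: fun_eq_iff)
    then show ?thesis by (simp add: fs.span_zero span_zero')
  qed
  moreover have "lin xs \<in> fs.span (E ` A)" using Cons by auto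
  ultimately show ?case unfolding lin_Cons x fst_conv snd_conv by (rule span_add')
qed

text \<open>Elements of a span become formal combinations, for which derivatives are explicit.\<close>
lemma span_is_lin: "f \<in> fs.span (E ` A) \<Longrightarrow> \<exists>xs. snd ` set xs \<subseteq> A \<and> f = lin xs"
proof (induction rule: span_induct_E)
  case zero
  then show ?case by (intro exI[of _ "[]"]) auto
next
  case (step c i g)
  then obtain xs where "snd ` set xs \<subseteq> A" "g = lin xs" by auto
  with step show ?case by (intro exI[of _ "(c, i) # xs"]) (auto simp: lin_Cons)
qed

definition dlin :: "(complex \<times> idx) list \<Rightarrow> HC \<Rightarrow> HC \<Rightarrow> complex" where
  "dlin xs Z V = (\<Sum>x\<leftarrow>xs. fst x * dE (snd x) Z V)"

lemma lin_has_derivative: "det Z \<noteq> 0 \<Longrightarrow> (lin xs has_derivative dlin xs Z) (at Z)"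
proof (induction xs)
  case Nil
  show ?case by (simp add: lin_def[abs_def] dlin_def[abs_def])
next
  case (Cons x xs)
  have "((\<lambda>Z. fst x * E (snd x) Z + lin xs Z) has_derivative (\<lambda>V. fst x * dE (snd x) Z V + dlin xs Z V)) (at Z)"
    using Cons by (intro has_derivative_add has_derivative_mult_right E_has_derivative) auto
  then show ?case
    by (simp add: lin_def[abs_def] dlin_def[abs_def] split_beta)
qed

lemma smul_simps [simp]: "smul c A $ i $ j = c * A $ i $ j" by (simp add: smul_def)

lemma ddet_smul: "ddet Z (smul t V) = ddet Z V * t" by (simp add: ddet_def algebra_simps)
lemma S_diff_smul: "S_diff p q r Z (smul t V) = S_diff p q r Z V * t" by (simp add: S_diff_def algebra_simps)
lemma dE_smul: "dE i Z (smul t V) = dE i Z V * t"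
  by (simp add: dE_def ddet_smul S_diff_smul algebra_simps split: prod.splits)

lemma smul_has_derivative: "((\<lambda>t. Z + smul t V) has_derivative (\<lambda>t. smul t V)) (at t)"
proof -
  have "linear (\<lambda>t. smul t V)"
    by (rule linearI) (auto simp: vec_eq_iff algebra_simps)
  then have "bounded_linear (\<lambda>t. smul t V)" by (simp add: linear_conv_bounded_linear)
  then have "((\<lambda>t. smul t V) has_derivative (\<lambda>t. smul t V)) (at t)"
    by (rule bounded_linear_imp_has_derivative)
  from has_derivative_add[OF has_derivative_const[of Z] this] show ?thesis by simp
qed

lemma smul_0 [simp]: "smul 0 V = 0" by (simp add: vec_eq_iff)

text \<open>The assumption on \<open>D\<close> says that the derivative is complex linear along the coordinate direction, which
  the real derivative does not know by itself.\<close>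
lemma partial_eq:
  assumes "(f has_derivative D) (at Z)" "\<And>t. D (smul t (e j)) = D (e j) * t"
  shows "partial j f Z = D (e j)"
proof -
  have "((\<lambda>t. f (Z + smul t (e j))) has_derivative (\<lambda>t. D (smul t (e j)))) (at 0)"
    by (rule has_derivative_compose[OF smul_has_derivative]) (simp add: assms)
  then have "((\<lambda>t. f (Z + smul t (e j))) has_field_derivative D (e j)) (at 0)"
    by (simp add: has_field_derivative_def assms(2))
  then show ?thesis unfolding partial_def by (rule DERIV_imp_deriv)
qed

lemma partial_cong:
  assumes "\<And>W. det W \<noteq> 0 \<Longrightarrow> f W = g W" "det Z \<noteq> 0"
  shows "partial j f Z = partial j g Z"
  unfolding partial_def
proof (rule deriv_cong_ev)
  have "open ((\<lambda>t. Z + smul t (e j)) -` {Z. det Z \<noteq> 0})"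
    using smul_has_derivative[of Z "e j"]
    by (intro continuous_open_vimage open_units has_derivative_continuous_on)
       (auto intro: has_derivative_at_withinI has_derivative_continuous)
  then have "\<forall>\<^sub>F t in nhds 0. t \<in> (\<lambda>t. Z + smul t (e j)) -` {Z. det Z \<noteq> 0}"
    using assms(2) by (intro eventually_nhds_in_open) auto
  then show "\<forall>\<^sub>F t in nhds 0. f (Z + smul t (e j)) = g (Z + smul t (e j))"
    by eventually_elim (use assms(1) in auto)
qed simp

lemma box_cong:
  assumes "\<And>W. det W \<noteq> 0 \<Longrightarrow> f W = g W" "det Z \<noteq> 0"
  shows "box f Z = box g Z"
  unfolding box_def by (intro sum.cong refl partial_cong assms)

section \<open>The Laplacian\<close>

definition ddE :: "idx \<Rightarrow> HC \<Rightarrow> HC \<Rightarrow> HC \<Rightarrow> complex" where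
  "ddE i Z V W = (case i of (k,p,q,r) \<Rightarrow>
     of_int k * (of_int (k-1) * det Z powi (k-2) * ddet Z W) * ddet Z V * S p q r Z
   + of_int k * det Z powi (k-1) * ddet W V * S p q r Z
   + of_int k * det Z powi (k-1) * ddet Z V * S_diff p q r Z W
   + of_int k * det Z powi (k-1) * ddet Z W * S_diff p q r Z V
   + det Z powi k * (S_diff (p-1) q (r-1) Z W * V$1$1 + S_diff p (q-1) (r-1) Z W * V$1$2
                  + S_diff (p-1) q r Z W * V$2$1 + S_diff p (q-1) r Z W * V$2$2))"

lemma ddet_has_derivative: "((\<lambda>Z. ddet Z V) has_derivative (\<lambda>W. ddet W V)) (at Z)"
proof -
  have "linear (\<lambda>Z. ddet Z V)"
    by (rule linearI) (auto simp: ddet_def algebra_simps)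
  then have "bounded_linear (\<lambda>Z. ddet Z V)" by (simp add: linear_conv_bounded_linear)
  then show ?thesis by (rule bounded_linear_imp_has_derivative)
qed

lemma S_diff_has_derivative: "((\<lambda>Z. S_diff p q r Z V) has_derivative
   (\<lambda>W. S_diff (p-1) q (r-1) Z W * V$1$1 + S_diff p (q-1) (r-1) Z W * V$1$2
                  + S_diff (p-1) q r Z W * V$2$1 + S_diff p (q-1) r Z W * V$2$2)) (at Z)"
  unfolding S_diff_def[of p q r]
  by (intro has_derivative_add has_derivative_mult_left S_has_derivative)

lemma dE_has_derivative:
  assumes "det Z \<noteq> 0"
  shows "((\<lambda>Z. dE i Z V) has_derivative ddE i Z V) (at Z)"
proof (cases i)
  case (fields k p q r)
  have 1: "((\<lambda>Z. of_int k * det Z powi (k - 1)) has_derivative (\<lambda>W. of_int k * (of_int (k-1) * det Z powi (k-1-1) * ddet Z W))) (at Z)"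
    by (intro has_derivative_mult_right det_powi_has_derivative assms)
  have "k - 1 - 1 = k - 2" by simp
  note 1 = 1[unfolded this]
  note 2 = has_derivative_mult[OF 1 ddet_has_derivative[of V]]
  note 3 = has_derivative_mult[OF 2 S_has_derivative[of p q r]]
  note 4 = has_derivative_mult[OF det_powi_has_derivative[OF assms] S_diff_has_derivative[of p q r V]]
  have e: "(\<lambda>Z. dE i Z V) = (\<lambda>Z. of_int k * det Z powi (k - 1) * ddet Z V * S p q r Z + det Z powi k * S_diff p q r Z V)"
    by (simp add: dE_def fields)
  show ?thesis unfolding e
    by (rule has_derivative_eq_rhs[OF has_derivative_add[OF 3 4]])
       (simp add: fun_eq_iff ddE_def fields algebra_simps)
qed

lemma ddE_smul: "ddE i Z V (smul t W) = ddE i Z V W * t"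
proof -
  have "ddet (smul t W) V = ddet W V * t" by (simp add: ddet_def algebra_simps)
  then show ?thesis
    by (simp add: ddE_def ddet_smul S_diff_smul algebra_simps split: prod.splits)
qed

lemma dlin_has_derivative: "det Z \<noteq> 0 \<Longrightarrow> ((\<lambda>Z. dlin xs Z V) has_derivative (\<lambda>W. \<Sum>x\<leftarrow>xs. fst x * ddE (snd x) Z V W)) (at Z)"
proof (induction xs)
  case Nil
  show ?case by (simp add: dlin_def[abs_def])
next
  case (Cons x xs)
  have "((\<lambda>Z. fst x * dE (snd x) Z V + dlin xs Z V) has_derivative (\<lambda>W. fst x * ddE (snd x) Z V W + (\<Sum>x\<leftarrow>xs. fst x * ddE (snd x) Z V W))) (at Z)"
    using Cons by (intro has_derivative_add has_derivative_mult_right dE_has_derivative) auto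
  then show ?case
    by (simp only: dlin_def split_beta list.map sum_list.Cons)
qed

lemma sum_list_scale: "(\<Sum>x\<leftarrow>xs. fst x * (f (snd x) * t)) = (\<Sum>x\<leftarrow>xs. fst x * f (snd x)) * (t::complex)"
  by (induction xs) (auto simp: algebra_simps)

lemma dlin_smul: "dlin xs Z (smul t V) = dlin xs Z V * t"
  unfolding dlin_def dE_smul by (rule sum_list_scale)

lemma partial_lin: "det Z \<noteq> 0 \<Longrightarrow> partial j (lin xs) Z = dlin xs Z (e j)"
  by (rule partial_eq[OF lin_has_derivative]) (auto simp only: dlin_smul)

lemma partial_partial_lin:
  assumes "det Z \<noteq> 0"
  shows "partial j (partial j (lin xs)) Z = (\<Sum>x\<leftarrow>xs. fst x * ddE (snd x) Z (e j) (e j))"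
proof -
  have "partial j (partial j (lin xs)) Z = partial j (\<lambda>Z. dlin xs Z (e j)) Z"
    by (rule partial_cong[OF partial_lin assms])
  also have "\<dots> = (\<Sum>x\<leftarrow>xs. fst x * ddE (snd x) Z (e j) (e j))"
    by (rule partial_eq[OF dlin_has_derivative[OF assms]]) (unfold ddE_smul, rule sum_list_scale)
  finally show ?thesis .
qed

definition box_coeff :: "idx \<Rightarrow> complex" where
  "box_coeff i = (case i of (k,p,q,r) \<Rightarrow> of_int (4 * k * (k + p + q + 1)))"

text \<open>The index shift of the Laplacian.\<close>
definition lower :: "idx \<Rightarrow> idx" where "lower i = (case i of (k,p,q,r) \<Rightarrow> (k-1,p,q,r))"

lemma e_simps [simp]: "e 0 $1$1 = 1" "e 0 $1$2 = 0" "e 0 $2$1 = 0" "e 0 $2$2 = 1"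
  "e 1 $1$1 = 0" "e 1 $1$2 = -\<i>" "e 1 $2$1 = -\<i>" "e 1 $2$2 = 0"
  "e 2 $1$1 = 0" "e 2 $1$2 = -1" "e 2 $2$1 = 1" "e 2 $2$2 = 0"
  "e 3 $1$1 = -\<i>" "e 3 $1$2 = 0" "e 3 $2$1 = 0" "e 3 $2$2 = \<i>"
  by (auto simp: e_def)

lemma sum_j: "(\<Sum>j\<in>(UNIV::4 set). f j) = f 0 + f 1 + f 2 + f 3"
proof -
  have "(4::4) = 0" by simp
  then show ?thesis unfolding sum_4 by (simp only: ac_simps)
qed

lemma sum_ddet_sq: "(\<Sum>j\<in>UNIV. ddet Z (e j) * ddet Z (e j)) = 4 * det Z"
proof -
  have "\<i> * \<i> = -1" by simp
  then show ?thesis by (simp only: sum_j ddet_def e_simps det_2) algebra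
qed

lemma sum_ddet_diag: "(\<Sum>j\<in>UNIV. ddet (e j) (e j)) = 8"
  by (simp add: sum_j ddet_def)

text \<open>In the coordinates \<open>z\<^sup>j\<close> the norm is the sum of squares, so the gradient of \<open>N\<close> paired with the
  gradient of \<open>S\<close> is twice the Euler operator, which multiplies \<open>S\<close> by its degree.\<close>
lemma sum_ddet_dS: "(\<Sum>j\<in>UNIV. ddet Z (e j) * S_diff p q r Z (e j)) = of_int (2 * (p + q)) * S p q r Z"
proof -
  have 1: "Z$1$1 * S (p-1) q (r-1) Z + Z$1$2 * S p (q-1) (r-1) Z = of_int r * S p q r Z"
    using S_row1[of Z p q "r-1"] by simp
  have 2: "Z$2$1 * S (p-1) q r Z + Z$2$2 * S p (q-1) r Z = (of_int p + of_int q - of_int r) * S p q r Z"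
    using S_row2[of Z p q "r"] by simp
  have "\<i> * \<i> = -1" by simp
  then have "(\<Sum>j\<in>UNIV. ddet Z (e j) * S_diff p q r Z (e j)) =
     2 * ((Z$1$1 * S (p-1) q (r-1) Z + Z$1$2 * S p (q-1) (r-1) Z) + (Z$2$1 * S (p-1) q r Z + Z$2$2 * S p (q-1) r Z))"
    by (simp only: sum_j ddet_def S_diff_def e_simps) algebra
  then show ?thesis unfolding 1 2 by (simp add: algebra_simps)
qed

text \<open>The Laplacian is four times \<open>\<partial>\<^sub>1\<^sub>1 \<partial>\<^sub>2\<^sub>2 - \<partial>\<^sub>1\<^sub>2 \<partial>\<^sub>2\<^sub>1\<close>, and both second derivatives lower
  all row and column sums of the exponents by one.\<close>
lemma S_harmonic: "(\<Sum>j\<in>UNIV. S_diff (p-1) q (r-1) Z (e j) * e j$1$1 + S_diff p (q-1) (r-1) Z (e j) * e j$1$2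
                  + S_diff (p-1) q r Z (e j) * e j$2$1 + S_diff p (q-1) r Z (e j) * e j$2$2) = 0"
proof -
  have "\<i> * \<i> = -1" by simp
  then show ?thesis by (simp only: sum_j S_diff_def e_simps) algebra
qed

text \<open>The product rule: \<open>\<box>\<close> of a power of \<open>N\<close>, twice the product of the gradients, and the harmonicity of
  \<open>S\<close> combine to \<open>4k(k-1) + 8k + 4kd = 4k(k+d+1)\<close>.\<close>
lemma box_E_pointwise:
  assumes "det Z \<noteq> 0"
  shows "(\<Sum>j\<in>UNIV. ddE (k,p,q,r) Z (e j) (e j)) = box_coeff (k,p,q,r) * E (lower (k,p,q,r)) Z"
proof -
  let ?w = "det Z powi (k-2)"
  let ?H = "\<lambda>j. S_diff (p-1) q (r-1) Z (e j) * e j$1$1 + S_diff p (q-1) (r-1) Z (e j) * e j$1$2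
                  + S_diff (p-1) q r Z (e j) * e j$2$1 + S_diff p (q-1) r Z (e j) * e j$2$2"
  have N: "det Z powi (k-1) = det Z * ?w"
    using powi_minus_1[OF assms, of "k-1"] by auto
  have "ddE (k,p,q,r) Z (e j) (e j) = of_int (k * (k-1)) * ?w * S p q r Z * (ddet Z (e j) * ddet Z (e j))
     + of_int k * (det Z * ?w) * S p q r Z * ddet (e j) (e j)
     + of_int (2*k) * (det Z * ?w) * (ddet Z (e j) * S_diff p q r Z (e j)) + det Z powi k * ?H j" for j
    by (simp add: ddE_def N algebra_simps)
  then have "(\<Sum>j\<in>UNIV. ddE (k,p,q,r) Z (e j) (e j)) =
      of_int (k * (k-1)) * ?w * S p q r Z * (4 * det Z) + of_int k * (det Z * ?w) * S p q r Z * 8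
     + of_int (2*k) * (det Z * ?w) * (of_int (2 * (p + q)) * S p q r Z) + det Z powi k * 0"
    by (simp only: sum.distrib sum_distrib_left[symmetric] sum_ddet_sq sum_ddet_diag sum_ddet_dS S_harmonic[unfolded sum.distrib])
  also have "\<dots> = box_coeff (k,p,q,r) * E (lower (k,p,q,r)) Z"
    by (simp add: box_coeff_def lower_def E_unit[OF assms] N algebra_simps)
  finally show ?thesis .
qed

definition boxl :: "(complex \<times> idx) list \<Rightarrow> (complex \<times> idx) list" where
  "boxl xs = map (\<lambda>x. (fst x * box_coeff (snd x), lower (snd x))) xs"

lemma box_lin:
  assumes "det Z \<noteq> 0" shows "box (lin xs) Z = lin (boxl xs) Z"
proof -
  have "box (lin xs) Z = (\<Sum>j\<in>UNIV. \<Sum>x\<leftarrow>xs. fst x * ddE (snd x) Z (e j) (e j))"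
    unfolding box_def using partial_partial_lin[OF assms] by simp
  also have "\<dots> = (\<Sum>x\<leftarrow>xs. fst x * (\<Sum>j\<in>UNIV. ddE (snd x) Z (e j) (e j)))"
  proof (induction xs)
    case (Cons x xs)
    show ?case by (simp only: list.map sum_list.Cons sum.distrib Cons sum_distrib_left)
  qed simp
  also have "\<dots> = (\<Sum>x\<leftarrow>xs. fst x * (box_coeff (snd x) * E (lower (snd x)) Z))"
    using box_E_pointwise[OF assms] by (intro arg_cong[where f=sum_list] map_cong refl) auto
  also have "\<dots> = lin (boxl xs) Z" by (simp only: lin_def split_beta boxl_def map_map comp_def fst_conv snd_conv mult.assoc)
  finally show ?thesis .
qed

section \<open>The functions E span the regular functions\<close>

lemma S_const [simp]: "S 0 0 0 Z = 1" by (simp add: S_def sterm_def)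

lemma S_coord: "S 1 0 1 Z = Z$1$1" "S 0 1 1 Z = Z$1$2" "S 1 0 0 Z = Z$2$1" "S 0 1 0 Z = Z$2$2"
  using S_col1[of Z 0 0 1] S_col2[of Z 0 0 1] S_col1[of Z 0 0 0] S_col2[of Z 0 0 0] by (auto simp: S_eq_0)

lemma regular_sing: "f \<in> regular_functions \<Longrightarrow> det Z = 0 \<Longrightarrow> f Z = 0"
  by (induction rule: regular_functions.induct) (auto simp: on_units_def)

lemma regular_scale:
  assumes "f \<in> regular_functions" shows "(\<lambda>Z. c * f Z) \<in> regular_functions"
proof -
  have "(\<lambda>Z. c * f Z) = (\<lambda>Z. on_units (\<lambda>Z. c) Z * f Z)" using regular_sing[OF assms] by (auto simp: on_units_def)
  then show ?thesis by (simp add: regular_functions.mult regular_functions.const assms)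
qed

lemma regular_power: "on_units f \<in> regular_functions \<Longrightarrow> on_units (\<lambda>Z. f Z ^ n) \<in> regular_functions"
proof (induction n)
  case 0
  then show ?case using regular_functions.const[of 1] by simp
next
  case (Suc n)
  have "on_units (\<lambda>Z. f Z ^ Suc n) = (\<lambda>Z. on_units f Z * on_units (\<lambda>Z. f Z ^ n) Z)" by (auto simp: on_units_def)
  then show ?case by (simp add: regular_functions.mult Suc)
qed

lemma regular_mult: "on_units f \<in> regular_functions \<Longrightarrow> on_units g \<in> regular_functions \<Longrightarrow> on_units (\<lambda>Z. f Z * g Z) \<in> regular_functions"
  using regular_functions.mult[of "on_units f" "on_units g"] by (simp add: on_units_def if_distrib cong: if_cong)

lemma regular_add: "on_units f \<in> regular_functions \<Longrightarrow> on_units g \<in> regular_functions \<Longrightarrow> on_units (\<lambda>Z. f Z + g Z) \<in> regular_functions"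
  using regular_functions.add[of "on_units f" "on_units g"] by (simp add: on_units_def if_distrib cong: if_cong)

lemma regular_sum: "(\<And>a. a \<in> A \<Longrightarrow> on_units (f a) \<in> regular_functions) \<Longrightarrow> on_units (\<lambda>Z. \<Sum>a\<in>A. f a Z) \<in> regular_functions"
  by (induction A rule: infinite_finite_induct) (auto intro: regular_add regular_functions.const)

lemma regular_dpow: "on_units (\<lambda>Z. dpow n (Z$i$j)) \<in> regular_functions"
proof (cases "n < 0")
  case True
  then show ?thesis using regular_functions.const[of 0] by simp
next
  case False
  have "on_units (\<lambda>Z::HC. (Z$i$j) ^ nat n * (1 / fact (nat n))) \<in> regular_functions"
    by (intro regular_mult regular_power regular_functions.coord regular_functions.const)
  with False show ?thesis by (simp add: dpow_def)
qed

lemma det_regular: "on_units det \<in> regular_functions"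
proof -
  have "on_units (\<lambda>Z. Z$1$1 * Z$2$2 + (-1) * (Z$1$2 * Z$2$1)) \<in> regular_functions"
    by (intro regular_mult regular_add regular_functions.coord regular_functions.const)
  then show ?thesis by (simp add: det_2[abs_def] on_units_def)
qed

lemma regular_S: "on_units (S p q r) \<in> regular_functions"
  unfolding S_def[abs_def] sterm_def by (intro regular_sum regular_mult regular_dpow)

lemma E_regular: "E i \<in> regular_functions"
proof (cases i)
  case (fields k p q r)
  have "on_units (\<lambda>Z. det Z powi k) \<in> regular_functions"
  proof (cases "k \<ge> 0")
    case True
    have "on_units (\<lambda>Z. det Z ^ nat k) \<in> regular_functions"
      by (intro regular_power det_regular)
    with True show ?thesis by (simp add: power_int_def)
  next
    case False
    have "on_units (\<lambda>Z. inverse (det Z) ^ nat (-k)) \<in> regular_functions"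
      by (intro regular_power regular_functions.inv_norm)
    with False show ?thesis by (simp add: power_int_def)
  qed
  then show ?thesis unfolding fields E.simps by (intro regular_mult regular_S)
qed

lemma span_regular: "f \<in> fs.span (E ` A) \<Longrightarrow> f \<in> regular_functions"
proof (induction rule: span_induct_E)
  case zero
  then show ?case using regular_functions.const[of 0] by (simp add: on_units_def cong: if_cong)
next
  case (step c i g)
  then show ?case by (intro regular_functions.add regular_scale E_regular)
qed

text \<open>The two-term rule \<open>S_mult11\<close> and its companions multiply \<open>E\<close> by a coordinate within the span.\<close>
lemma mult_coord_span: "(\<lambda>Z. Z$a$b * E i Z) \<in> fs.span (E ` II)"
proof (cases "i \<in> II")
  case False
  then show ?thesis by (simp add: E_outside span_zero')
next
  case True
  obtain k p q r where i: "i = (k,p,q,r)" by (cases i)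
  let ?D = "of_int (p + q + 1) :: complex"
  have "p + q + 1 \<noteq> 0" using True by (auto simp: II_def i)
  then have D: "?D \<noteq> 0" by (metis of_int_eq_0_iff)
  have *: "(\<lambda>Z. Z$a$b * E i Z) \<in> fs.span (E ` II)" if
    "\<And>Z. ?D * (Z$a$b * S p q r Z) = c1 * S p1 q1 r1 Z + c2 * (det Z * S p2 q2 r2 Z)" for a b c1 p1 q1 r1 c2 p2 q2 r2
  proof -
    have "Z$a$b * E i Z = lin [(c1 / ?D, (k,p1,q1,r1)), (c2 / ?D, (k+1,p2,q2,r2))] Z" for Z
    proof (cases "det Z = 0")
      case True
      then show ?thesis by (simp add: lin_def E_sing)
    next
      case False
      have "?D * (Z$a$b * E i Z) = det Z powi k * (?D * (Z$a$b * S p q r Z))" by (simp add: i E_unit False)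
      also have "\<dots> = det Z powi k * (c1 * S p1 q1 r1 Z + c2 * (det Z * S p2 q2 r2 Z))" by (simp only: that)
      also have "\<dots> = ?D * lin [(c1 / ?D, (k,p1,q1,r1)), (c2 / ?D, (k+1,p2,q2,r2))] Z"
        using D by (simp add: lin_def E_unit False powi_plus_1 distrib_left del: of_int_add)
      finally show ?thesis using D by (metis mult_cancel_left)
    qed
    then have "(\<lambda>Z. Z$a$b * E i Z) = lin [(c1 / ?D, (k,p1,q1,r1)), (c2 / ?D, (k+1,p2,q2,r2))]" by blast
    moreover have "lin xs \<in> fs.span (E ` II)" for xs by (rule lin_in_span) (use E_outside in blast)
    ultimately show ?thesis by simp
  qed
  have "(\<lambda>Z. Z$1$1 * E i Z) \<in> fs.span (E ` II)" by (rule *[where ?c2.0 = 1]) (use S_mult11 in simp)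
  moreover have "(\<lambda>Z. Z$1$2 * E i Z) \<in> fs.span (E ` II)" by (rule *[where ?c2.0 = "-1"]) (use S_mult12 in simp)
  moreover have "(\<lambda>Z. Z$2$1 * E i Z) \<in> fs.span (E ` II)" by (rule *[where ?c2.0 = "-1"]) (use S_mult21 in simp)
  moreover have "(\<lambda>Z. Z$2$2 * E i Z) \<in> fs.span (E ` II)" by (rule *[where ?c2.0 = "1"]) (use S_mult22 in simp)
  ultimately show ?thesis using exhaust_2[of a] exhaust_2[of b] by auto
qed

lemma span_mult:
  assumes "g \<in> fs.span (E ` A)" "\<And>i. (\<lambda>Z. h Z * E i Z) \<in> fs.span B"
  shows "(\<lambda>Z. h Z * g Z) \<in> fs.span B"
  using assms(1)
proof (induction rule: span_induct_E)
  case zero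
  show ?case using span_zero'[of B] by simp
next
  case (step c i g)
  have "(\<lambda>Z. c * (h Z * E i Z) + h Z * g Z) \<in> fs.span B"
    by (intro span_add'[OF fs.span_scale[OF assms(2)]] step)
  then show ?case by (simp add: distrib_left mult.left_commute)
qed

lemma regular_span_mult: "f \<in> regular_functions \<Longrightarrow> g \<in> fs.span (E ` II) \<Longrightarrow> (\<lambda>Z. f Z * g Z) \<in> fs.span (E ` II)"
proof (induction arbitrary: g rule: regular_functions.induct)
  case (const c)
  have "(\<lambda>Z. on_units (\<lambda>Z. c) Z * g Z) = (\<lambda>Z. c * g Z)"
    using regular_sing[OF span_regular[OF const]] by (auto simp: on_units_def)
  then show ?case using const by (simp add: fs.span_scale)
next
  case (coord i j)
  have "(\<lambda>Z. on_units (\<lambda>Z. Z $ i $ j) Z * E phi_ix Z) \<in> fs.span (E ` II)" for phi_ix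
  proof -
    have "(\<lambda>Z. on_units (\<lambda>Z. Z $ i $ j) Z * E phi_ix Z) = (\<lambda>Z. Z$i$j * E phi_ix Z)"
      by (rule ext) (simp add: on_units_def E_sing)
    then show ?thesis using mult_coord_span[of i j phi_ix] by simp
  qed
  then show ?case by (rule span_mult[OF coord])
next
  case inv_norm
  have "(\<lambda>Z. on_units (\<lambda>Z. inverse (det Z)) Z * E phi_ix Z) \<in> fs.span (E ` II)" for phi_ix
  proof -
    have "on_units (\<lambda>Z. inverse (det Z)) Z * E phi_ix Z = E (lower phi_ix) Z" for Z
    proof (cases "det Z = 0")
      case False
      then show ?thesis using powi_minus_1[OF False, of "fst phi_ix"]
        by (cases phi_ix) (simp add: lower_def on_units_def E_unit)
    qed (simp add: E_sing)
    then show ?thesis using E_in_span[of "lower phi_ix"] by simp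
  qed
  then show ?case by (rule span_mult[OF inv_norm])
next
  case (add f1 f2)
  then have "(\<lambda>Z. f1 Z * g Z + f2 Z * g Z) \<in> fs.span (E ` II)" by (intro span_add') auto
  then show ?case by (simp add: algebra_simps)
next
  case (mult f1 f2)
  have "(\<lambda>Z. f1 Z * (f2 Z * g Z)) \<in> fs.span (E ` II)" using mult by auto
  then show ?case by (simp add: mult.assoc)
qed

text \<open>The span contains \<open>1\<close> and is stable under multiplication by the generators of the algebra.\<close>
lemma regular_eq_span: "regular_functions = fs.span (E ` II)"
proof (intro set_eqI iffI span_regular)
  fix f assume f: "f \<in> regular_functions"
  have "(\<lambda>Z. f Z * E (0,0,0,0) Z) \<in> fs.span (E ` II)" by (rule regular_span_mult[OF f E_in_span])
  moreover have "(\<lambda>Z. f Z * E (0,0,0,0) Z) = f" using regular_sing[OF f] by (auto simp: fun_eq_iff E.simps on_units_def)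
  ultimately show "f \<in> fs.span (E ` II)" by simp
qed

section \<open>Quaternions and the surface measure\<close>

lemma quat_entries [simp]: "quat x $ 1 $ 1 = Complex (x$0) (- x$3)" "quat x $ 1 $ 2 = Complex (- x$2) (- x$1)"
   "quat x $ 2 $ 1 = Complex (x$2) (- x$1)" "quat x $ 2 $ 2 = Complex (x$0) (x$3)"
  unfolding quat_def sum_j by (simp_all add: complex_eq_iff)

lemma norm_sq_4: "(norm (x :: real^4))\<^sup>2 = (x$0)\<^sup>2 + (x$1)\<^sup>2 + (x$2)\<^sup>2 + (x$3)\<^sup>2"
proof -
  have "(norm x)\<^sup>2 = (\<Sum>j\<in>UNIV. (x$j)\<^sup>2)"
    by (simp add: norm_vec_def L2_set_def sum_nonneg)
  then show ?thesis unfolding sum_j .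
qed

lemma det_quat: "det (quat x) = complex_of_real ((norm x)\<^sup>2)"
  unfolding norm_sq_4 by (simp add: det_2 complex_eq_iff power2_eq_square)

lemma linear_quat: "linear quat"
  by (rule linearI; rule matrix_entries_eqI) (auto simp: complex_eq_iff)

lemma quat_scaleR: "quat (c *\<^sub>R x) = c *\<^sub>R quat x"
  by (rule linear_scale[OF linear_quat])

text \<open>The inverse of \<open>quat\<close> on its image.\<close>
definition qinv :: "HC \<Rightarrow> real^4" where
  "qinv Z = (\<chi> j. if j = 0 then Re (Z$1$1) else if j = 1 then - Im (Z$2$1) else if j = 2 then Re (Z$2$1) else Im (Z$2$2))"

lemma qinv_entries [simp]: "qinv Z $ 0 = Re (Z$1$1)" "qinv Z $ 1 = - Im (Z$2$1)" "qinv Z $ 2 = Re (Z$2$1)" "qinv Z $ 3 = Im (Z$2$2)"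
  by (simp_all add: qinv_def)

lemma quat_left_mult: "quat (qinv (quat x ** quat y)) = quat x ** quat y"
  by (rule matrix_entries_eqI) (simp_all add: mult_2_entry complex_eq_iff algebra_simps)

text \<open>The determinant of a quaternion is its squared norm, and determinants multiply.\<close>
lemma orthogonal_left:
  assumes "norm u = 1" shows "orthogonal_transformation (\<lambda>x. qinv (quat u ** quat x))"
proof -
  have l: "linear (\<lambda>x. qinv (quat u ** quat x))"
    by (rule linearI) (simp_all add: qinv_def vec_eq_iff mult_2_entry algebra_simps)
  have "norm (qinv (quat u ** quat x)) = norm x" for x
  proof -
    have "complex_of_real ((norm (qinv (quat u ** quat x)))\<^sup>2) = complex_of_real ((norm x)\<^sup>2)"
      unfolding det_quat[symmetric] quat_left_mult det_mul using assms by (simp add: det_quat)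
    then have "(norm (qinv (quat u ** quat x)))\<^sup>2 = (norm x)\<^sup>2" unfolding of_real_eq_iff .
    then show ?thesis by simp
  qed
  with l show ?thesis by (simp add: orthogonal_transformation)
qed

lemma orthogonal_right:
  assumes "norm u = 1" shows "orthogonal_transformation (\<lambda>x. qinv (quat x ** quat u))"
proof -
  have l: "linear (\<lambda>x. qinv (quat x ** quat u))"
    by (rule linearI) (simp_all add: qinv_def vec_eq_iff mult_2_entry algebra_simps)
  have "norm (qinv (quat x ** quat u)) = norm x" for x
  proof -
    have "complex_of_real ((norm (qinv (quat x ** quat u)))\<^sup>2) = complex_of_real ((norm x)\<^sup>2)"
      unfolding det_quat[symmetric] quat_left_mult det_mul using assms by (simp add: det_quat)
    then have "(norm (qinv (quat x ** quat u)))\<^sup>2 = (norm x)\<^sup>2" unfolding of_real_eq_iff .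
    then show ?thesis by simp
  qed
  with l show ?thesis by (simp add: orthogonal_transformation)
qed

text \<open>Both measures give a box the same volume, and boxes determine Lebesgue measure.\<close>
lemma lborel_orthogonal:
  fixes T :: "real^4 \<Rightarrow> real^4"
  assumes T: "orthogonal_transformation T"
  shows "distr lborel borel T = lborel"
proof (rule sym, rule lborel_eqI)
  have lin: "linear T" using T by (rule orthogonal_transformation_linear)
  have meas [measurable]: "T \<in> borel_measurable borel"
    by (intro borel_measurable_continuous_onI linear_continuous_on) (use lin in \<open>simp add: linear_conv_bounded_linear\<close>)
  show "sets (distr lborel borel T) = sets borel" by simp
  fix l u :: "real^4" assume lu: "\<And>b. b \<in> Basis \<Longrightarrow> l \<bullet> b \<le> u \<bullet> b"
  have bij: "bij T" using T by (rule orthogonal_transformation_bij)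
  have T': "orthogonal_transformation (inv T)" using T by (rule orthogonal_transformation_inv)
  have "T -` Topology_Euclidean_Space.box l u = inv T ` Topology_Euclidean_Space.box l u" using bij by (simp add: bij_vimage_eq_inv_image)
  have "emeasure (distr lborel borel T) (Topology_Euclidean_Space.box l u) = emeasure lborel (T -` Topology_Euclidean_Space.box l u)"
    by (subst emeasure_distr) auto
  also have "T -` Topology_Euclidean_Space.box l u = inv T ` Topology_Euclidean_Space.box l u" by fact
  also have "emeasure lborel (inv T ` Topology_Euclidean_Space.box l u) = emeasure lebesgue (inv T ` Topology_Euclidean_Space.box l u)"
  proof -
    have "T -` Topology_Euclidean_Space.box l u \<inter> space borel \<in> sets borel" by measurable
    then have "inv T ` Topology_Euclidean_Space.box l u \<in> sets borel" using \<open>T -` Topology_Euclidean_Space.box l u = inv T ` Topology_Euclidean_Space.box l u\<close> by simp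
    then show ?thesis by simp
  qed
  also have "\<dots> = ennreal (measure lebesgue (inv T ` Topology_Euclidean_Space.box l u))"
    by (intro emeasure_eq_measure2 measurable_orthogonal_image[OF T'] lmeasurable_box)
  also have "measure lebesgue (inv T ` Topology_Euclidean_Space.box l u) = measure lebesgue (Topology_Euclidean_Space.box l u)"
    by (rule measure_orthogonal_image[OF T']) simp
  also have "\<dots> = measure lborel (Topology_Euclidean_Space.box l u)" by simp
  also have "\<dots> = (\<Prod>b\<in>Basis. (u - l) \<bullet> b)" using lu by (simp add: measure_lborel_box)
  finally show "emeasure (distr lborel borel T) (Topology_Euclidean_Space.box l u) = (\<Prod>b\<in>Basis. (u - l) \<bullet> b)" .
qed

text \<open>The radial projection onto the sphere, along which \<open>dS\<close> is the image of a multiple of Lebesgue measure.\<close>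
definition rproj :: "real \<Rightarrow> real^4 \<Rightarrow> HC" where "rproj R x = quat ((R / norm x) *\<^sub>R x)"

lemma det_quat_iff: "R > 0 \<Longrightarrow> det (quat x) = complex_of_real (R\<^sup>2) \<longleftrightarrow> norm x = R"
  unfolding det_quat of_real_eq_iff by simp

lemma S3_eq: "R > 0 \<Longrightarrow> S3 R = quat ` sphere 0 R"
  by (auto simp only: S3_def HR_def det_quat_iff mem_sphere dist_0_norm)

lemma continuous_quat: "continuous_on A quat"
  using linear_quat by (simp add: linear_continuous_on linear_conv_bounded_linear)

lemma compact_S3: "R > 0 \<Longrightarrow> compact (S3 R)"
  unfolding S3_eq by (intro compact_continuous_image continuous_quat) auto

lemma rproj_in_S3: "R > 0 \<Longrightarrow> x \<noteq> 0 \<Longrightarrow> rproj R x \<in> S3 R"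
  by (auto simp: rproj_def S3_eq)

lemma rproj_continuous: "continuous_on (- {0}) (rproj R)"
  unfolding rproj_def
  by (intro continuous_on_compose2[OF continuous_quat[of UNIV]] continuous_intros) auto

definition Mball :: "real \<Rightarrow> (real^4) measure" where
  "Mball R = density (restrict_space lborel (ball 0 R - {0})) (\<lambda>_. ennreal (4 / R))"

lemma dS_eq: "dS R = distr (Mball R) (restrict_space borel (S3 R)) (rproj R)"
  unfolding dS_def Mball_def rproj_def ..

lemma space_Mball: "space (Mball R) = ball 0 R - {0}"
  by (simp add: Mball_def space_restrict_space)

lemma sets_Mball: "sets (Mball R) = sets (restrict_space borel (ball 0 R - {0}))"
  by (simp add: Mball_def sets_restrict_space)

lemma rproj_measurable: "R > 0 \<Longrightarrow> rproj R \<in> measurable (Mball R) (restrict_space borel (S3 R))"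
proof (rule measurable_restrict_space2)
  show "rproj R \<in> space (Mball R) \<rightarrow> S3 R" if "R > 0" using that by (auto simp: space_Mball rproj_in_S3)
  have "rproj R \<in> borel_measurable (restrict_space borel (ball 0 R - {0}))"
    by (intro borel_measurable_continuous_on_restrict continuous_on_subset[OF rproj_continuous]) auto
  then show "rproj R \<in> borel_measurable (Mball R)"
    by (simp cong: measurable_cong_sets add: measurable_cong_sets[OF sets_Mball refl])
qed

lemma integral_dS:
  fixes f :: "HC \<Rightarrow> complex"
  assumes R: "R > 0" and f: "f \<in> borel_measurable (restrict_space borel (S3 R))"
  shows "(\<integral>X. f X \<partial>dS R) = (4 / R) *\<^sub>R (\<integral>x. indicator (ball 0 R - {0}) x *\<^sub>R f (rproj R x) \<partial>lborel)"
    and "(\<lambda>x. indicator (ball 0 R - {0}) x *\<^sub>R f (rproj R x)) \<in> borel_measurable borel"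
proof -
  have m: "(\<lambda>x. f (rproj R x)) \<in> borel_measurable (Mball R)"
    by (rule measurable_compose[OF rproj_measurable[OF R] f])
  then have m': "(\<lambda>x. f (rproj R x)) \<in> borel_measurable (restrict_space lborel (ball 0 R - {0}))"
    by (simp add: Mball_def)
  have "(\<integral>X. f X \<partial>dS R) = (\<integral>x. f (rproj R x) \<partial>Mball R)"
    unfolding dS_eq by (rule integral_distr[OF rproj_measurable[OF R] f])
  also have "\<dots> = (\<integral>x. (4 / R) *\<^sub>R f (rproj R x) \<partial>restrict_space lborel (ball 0 R - {0}))"
    unfolding Mball_def using R m' by (subst integral_density) auto
  also have "\<dots> = (4 / R) *\<^sub>R (\<integral>x. f (rproj R x) \<partial>restrict_space lborel (ball 0 R - {0}))"
    by simp
  also have "(\<integral>x. f (rproj R x) \<partial>restrict_space lborel (ball 0 R - {0})) = (\<integral>x. indicator (ball 0 R - {0}) x *\<^sub>R f (rproj R x) \<partial>lborel)"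
    by (subst integral_restrict_space) auto
  finally show "(\<integral>X. f X \<partial>dS R) = (4 / R) *\<^sub>R (\<integral>x. indicator (ball 0 R - {0}) x *\<^sub>R f (rproj R x) \<partial>lborel)" .
  show "(\<lambda>x. indicator (ball 0 R - {0}) x *\<^sub>R f (rproj R x)) \<in> borel_measurable borel"
    using m' by (subst (asm) borel_measurable_restrict_space_iff) auto
qed

text \<open>An orthogonal map commutes with the radial projection and preserves Lebesgue measure on the ball.\<close>
lemma integral_dS_orthogonal:
  fixes f g :: "HC \<Rightarrow> complex"
  assumes R: "R > 0" and f: "f \<in> borel_measurable (restrict_space borel (S3 R))"
    and g: "g \<in> borel_measurable (restrict_space borel (S3 R))"
    and T: "orthogonal_transformation T" and fg: "\<And>x. g (quat x) = f (quat (T x))"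
  shows "(\<integral>X. g X \<partial>dS R) = (\<integral>X. f X \<partial>dS R)"
proof -
  have nT: "norm (T x) = norm x" for x using T by (simp add: orthogonal_transformation_norm)
  have lT: "T (c *\<^sub>R x) = c *\<^sub>R T x" for c x using T by (simp add: orthogonal_transformation_linear linear_scale)
  define h where "h x = indicator (ball 0 R - {0}) x *\<^sub>R f (rproj R x)" for x
  have hm: "h \<in> borel_measurable borel" unfolding h_def by (rule integral_dS[OF R f])
  have "indicator (ball 0 R - {0}) x *\<^sub>R g (rproj R x) = h (T x)" for x
  proof -
    have "g (rproj R x) = f (rproj R (T x))" unfolding rproj_def fg lT nT ..
    moreover have "x = 0 \<longleftrightarrow> T x = 0" using nT[of x] by (metis norm_eq_zero)
    ultimately show ?thesis by (auto simp: h_def indicator_def nT)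
  qed
  then have "(\<integral>X. g X \<partial>dS R) = (4 / R) *\<^sub>R (\<integral>x. h (T x) \<partial>lborel)"
    by (simp add: integral_dS(1)[OF R g])
  also have "(\<integral>x. h (T x) \<partial>lborel) = (\<integral>x. h x \<partial>distr lborel borel T)"
  proof (rule integral_distr[symmetric])
    have "linear T" using T by (rule orthogonal_transformation_linear)
    then show "T \<in> borel_measurable lborel"
      by (auto intro!: borel_measurable_continuous_onI linear_continuous_on simp: linear_conv_bounded_linear)
  qed (rule hm)
  also have "\<dots> = (\<integral>x. h x \<partial>lborel)" by (simp only: lborel_orthogonal[OF T])
  also have "(4 / R) *\<^sub>R (\<integral>x. h x \<partial>lborel) = (\<integral>X. f X \<partial>dS R)"
    by (simp add: integral_dS(1)[OF R f] h_def)
  finally show ?thesis .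
qed

lemma S3_units: "R > 0 \<Longrightarrow> X \<in> S3 R \<Longrightarrow> det X \<noteq> 0"
  by (auto simp: S3_def)

lemma regular_continuous: "f \<in> regular_functions \<Longrightarrow> continuous_on {Z. det Z \<noteq> 0} f"
proof -
  assume "f \<in> regular_functions"
  then obtain xs where "f = lin xs" using span_is_lin regular_eq_span by blast
  then show ?thesis
    by (intro has_derivative_continuous_on[where f' = "dlin xs"]) (auto intro!: has_derivative_at_withinI lin_has_derivative)
qed

lemma regular_measurable:
  assumes "R > 0" "f \<in> regular_functions"
  shows "f \<in> borel_measurable (restrict_space borel (S3 R))"
  by (intro borel_measurable_continuous_on_restrict continuous_on_subset[OF regular_continuous[OF assms(2)]])
     (use S3_units[OF assms(1)] in auto)

lemma finite_measure_dS: "R > 0 \<Longrightarrow> finite_measure (dS R)"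
proof -
  assume R: "R > 0"
  have "emeasure (Mball R) (space (Mball R)) < \<infinity>"
  proof -
    have "emeasure (Mball R) (space (Mball R)) = ennreal (4 / R) * emeasure (restrict_space lborel (ball 0 R - {0::real^4})) (ball 0 R - {0})"
      unfolding space_Mball Mball_def using space_restrict_space[of lborel "ball 0 R - {0::real^4}"]
      by (subst emeasure_density_const) (auto simp: sets_restrict_space)
    also have "\<dots> \<le> ennreal (4 / R) * emeasure lborel (ball 0 R :: (real^4) set)"
      by (intro mult_left_mono) (auto simp: emeasure_restrict_space intro!: emeasure_mono)
    also have "\<dots> < \<infinity>" using emeasure_lborel_ball_finite[of "0::real^4" R] by (simp add: ennreal_mult_less_top)
    finally show ?thesis .
  qed
  then have "finite_measure (Mball R)" by (intro finite_measureI) auto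
  then show ?thesis unfolding dS_eq by (rule finite_measure.finite_measure_distr) (rule rproj_measurable[OF R])
qed

lemma space_dS: "space (dS R) = S3 R" by (simp add: dS_def space_restrict_space)
lemma sets_dS: "sets (dS R) = sets (restrict_space borel (S3 R))" by (simp add: dS_def)

lemma regular_integrable:
  assumes R: "R > 0" and f: "f \<in> regular_functions"
  shows "integrable (dS R) f"
proof -
  have "compact (f ` S3 R)"
    by (intro compact_continuous_image compact_S3 R continuous_on_subset[OF regular_continuous[OF f]])
     (use S3_units[OF R] in auto)
  then obtain B where B: "\<And>X. X \<in> S3 R \<Longrightarrow> norm (f X) \<le> B"
    by (meson bounded_iff compact_imp_bounded image_eqI)
  show ?thesis
  proof (rule finite_measure.integrable_const_bound[OF finite_measure_dS[OF R]])
    show "AE x in dS R. norm (f x) \<le> B" by (rule AE_I2) (auto simp: space_dS B)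
    show "f \<in> borel_measurable (dS R)"
      using regular_measurable[OF R f] by (simp cong: measurable_cong_sets add: measurable_cong_sets[OF sets_dS refl])
  qed
qed

text \<open>By its definition through cones, the area is \<open>4/R\<close> times the volume \<open>\<pi>\<^sup>2 R\<^sup>4 / 2\<close> of the ball.\<close>
lemma area_S3: "R > 0 \<Longrightarrow> (\<integral>X. 1 \<partial>dS R) = complex_of_real (2 * pi\<^sup>2 * R ^ 3)"
proof -
  assume R: "R > 0"
  have "(\<integral>X. (1::complex) \<partial>dS R) = (4 / R) *\<^sub>R (\<integral>x. indicator (ball 0 R - {0::real^4}) x *\<^sub>R (1::complex) \<partial>lborel)"
    by (subst integral_dS(1)[OF R]) auto
  also have "(\<integral>x. indicator (ball 0 R - {0::real^4}) x *\<^sub>R (1::complex) \<partial>lborel) = complex_of_real (measure lborel (ball 0 R - {0::real^4}))"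
  proof -
    have "emeasure lborel (ball 0 R - {0::real^4}) \<le> emeasure lborel (ball 0 R :: (real^4) set)"
      by (intro emeasure_mono) auto
    also have "\<dots> < \<infinity>" by (rule emeasure_lborel_ball_finite)
    finally have "integrable lborel (indicator (ball 0 R - {0::real^4}) :: _ \<Rightarrow> real)"
      by (intro integrable_real_indicator) auto
    then show ?thesis by (simp add: scaleR_conv_of_real)
  qed
  also have "measure lborel (ball 0 R - {0::real^4}) = measure lborel (ball 0 R :: (real^4) set)"
    by (intro measure_Diff_null_set) auto
  also have "\<dots> = pi\<^sup>2 / 2 * R ^ 4"
    using R content_ball[of R "0::real^4"] by (simp add: unit_ball_vol_4)
  finally show ?thesis using R by (simp add: scaleR_conv_of_real power_numeral_reduce)
qed

section \<open>Infinitesimal invariance of the surface integral\<close>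

text \<open>Finite sums of products of a function of the parameter and a regular function of \<open>Z\<close>. For such families
  differentiation in the parameter commutes with integration for a trivial reason: no dominated
  convergence is involved.\<close>
inductive_set tensors :: "(real \<Rightarrow> HC \<Rightarrow> complex) set" where
  basic: "(c has_vector_derivative c') (at 0) \<Longrightarrow> G \<in> regular_functions \<Longrightarrow> (\<lambda>\<theta> Z. c \<theta> * G Z) \<in> tensors"
| add: "H1 \<in> tensors \<Longrightarrow> H2 \<in> tensors \<Longrightarrow> (\<lambda>\<theta> Z. H1 \<theta> Z + H2 \<theta> Z) \<in> tensors"

lemma tensors_const: "G \<in> regular_functions \<Longrightarrow> (\<lambda>\<theta>. G) \<in> tensors"
  using tensors.basic[OF has_vector_derivative_const[of 1 "at 0"]] by simp

lemma tensors_mult_basic: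
  assumes "H \<in> tensors" "(c has_vector_derivative c') (at 0)" "G \<in> regular_functions"
  shows "(\<lambda>\<theta> Z. c \<theta> * G Z * H \<theta> Z) \<in> tensors"
  using assms(1)
proof induction
  case (basic c1 c1' G1)
  have "(\<lambda>\<theta> Z. (c \<theta> * c1 \<theta>) * (G Z * G1 Z)) \<in> tensors"
    by (rule tensors.basic[OF has_vector_derivative_mult[OF assms(2) basic(1)]])
       (intro regular_functions.mult assms basic)
  then show ?case by (simp add: mult_ac)
next
  case (add H1 H2)
  from tensors.add[OF add.IH] show ?case by (simp add: distrib_left)
qed

lemma tensors_mult: "H1 \<in> tensors \<Longrightarrow> H2 \<in> tensors \<Longrightarrow> (\<lambda>\<theta> Z. H1 \<theta> Z * H2 \<theta> Z) \<in> tensors"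
proof (induction rule: tensors.induct)
  case (basic c c' G)
  then show ?case using tensors_mult_basic by blast
next
  case (add H1 H1')
  from tensors.add[OF add.IH(1)[OF add.prems] add.IH(2)[OF add.prems]] show ?case by (simp add: distrib_right)
qed

lemma tensor_deriv:
  assumes R: "R > 0" and "H \<in> tensors"
  shows "\<exists>H'. H' \<in> regular_functions \<and> (\<forall>\<theta>. H \<theta> \<in> regular_functions) \<and> (\<forall>Z. ((\<lambda>\<theta>. H \<theta> Z) has_vector_derivative H' Z) (at 0)) \<and>
     ((\<lambda>\<theta>. \<integral>X. H \<theta> X \<partial>dS R) has_vector_derivative (\<integral>X. H' X \<partial>dS R)) (at 0)"
  using assms(2)
proof induction
  case (basic c c' G)
  show ?case
  proof (intro exI[of _ "\<lambda>Z. c' * G Z"] conjI allI)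
    show "((\<lambda>\<theta>. c \<theta> * G Z) has_vector_derivative c' * G Z) (at 0)" for Z
      using has_vector_derivative_mult[OF basic(1) has_vector_derivative_const[of "G Z"]] by simp
    show "((\<lambda>\<theta>. \<integral>X. c \<theta> * G X \<partial>dS R) has_vector_derivative (\<integral>X. c' * G X \<partial>dS R)) (at 0)"
      using has_vector_derivative_mult[OF basic(1) has_vector_derivative_const[of "\<integral>X. G X \<partial>dS R"]] by simp
  qed (use basic in \<open>auto intro: regular_scale\<close>)
next
  case (add H1 H2)
  then obtain H1' H2' where
    1: "H1' \<in> regular_functions" "\<And>\<theta>. H1 \<theta> \<in> regular_functions" "\<And>Z. ((\<lambda>\<theta>. H1 \<theta> Z) has_vector_derivative H1' Z) (at 0)"
     "((\<lambda>\<theta>. \<integral>X. H1 \<theta> X \<partial>dS R) has_vector_derivative (\<integral>X. H1' X \<partial>dS R)) (at 0)"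
    and 2: "H2' \<in> regular_functions" "\<And>\<theta>. H2 \<theta> \<in> regular_functions" "\<And>Z. ((\<lambda>\<theta>. H2 \<theta> Z) has_vector_derivative H2' Z) (at 0)"
     "((\<lambda>\<theta>. \<integral>X. H2 \<theta> X \<partial>dS R) has_vector_derivative (\<integral>X. H2' X \<partial>dS R)) (at 0)"
    by blast
  show ?case
  proof (intro exI[of _ "\<lambda>Z. H1' Z + H2' Z"] conjI allI)
    show "((\<lambda>\<theta>. \<integral>X. H1 \<theta> X + H2 \<theta> X \<partial>dS R) has_vector_derivative (\<integral>X. H1' X + H2' X \<partial>dS R)) (at 0)"
      using has_vector_derivative_add[OF 1(4) 2(4)] 1 2 by (simp add: Bochner_Integration.integral_add regular_integrable[OF R])
  qed (use 1 2 in \<open>auto intro: regular_functions.add has_vector_derivative_add\<close>)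
qed

text \<open>Along a family of substitutions that preserves the determinant, the inverse determinant is constant;
  only the coordinates have to be checked.\<close>
lemma regular_tensor:
  assumes "\<And>\<theta> Z. det (A \<theta> Z) = det Z" and "\<And>i j. (\<lambda>\<theta>. on_units (\<lambda>Z. A \<theta> Z $ i $ j)) \<in> tensors"
    and "F \<in> regular_functions"
  shows "(\<lambda>\<theta> Z. F (A \<theta> Z)) \<in> tensors"
  using assms(3)
proof induction
  case (const c)
  then show ?case using tensors_const[OF regular_functions.const[of c]] by (simp add: on_units_def assms(1))
next
  case (coord i j)
  then show ?case using assms(2)[of i j] by (simp add: on_units_def assms(1))
next
  case inv_norm
  then show ?case using tensors_const[OF regular_functions.inv_norm] by (simp add: on_units_def assms(1) cong: if_cong)
next
  case (add f g)
  then show ?case by (simp add: tensors.add)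
next
  case (mult f g)
  then show ?case by (simp add: tensors_mult)
qed

lemma integral_dS_cong:
  "(\<And>X. X \<in> S3 R \<Longrightarrow> f X = g X) \<Longrightarrow> (\<integral>X. f X \<partial>dS R) = (\<integral>X. g X \<partial>dS R)"
  by (rule Bochner_Integration.integral_cong) (auto simp: space_dS)

text \<open>The integral does not depend on the parameter, so its derivative, the integral of the derivative of
  \<open>F\<close> along the generating vector field, vanishes.\<close>
lemma infinitesimal_invariance:
  assumes R: "R > 0" and A: "\<And>\<theta> Z. det (A \<theta> Z) = det Z" "\<And>i j. (\<lambda>\<theta>. on_units (\<lambda>Z. A \<theta> Z $ i $ j)) \<in> tensors"
    and A0: "\<And>Z. A 0 Z = Z" and A': "\<And>Z. ((\<lambda>\<theta>. A \<theta> Z) has_vector_derivative V Z) (at 0)"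
    and F: "F \<in> regular_functions" and D: "\<And>Z. det Z \<noteq> 0 \<Longrightarrow> (F has_derivative D Z) (at Z)"
    and inv: "\<And>\<theta>. (\<integral>X. F (A \<theta> X) \<partial>dS R) = (\<integral>X. F X \<partial>dS R)"
  shows "integrable (dS R) (\<lambda>Z. D Z (V Z)) \<and> (\<integral>X. D X (V X) \<partial>dS R) = 0"
proof -
  obtain H' where H': "H' \<in> regular_functions" "\<And>Z. ((\<lambda>\<theta>. F (A \<theta> Z)) has_vector_derivative H' Z) (at 0)"
     "((\<lambda>\<theta>. \<integral>X. F (A \<theta> X) \<partial>dS R) has_vector_derivative (\<integral>X. H' X \<partial>dS R)) (at 0)"
    using tensor_deriv[OF R regular_tensor[OF A F]] by blast
  have eq: "H' Z = D Z (V Z)" if "det Z \<noteq> 0" for Z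
  proof -
    have "((\<lambda>\<theta>. F (A \<theta> Z)) has_derivative (\<lambda>x. D Z (x *\<^sub>R V Z))) (at 0)"
      by (rule has_derivative_compose[OF A'[of Z, unfolded has_vector_derivative_def]]) (simp add: A0 D that)
    moreover have "linear (D Z)" using D[OF that] has_derivative_linear by blast
    ultimately have "((\<lambda>\<theta>. F (A \<theta> Z)) has_vector_derivative D Z (V Z)) (at 0)"
      by (simp add: has_vector_derivative_def linear_scale)
    then show ?thesis using H'(2)[of Z] vector_derivative_unique_at by blast
  qed
  have "(\<integral>X. H' X \<partial>dS R) = 0"
    using H'(3) unfolding inv by (metis has_vector_derivative_const vector_derivative_unique_at)
  then have zero: "(\<integral>X. D X (V X) \<partial>dS R) = 0"
    using integral_dS_cong[of R H' "\<lambda>X. D X (V X)"] eq S3_units[OF R] by auto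
  have "integrable (dS R) H'" by (rule regular_integrable[OF R H'(1)])
  moreover have "integrable (dS R) H' = integrable (dS R) (\<lambda>Z. D Z (V Z))"
    by (rule Bochner_Integration.integrable_cong) (auto simp: space_dS eq dest: S3_units[OF R])
  ultimately show ?thesis using zero by simp
qed

text \<open>The one-parameter group of unit quaternions generated by \<open>e j\<close>.\<close>
definition circle_quat :: "4 \<Rightarrow> real \<Rightarrow> real^4" where
  "circle_quat j \<theta> = cos \<theta> *\<^sub>R axis 0 1 + sin \<theta> *\<^sub>R axis j 1"

lemma quat_axis: "quat (axis j 1) = e j"
proof -
  have "quat (axis j 1) = (\<Sum>i\<in>UNIV. if i = j then e i else 0)"
    unfolding quat_def by (intro sum.cong refl matrix_entries_eqI) (auto simp: axis_def)
  then show ?thesis by simp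
qed

lemma norm_uq: "j \<noteq> 0 \<Longrightarrow> norm (circle_quat j \<theta>) = 1"
proof -
  assume j: "j \<noteq> 0"
  have "(circle_quat j \<theta>) \<bullet> (circle_quat j \<theta>) = (cos \<theta>)\<^sup>2 + (sin \<theta>)\<^sup>2"
    using j by (simp add: circle_quat_def inner_add_left inner_add_right inner_axis_axis power2_eq_square)
  then show ?thesis by (simp add: norm_eq_sqrt_inner)
qed

lemma e_0: "e 0 = mat 1"
  by (rule matrix_entries_eqI) (auto simp: mat_def)

lemma quat_uq: "quat (circle_quat j \<theta>) = cos \<theta> *\<^sub>R mat 1 + sin \<theta> *\<^sub>R e j"
  by (simp add: circle_quat_def linear_add[OF linear_quat] quat_scaleR quat_axis e_0)

lemma quat_uq_entry: "quat (circle_quat j \<theta>) $ a $ b = of_real (cos \<theta>) * (mat 1 :: HC) $ a $ b + of_real (sin \<theta>) * e j $ a $ b"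
  unfolding quat_uq by simp (simp add: scaleR_conv_of_real)

lemma cos_deriv0: "((\<lambda>\<theta>. complex_of_real (cos \<theta>)) has_vector_derivative 0) (at 0)"
  and sin_deriv0: "((\<lambda>\<theta>. complex_of_real (sin \<theta>)) has_vector_derivative 1) (at 0)"
  using has_vector_derivative_of_real[OF DERIV_cos[of "0::real"]] has_vector_derivative_of_real[OF DERIV_sin[of "0::real"]]
  by simp_all

lemma quat_uq_entry_deriv: "((\<lambda>\<theta>. quat (circle_quat j \<theta>) $ a $ b) has_vector_derivative e j $ a $ b) (at 0)"
  unfolding quat_uq_entry
  using has_vector_derivative_add[OF has_vector_derivative_mult[OF cos_deriv0 has_vector_derivative_const]
     has_vector_derivative_mult[OF sin_deriv0 has_vector_derivative_const], of "(mat 1::HC)$a$b" "e j $ a $ b"] by simp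

lemma HC_has_vector_derivative:
  assumes "\<And>a b. ((\<lambda>\<theta>. (f \<theta> :: HC) $ a $ b) has_vector_derivative V $ a $ b) (at t)"
  shows "(f has_vector_derivative V) (at t)"
  unfolding has_vector_derivative_def has_derivative_componentwise_within[of f _ t UNIV]
proof
  fix i :: HC assume "i \<in> Basis"
  then obtain a b u where i: "i = axis a (axis b u)" by (auto simp: Basis_vec_def)
  show "((\<lambda>x. f x \<bullet> i) has_derivative (\<lambda>x. x *\<^sub>R V \<bullet> i)) (at t)"
    using has_derivative_inner_left[OF assms[of a b, unfolded has_vector_derivative_def], of u]
    by (simp add: i inner_axis)
qed

lemma coord_tensor: "((c has_vector_derivative c') (at 0)) \<Longrightarrow> (\<lambda>\<theta>. on_units (\<lambda>Z. c \<theta> * Z $ i $ j)) \<in> tensors"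
proof -
  assume "(c has_vector_derivative c') (at 0)"
  from tensors.basic[OF this regular_functions.coord[of i j]]
  have "(\<lambda>\<theta> Z. c \<theta> * on_units (\<lambda>Z. Z $ i $ j) Z) \<in> tensors" .
  moreover have "(\<lambda>\<theta> Z. c \<theta> * on_units (\<lambda>Z. Z $ i $ j) Z) = (\<lambda>\<theta>. on_units (\<lambda>Z. c \<theta> * Z $ i $ j))"
    by (intro ext) (simp add: on_units_def)
  ultimately show ?thesis by simp
qed

lemma coord_tensor_add:
  assumes "(\<lambda>\<theta>. on_units (f \<theta>)) \<in> tensors" "(\<lambda>\<theta>. on_units (g \<theta>)) \<in> tensors"
  shows "(\<lambda>\<theta>. on_units (\<lambda>Z. f \<theta> Z + g \<theta> Z)) \<in> tensors"
proof -
  have "(\<lambda>\<theta>. on_units (\<lambda>Z. f \<theta> Z + g \<theta> Z)) = (\<lambda>\<theta> Z. on_units (f \<theta>) Z + on_units (g \<theta>) Z)"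
    by (intro ext) (simp add: on_units_def)
  then show ?thesis using tensors.add[OF assms] by simp
qed

lemma det_quat_uq: "j \<noteq> 0 \<Longrightarrow> det (quat (circle_quat j \<theta>)) = 1"
  by (simp add: det_quat norm_uq)

lemma integral_dS_quat_mult:
  assumes "R > 0" "norm u = 1" "F \<in> regular_functions"
  shows "(\<integral>X. F (quat u ** X) \<partial>dS R) = (\<integral>X. F X \<partial>dS R)"
    "(\<integral>X. F (X ** quat u) \<partial>dS R) = (\<integral>X. F X \<partial>dS R)"
proof -
  have du: "det (quat u) = 1" by (simp add: det_quat assms)
  have l: "continuous_on UNIV (\<lambda>X. quat u ** X)" "continuous_on UNIV (\<lambda>X. X ** quat u)"
    unfolding matrix_matrix_mult_def by (intro continuous_intros)+
  have "continuous_on (S3 R) (\<lambda>X. F (quat u ** X))" "continuous_on (S3 R) (\<lambda>X. F (X ** quat u))"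
    by (rule continuous_on_compose2[OF regular_continuous[OF assms(3)]];
        use l S3_units[OF assms(1)] du in \<open>auto simp: det_mul intro: continuous_on_subset\<close>)+
  then have m: "(\<lambda>X. F (quat u ** X)) \<in> borel_measurable (restrict_space borel (S3 R))"
    "(\<lambda>X. F (X ** quat u)) \<in> borel_measurable (restrict_space borel (S3 R))"
    by (auto intro: borel_measurable_continuous_on_restrict)
  show "(\<integral>X. F (quat u ** X) \<partial>dS R) = (\<integral>X. F X \<partial>dS R)"
    by (rule integral_dS_orthogonal[OF assms(1) regular_measurable[OF assms(1,3)] m(1) orthogonal_left[OF assms(2)]])
       (simp add: quat_left_mult)
  show "(\<integral>X. F (X ** quat u) \<partial>dS R) = (\<integral>X. F X \<partial>dS R)"
    by (rule integral_dS_orthogonal[OF assms(1) regular_measurable[OF assms(1,3)] m(2) orthogonal_right[OF assms(2)]])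
       (simp add: quat_left_mult)
qed

text \<open>Differentiation of the invariance under the group of unit quaternions generated by \<open>e j\<close>.\<close>
lemma left_infinitesimal:
  assumes R: "R > 0" and j: "j \<noteq> 0" and F: "F \<in> regular_functions" and D: "\<And>Z. det Z \<noteq> 0 \<Longrightarrow> (F has_derivative D Z) (at Z)"
  shows "integrable (dS R) (\<lambda>Z. D Z (e j ** Z)) \<and> (\<integral>X. D X (e j ** X) \<partial>dS R) = 0"
proof (rule infinitesimal_invariance[where A = "\<lambda>\<theta> Z. quat (circle_quat j \<theta>) ** Z" and F = F])
  show "det (quat (circle_quat j \<theta>) ** Z) = det Z" for \<theta> Z by (simp add: det_mul det_quat_uq j)
  show "(\<lambda>\<theta>. on_units (\<lambda>Z. (quat (circle_quat j \<theta>) ** Z) $ a $ b)) \<in> tensors" for a b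
    unfolding mult_2_entry by (intro coord_tensor_add quat_uq_entry_deriv[THEN coord_tensor])
  show "quat (circle_quat j 0) ** Z = Z" for Z by (simp add: quat_uq)
  show "((\<lambda>\<theta>. quat (circle_quat j \<theta>) ** Z) has_vector_derivative e j ** Z) (at 0)" for Z :: HC
  proof (rule HC_has_vector_derivative)
    fix a b
    show "((\<lambda>\<theta>. (quat (circle_quat j \<theta>) ** Z) $ a $ b) has_vector_derivative (e j ** Z) $ a $ b) (at 0)"
      unfolding mult_2_entry
      using has_vector_derivative_add[OF has_vector_derivative_mult[OF quat_uq_entry_deriv has_vector_derivative_const] has_vector_derivative_mult[OF quat_uq_entry_deriv has_vector_derivative_const]] by simp
  qed
  show "(\<integral>X. F (quat (circle_quat j \<theta>) ** X) \<partial>dS R) = (\<integral>X. F X \<partial>dS R)" for \<theta>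
    by (rule integral_dS_quat_mult[OF R norm_uq[OF j] F])
qed (use assms in auto)

lemma right_infinitesimal:
  assumes R: "R > 0" and j: "j \<noteq> 0" and F: "F \<in> regular_functions" and D: "\<And>Z. det Z \<noteq> 0 \<Longrightarrow> (F has_derivative D Z) (at Z)"
  shows "integrable (dS R) (\<lambda>Z. D Z (Z ** e j)) \<and> (\<integral>X. D X (X ** e j) \<partial>dS R) = 0"
proof (rule infinitesimal_invariance[where A = "\<lambda>\<theta> Z. Z ** quat (circle_quat j \<theta>)" and F = F])
  show "det (Z ** quat (circle_quat j \<theta>)) = det Z" for \<theta> Z by (simp add: det_mul det_quat_uq j)
  show "(\<lambda>\<theta>. on_units (\<lambda>Z. (Z ** quat (circle_quat j \<theta>)) $ a $ b)) \<in> tensors" for a b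
    unfolding mult_2_entry mult.commute[of "_ $ a $ _"] by (intro coord_tensor_add quat_uq_entry_deriv[THEN coord_tensor])
  show "Z ** quat (circle_quat j 0) = Z" for Z by (simp add: quat_uq)
  show "((\<lambda>\<theta>. Z ** quat (circle_quat j \<theta>)) has_vector_derivative Z ** e j) (at 0)" for Z :: HC
  proof (rule HC_has_vector_derivative)
    fix a b
    show "((\<lambda>\<theta>. (Z ** quat (circle_quat j \<theta>)) $ a $ b) has_vector_derivative (Z ** e j) $ a $ b) (at 0)"
      unfolding mult_2_entry
      using has_vector_derivative_add[OF has_vector_derivative_mult[OF has_vector_derivative_const quat_uq_entry_deriv] has_vector_derivative_mult[OF has_vector_derivative_const quat_uq_entry_deriv]] by simp
  qed
  show "(\<integral>X. F (X ** quat (circle_quat j \<theta>)) \<partial>dS R) = (\<integral>X. F X \<partial>dS R)" for \<theta>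
    by (rule integral_dS_quat_mult[OF R norm_uq[OF j] F])
qed (use assms in auto)

lemma ddet_add: "ddet Z (V + W) = ddet Z V + ddet Z W" by (simp add: ddet_def algebra_simps)
lemma S_diff_add: "S_diff p q r Z (V + W) = S_diff p q r Z V + S_diff p q r Z W" by (simp add: S_diff_def algebra_simps)
lemma dE_add: "dE i Z (V + W) = dE i Z V + dE i Z W"
  by (simp add: dE_def ddet_add S_diff_add algebra_simps split: prod.splits)

text \<open>The derivative of a product of two functions \<open>E\<close>.\<close>
definition dEE :: "idx \<Rightarrow> idx \<Rightarrow> HC \<Rightarrow> HC \<Rightarrow> complex" where
  "dEE i j Z V = E i Z * dE j Z V + dE i Z V * E j Z"

lemma EE_has_derivative: "det Z \<noteq> 0 \<Longrightarrow> ((\<lambda>Z. E i Z * E j Z) has_derivative dEE i j Z) (at Z)"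
  unfolding dEE_def[abs_def] by (intro has_derivative_mult E_has_derivative)

lemma dEE_add: "dEE i j Z (V + W) = dEE i j Z V + dEE i j Z W" by (simp add: dEE_def dE_add algebra_simps)
lemma dEE_smul: "dEE i j Z (smul t V) = dEE i j Z V * t" by (simp add: dEE_def dE_smul algebra_simps)

lemma EE_regular: "(\<lambda>Z. E i Z * E j Z) \<in> regular_functions"
  by (intro regular_functions.mult E_regular)

text \<open>The complexified Lie algebra of \<open>SU(2)\<close> is spanned by the off-diagonal matrix units and the
  difference of the diagonal ones.\<close>
lemma U_e: "U 2 1 = smul (1/2) (e 2) + smul (\<i>/2) (e 1)" "U 1 2 = smul (-1/2) (e 2) + smul (\<i>/2) (e 1)"
  "smul \<i> (e 3) = U 1 1 + smul (-1) (U 2 2)"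
  by (auto intro!: matrix_entries_eqI)

lemma smul_mult: "smul t A ** B = smul t (A ** B)" "A ** smul t B = smul t (A ** B)"
  for A B :: HC
  by (rule matrix_entries_eqI; simp add: mult_2_entry algebra_simps)+

lemma add_mult: "(A + C) ** B = A ** B + C ** B" "B ** (A + C) = B ** A + B ** C"
  for A B C :: HC
  by (rule matrix_entries_eqI; simp add: mult_2_entry algebra_simps)+

lemma EE_invariance_left:
  assumes R: "R > 0"
  shows "a \<noteq> b \<Longrightarrow> (\<integral>X. dEE i j X (U a b ** X) \<partial>dS R) = 0"
    "(\<integral>X. dEE i j X (U 1 1 ** X) - dEE i j X (U 2 2 ** X) \<partial>dS R) = 0"
proof -
  have n0: "(1::4) \<noteq> 0" "(2::4) \<noteq> 0" "(3::4) \<noteq> 0" by auto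
  note L = left_infinitesimal[OF R _ EE_regular EE_has_derivative]
  note l = L[OF n0(1), of i j] L[OF n0(2), of i j] L[OF n0(3), of i j]
  show "(\<integral>X. dEE i j X (U a b ** X) \<partial>dS R) = 0" if "a \<noteq> b"
  proof -
    have "(\<integral>X. dEE i j X (U 2 1 ** X) \<partial>dS R) = 0" "(\<integral>X. dEE i j X (U 1 2 ** X) \<partial>dS R) = 0"
      using l unfolding U_e smul_mult add_mult dEE_add dEE_smul by (simp_all add: Bochner_Integration.integral_add)
    then show ?thesis using that exhaust_2[of a] exhaust_2[of b] by auto
  qed
  have "dEE i j X (U 1 1 ** X) - dEE i j X (U 2 2 ** X) = dEE i j X (e 3 ** X) * \<i>" for X
  proof -
    have "dEE i j X (e 3 ** X) * \<i> = dEE i j X (smul \<i> (e 3) ** X)" by (simp only: smul_mult dEE_smul)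
    then show ?thesis by (simp only: U_e smul_mult add_mult dEE_add dEE_smul) simp
  qed
  then show "(\<integral>X. dEE i j X (U 1 1 ** X) - dEE i j X (U 2 2 ** X) \<partial>dS R) = 0" using l by simp
qed

lemma EE_invariance_right:
  assumes R: "R > 0"
  shows "a \<noteq> b \<Longrightarrow> (\<integral>X. dEE i j X (X ** U a b) \<partial>dS R) = 0"
    "(\<integral>X. dEE i j X (X ** U 1 1) - dEE i j X (X ** U 2 2) \<partial>dS R) = 0"
proof -
  have n0: "(1::4) \<noteq> 0" "(2::4) \<noteq> 0" "(3::4) \<noteq> 0" by auto
  note L = right_infinitesimal[OF R _ EE_regular EE_has_derivative]
  note l = L[OF n0(1), of i j] L[OF n0(2), of i j] L[OF n0(3), of i j]
  show "(\<integral>X. dEE i j X (X ** U a b) \<partial>dS R) = 0" if "a \<noteq> b"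
  proof -
    have "(\<integral>X. dEE i j X (X ** U 2 1) \<partial>dS R) = 0" "(\<integral>X. dEE i j X (X ** U 1 2) \<partial>dS R) = 0"
      using l unfolding U_e smul_mult add_mult dEE_add dEE_smul by (simp_all add: Bochner_Integration.integral_add)
    then show ?thesis using that exhaust_2[of a] exhaust_2[of b] by auto
  qed
  have "dEE i j X (X ** U 1 1) - dEE i j X (X ** U 2 2) = dEE i j X (X ** e 3) * \<i>" for X
  proof -
    have "dEE i j X (X ** e 3) * \<i> = dEE i j X (X ** smul \<i> (e 3))" by (simp only: smul_mult dEE_smul)
    then show ?thesis by (simp only: U_e smul_mult add_mult dEE_add dEE_smul) simp
  qed
  then show "(\<integral>X. dEE i j X (X ** U 1 1) - dEE i j X (X ** U 2 2) \<partial>dS R) = 0" using l by simp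
qed

section \<open>Orthogonality on spheres\<close>

text \<open>The exponents of the determinant are irrelevant on a sphere, where the determinant is constant.\<close>
definition J :: "real \<Rightarrow> int \<Rightarrow> int \<Rightarrow> int \<Rightarrow> int \<Rightarrow> int \<Rightarrow> int \<Rightarrow> complex" where
  "J R p q r p' q' t = (\<integral>X. E (0,p,q,r) X * E (0,p',q',t) X \<partial>dS R)"

lemma J_sym: "J R p q r p' q' t = J R p' q' t p q r" by (simp add: J_def mult.commute)

lemma J_0: "(0,p,q,r) \<notin> II \<or> (0,p',q',t) \<notin> II \<Longrightarrow> J R p q r p' q' t = 0"
  unfolding J_def using E_outside by auto

lemma integral_lincomb:
  assumes "R > 0"
  shows "(\<integral>X. c * (E i X * E j X) + c' * (E i' X * E j' X) \<partial>dS R) = c * (\<integral>X. E i X * E j X \<partial>dS R) + c' * (\<integral>X. E i' X * E j' X \<partial>dS R)"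
  using regular_integrable[OF assms EE_regular] by (simp add: Bochner_Integration.integral_add)

context
  fixes R :: real and p q p' q' :: int
  assumes R: "R > 0" and nz: "p + q + 1 \<noteq> 0" "p' + q' + 1 \<noteq> 0"
begin

text \<open>Raising operators of the left \<open>SU(2)\<close>. The next three lemmas are the analogue for the right action
  and the weight conditions from the diagonal generators.\<close>
lemma J_left: "ci (r+1) * J R p q (r+1) p' q' t + ci (t+1) * J R p q r p' q' (t+1) = 0"
proof -
  have "(\<integral>X. dEE (0,p,q,r) (0,p',q',t) X (U 2 1 ** X) \<partial>dS R) = 0" by (rule EE_invariance_left[OF R]) simp
  moreover have "dEE (0,p,q,r) (0,p',q',t) X (U 2 1 ** X) =
    ci (r+1) * (E (0,p,q,r+1) X * E (0,p',q',t) X) + ci (t+1) * (E (0,p,q,r) X * E (0,p',q',t+1) X)" if "X \<in> S3 R" for X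
    unfolding dEE_def left_op_dE[OF S3_units[OF R that] nz(1)] left_op_dE[OF S3_units[OF R that] nz(2)]
    by (simp add: left_op.simps lin_def)
  ultimately have "(\<integral>X. ci (r+1) * (E (0,p,q,r+1) X * E (0,p',q',t) X) + ci (t+1) * (E (0,p,q,r) X * E (0,p',q',t+1) X) \<partial>dS R) = 0"
    using integral_dS_cong[of R "\<lambda>X. dEE (0,p,q,r) (0,p',q',t) X (U 2 1 ** X)"] by fastforce
  then show ?thesis by (simp only: integral_lincomb[OF R] J_def)
qed

lemma J_right: "ci (p+1) * J R (p+1) (q-1) r p' q' t + ci (p'+1) * J R p q r (p'+1) (q'-1) t = 0"
proof -
  have "(\<integral>X. dEE (0,p,q,r) (0,p',q',t) X (X ** U 1 2) \<partial>dS R) = 0" by (rule EE_invariance_right[OF R]) simp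
  moreover have "dEE (0,p,q,r) (0,p',q',t) X (X ** U 1 2) =
    ci (p+1) * (E (0,p+1,q-1,r) X * E (0,p',q',t) X) + ci (p'+1) * (E (0,p,q,r) X * E (0,p'+1,q'-1,t) X)" if "X \<in> S3 R" for X
    unfolding dEE_def right_op_dE[OF S3_units[OF R that] nz(1)] right_op_dE[OF S3_units[OF R that] nz(2)]
    by (simp add: right_op.simps lin_def)
  ultimately have "(\<integral>X. ci (p+1) * (E (0,p+1,q-1,r) X * E (0,p',q',t) X) + ci (p'+1) * (E (0,p,q,r) X * E (0,p'+1,q'-1,t) X) \<partial>dS R) = 0"
    using integral_dS_cong[of R "\<lambda>X. dEE (0,p,q,r) (0,p',q',t) X (X ** U 1 2)"] by fastforce
  then show ?thesis by (simp only: integral_lincomb[OF R] J_def)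
qed

lemma J_weight_left: "2 * r + 2 * t \<noteq> p + q + p' + q' \<Longrightarrow> J R p q r p' q' t = 0"
proof -
  assume ne: "2 * r + 2 * t \<noteq> p + q + p' + q'"
  let ?c = "ci (2 * r + 2 * t - (p + q + p' + q'))"
  have "dEE (0,p,q,r) (0,p',q',t) X (U 1 1 ** X) - dEE (0,p,q,r) (0,p',q',t) X (U 2 2 ** X)
    = ?c * (E (0,p,q,r) X * E (0,p',q',t) X)" if "X \<in> S3 R" for X
    unfolding dEE_def left_op_dE[OF S3_units[OF R that] nz(1)] left_op_dE[OF S3_units[OF R that] nz(2)]
    by (simp add: left_op.simps lin_def algebra_simps)
  then have "(\<integral>X. ?c * (E (0,p,q,r) X * E (0,p',q',t) X) \<partial>dS R) = 0"
    using EE_invariance_left(2)[OF R, of "(0,p,q,r)" "(0,p',q',t)"]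
      integral_dS_cong[of R "\<lambda>X. dEE (0,p,q,r) (0,p',q',t) X (U 1 1 ** X) - dEE (0,p,q,r) (0,p',q',t) X (U 2 2 ** X)"] by fastforce
  then have "?c * J R p q r p' q' t = 0" by (simp only: J_def Bochner_Integration.integral_mult_right_zero)
  moreover have "?c \<noteq> 0" using ne by (metis eq_iff_diff_eq_0 of_int_eq_0_iff)
  ultimately show ?thesis by simp
qed

lemma J_weight_right: "p + p' \<noteq> q + q' \<Longrightarrow> J R p q r p' q' t = 0"
proof -
  assume ne: "p + p' \<noteq> q + q'"
  let ?c = "ci (p + p' - (q + q'))"
  have "dEE (0,p,q,r) (0,p',q',t) X (X ** U 1 1) - dEE (0,p,q,r) (0,p',q',t) X (X ** U 2 2)
    = ?c * (E (0,p,q,r) X * E (0,p',q',t) X)" if "X \<in> S3 R" for X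
    unfolding dEE_def right_op_dE[OF S3_units[OF R that] nz(1)] right_op_dE[OF S3_units[OF R that] nz(2)]
    by (simp add: right_op.simps lin_def algebra_simps)
  then have "(\<integral>X. ?c * (E (0,p,q,r) X * E (0,p',q',t) X) \<partial>dS R) = 0"
    using EE_invariance_right(2)[OF R, of "(0,p,q,r)" "(0,p',q',t)"]
      integral_dS_cong[of R "\<lambda>X. dEE (0,p,q,r) (0,p',q',t) X (X ** U 1 1) - dEE (0,p,q,r) (0,p',q',t) X (X ** U 2 2)"] by fastforce
  then have "?c * J R p q r p' q' t = 0" by (simp only: J_def Bochner_Integration.integral_mult_right_zero)
  moreover have "?c \<noteq> 0" using ne by (metis eq_iff_diff_eq_0 of_int_eq_0_iff)
  ultimately show ?thesis by simp
qed

end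

definition ifact :: "int \<Rightarrow> complex" where "ifact n = dpow n 1"

lemma ifact_rec: "of_int (n + 1) * ifact (n + 1) = ifact n"
  using dpow_mult[of 1 n] by (simp add: ifact_def)

lemma ifact_rec': "of_int n * ifact n = ifact (n - 1)"
  using ifact_rec[of "n - 1"] by simp

lemma ifact_0 [simp]: "ifact 0 = 1" by (simp add: ifact_def)
lemma ifact_neg [simp]: "n < 0 \<Longrightarrow> ifact n = 0" by (simp add: ifact_def)
lemma ifact_nz: "n \<ge> 0 \<Longrightarrow> ifact n \<noteq> 0" by (simp add: ifact_def dpow_def)

text \<open>Representations of different dimension are orthogonal: by the weight condition \<open>r + t\<close> is fixed, and the
  raising relation moves the pair \<open>(r, t)\<close> along this line until \<open>r\<close> leaves the range of the smaller
  representation, where the integral vanishes, while \<open>t\<close> is still inside the range of the larger one.\<close>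
lemma J_deg_less:
  assumes R: "R > 0" and pos: "p \<ge> 0" "q \<ge> 0" "p' \<ge> 0" "q' \<ge> 0" and d: "p + q < p' + q'"
  shows "J R p q r p' q' t = 0"
proof (cases "2 * r + 2 * t = p + q + p' + q'")
  case False
  then show ?thesis using pos by (intro J_weight_left R) auto
next
  case True
  define d where "d = p + q"
  define \<delta> where "\<delta> = r + t - d"
  have \<delta>: "\<delta> > 0" "t = d + \<delta> - r" using True d by (auto simp: \<delta>_def d_def)
  \<comment> \<open>The induction starts at \<open>r = d + 1\<close>, one step outside the range; the pair \<open>(r, t)\<close> then descends in \<open>r\<close>. The factor \<open>\<delta> + n\<close> never vanishes.\<close>
  have "J R p q (d + 1 - int n) p' q' (\<delta> - 1 + int n) = 0" for n
  proof (induction n)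
    case 0
    then show ?case by (intro J_0) (auto simp: II_def d_def)
  next
    case (Suc n)
    have e: "d - int n + 1 = d + 1 - int n" "\<delta> - 1 + int n + 1 = \<delta> + int n" "d + 1 - int (Suc n) = d - int n" "\<delta> - 1 + int (Suc n) = \<delta> + int n"
      by auto
    have "ci (d - int n + 1) * J R p q (d - int n + 1) p' q' (\<delta> - 1 + int n)
        + ci (\<delta> - 1 + int n + 1) * J R p q (d - int n) p' q' (\<delta> - 1 + int n + 1) = 0"
      by (rule J_left[OF R]) (use pos in auto)
    then have "ci (\<delta> + int n) * J R p q (d - int n) p' q' (\<delta> + int n) = 0" unfolding e Suc by simp
    moreover have "ci (\<delta> + int n) \<noteq> 0" using \<delta> by (metis add_pos_nonneg less_irrefl of_int_eq_0_iff of_nat_0_le_iff)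
    ultimately show ?case unfolding e by simp
  qed
  from this[of "nat (d + 1 - r)"] have "r \<le> d + 1 \<Longrightarrow> ?thesis" by (simp add: \<delta>(2) algebra_simps)
  moreover have "r > d \<Longrightarrow> ?thesis" by (intro J_0) (auto simp: II_def d_def)
  ultimately show ?thesis by linarith
qed

lemma J_deg:
  assumes "R > 0" "p \<ge> 0" "q \<ge> 0" "p' \<ge> 0" "q' \<ge> 0" "p + q \<noteq> p' + q'"
  shows "J R p q r p' q' t = 0"
  using J_deg_less[of R p q p' q' r t] J_deg_less[of R p' q' p q t r] assms J_sym[of R p q r p' q' t] by fastforce

text \<open>The recursion of the alternating binomial coefficients.\<close>
lemma ladder:
  assumes "\<And>n. 0 \<le> n \<Longrightarrow> ci (n + 1) * f (n + 1) + ci (d - n) * f n = 0" "0 \<le> n"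
  shows "ifact d * f n = sg n * ifact n * ifact (d - n) * f 0"
  using assms(2)
proof (induction n rule: int_ge_induct)
  case base
  then show ?case by simp
next
  case (step n)
  have nz: "ci (n + 1) \<noteq> 0" using step.hyps by (metis add_le_same_cancel1 not_one_le_zero of_int_eq_0_iff)
  have "ci (n + 1) * (ifact d * f (n + 1)) = ifact d * (- (ci (d - n) * f n))"
  proof -
    have "ci (n + 1) * f (n + 1) = - (ci (d - n) * f n)"
      using assms(1)[OF step.hyps] by (simp only: eq_neg_iff_add_eq_0)
    then show ?thesis by (simp only: mult.left_commute[of "ci (n + 1)"])
  qed
  also have "\<dots> = - (ci (d - n) * (ifact d * f n))" by simp
  also have "\<dots> = - sg n * ifact n * (ci (d - n) * ifact (d - n)) * f 0" by (simp add: step.IH)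
  also have "\<dots> = - sg n * (ci (n + 1) * ifact (n + 1)) * ifact (d - n - 1) * f 0"
    by (simp only: ifact_rec'[of "d - n"] ifact_rec)
  also have "\<dots> = ci (n + 1) * (sg (n + 1) * ifact (n + 1) * ifact (d - (n + 1)) * f 0)"
    by (simp add: sg_add algebra_simps del: of_int_add)
  finally show ?case using nz by (metis mult_cancel_left)
qed

text \<open>The ladder in \<open>r\<close> of the left action, followed by the ladder in \<open>p\<close> of the right action, reaches the
  extreme index.\<close>
lemma J_ladder:
  assumes R: "R > 0" and pos: "p \<ge> 0" "q \<ge> 0" "0 \<le> r"
  shows "ifact (p+q) * (ifact (p+q) * J R p q r q p (p + q - r))
    = sg (p + r) * ifact p * ifact q * ifact r * ifact (p + q - r) * J R 0 (p+q) 0 (p+q) 0 (p+q)"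
proof -
  define d where "d = p + q"
  have d0: "d \<ge> 0" using pos by (simp add: d_def)
  have 1: "ifact d * J R p q r q p (d - r) = sg r * ifact r * ifact (d - r) * J R p q 0 q p (d - 0)"
  proof (rule ladder[of "\<lambda>x. J R p q x q p (d - x)", OF _ pos(3)])
    fix n :: int assume "0 \<le> n"
    have e: "d - (n + 1) + 1 = d - n" by simp
    have "ci (n+1) * J R p q (n+1) q p (d - (n+1)) + ci (d - (n+1) + 1) * J R p q n q p (d - (n+1) + 1) = 0"
      by (rule J_left[OF R]) (use pos in auto)
    then show "ci (n + 1) * J R p q (n + 1) q p (d - (n + 1)) + ci (d - n) * J R p q n q p (d - n) = 0"
      unfolding e .
  qed
  have 2: "ifact d * J R p (d - p) 0 (d - p) p d = sg p * ifact p * ifact (d - p) * J R 0 (d - 0) 0 (d - 0) 0 d"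
  proof (rule ladder[of "\<lambda>x. J R x (d - x) 0 (d - x) x d", OF _ pos(1)])
    fix n :: int assume n: "0 \<le> n"
    have e: "d - n - 1 + 1 = d - n" "n + 1 - 1 = n" "d - (n + 1) = d - n - 1" by simp_all
    have "ci (n+1) * J R (n+1) (d-n-1) 0 (d-n-1) (n+1) d + ci (d-n-1+1) * J R n (d-n) 0 (d-n-1+1) (n+1-1) d = 0"
      by (rule J_right[OF R]) (use d0 in auto)
    then show "ci (n + 1) * J R (n + 1) (d - (n + 1)) 0 (d - (n + 1)) (n + 1) d + ci (d - n) * J R n (d - n) 0 (d - n) n d = 0"
      unfolding e .
  qed
  have e: "d - p = q" by (simp add: d_def)
  show ?thesis unfolding d_def[symmetric] 1 using 2 unfolding e by (simp add: sg_add algebra_simps)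
qed

text \<open>At the extreme indices \<open>S\<close> is a single monomial, and \<open>R\<^sup>2 = z\<^sub>1\<^sub>1 z\<^sub>2\<^sub>2 - z\<^sub>1\<^sub>2 z\<^sub>2\<^sub>1\<close> on the sphere. This
  relates the integrals in degree \<open>n\<close> to two integrals in degree \<open>n+1\<close>, which the ladder identifies up to
  a factor.\<close>
lemma J_top_rec:
  assumes R: "R > 0" and n: "n \<ge> 0"
  shows "complex_of_real (R\<^sup>2) * J R 0 n 0 n 0 n = of_int ((n + 1) * (n + 2)) * J R 0 (n+1) 0 (n+1) 0 (n+1)"
proof -
  have nz: "ci (n + 1) \<noteq> 0" using n by (metis add_le_same_cancel1 not_one_le_zero of_int_eq_0_iff)
  have pw: "complex_of_real (R\<^sup>2) * (E (0,0,n,0) X * E (0,n,0,n) X) =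
     ci ((n+1)*(n+1)) * (E (0,0,n+1,0) X * E (0,n+1,0,n+1) X) + (-1) * (E (0,0,n+1,1) X * E (0,n+1,0,n) X)"
    if X: "X \<in> S3 R" for X
  proof -
    have u: "det X \<noteq> 0" by (rule S3_units[OF R X])
    have d: "X$1$1 * X$2$2 - X$1$2 * X$2$1 = complex_of_real (R\<^sup>2)" using X unfolding S3_def det_2 by simp
    have 1: "X$2$2 * S 0 n 0 X = ci (n+1) * S 0 (n+1) 0 X" using S_col2[of X 0 n 0] by (simp add: S_eq_0)
    have 2: "X$1$1 * S n 0 n X = ci (n+1) * S (n+1) 0 (n+1) X" using S_col1[of X n 0 "n+1"] by (simp add: S_eq_0)
    have "ci (n+1) * (X$1$2 * S 0 n 0 X) = ci (n+1) * S 0 (n+1) 1 X" using S_mult12[of 0 n X 0] by (simp add: S_eq_0)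
    then have 3: "X$1$2 * S 0 n 0 X = S 0 (n+1) 1 X" using nz by (metis mult_cancel_left)
    have "ci (n+1) * (X$2$1 * S n 0 n X) = ci (n+1) * S (n+1) 0 n X" using S_mult21[of n 0 X n] by (simp add: S_eq_0)
    then have 4: "X$2$1 * S n 0 n X = S (n+1) 0 n X" using nz by (metis mult_cancel_left)
    have "complex_of_real (R\<^sup>2) * (S 0 n 0 X * S n 0 n X) = (X$2$2 * S 0 n 0 X) * (X$1$1 * S n 0 n X) - (X$1$2 * S 0 n 0 X) * (X$2$1 * S n 0 n X)"
      unfolding d[symmetric] by (simp add: algebra_simps)
    then show ?thesis unfolding 1 2 3 4 by (simp add: E_unit[OF u] algebra_simps)
  qed
  have "complex_of_real (R\<^sup>2) * J R 0 n 0 n 0 n = (\<integral>X. complex_of_real (R\<^sup>2) * (E (0,0,n,0) X * E (0,n,0,n) X) \<partial>dS R)"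
    by (simp only: J_def Bochner_Integration.integral_mult_right_zero)
  also have "\<dots> = ci ((n+1)*(n+1)) * J R 0 (n+1) 0 (n+1) 0 (n+1) + (-1) * J R 0 (n+1) 1 (n+1) 0 n"
    unfolding J_def by (rule trans[OF integral_dS_cong[OF pw] integral_lincomb[OF R]])
  also have "J R 0 (n+1) 1 (n+1) 0 n = - ci (n + 1) * J R 0 (n+1) 0 (n+1) 0 (n+1)"
  proof -
    have "ci (0 + 1) * J R 0 (n+1) (0+1) (n+1) 0 n + ci (n+1) * J R 0 (n+1) 0 (n+1) 0 (n+1) = 0"
      by (rule J_left[OF R]) (use n in auto)
    then show ?thesis by (simp add: add_eq_0_iff2 del: of_int_add)
  qed
  finally show ?thesis by (simp add: algebra_simps)
qed

text \<open>Induction from the area of the sphere.\<close>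
lemma J_top:
  assumes R: "R > 0" and n: "n \<ge> 0"
  shows "of_int (n + 1) * J R 0 n 0 n 0 n = complex_of_real (2 * pi\<^sup>2 * R ^ 3 * R\<^sup>2 powi n) * ifact n * ifact n"
  using n
proof (induction n rule: int_ge_induct)
  case base
  have "J R 0 0 0 0 0 0 = (\<integral>X. 1 \<partial>dS R)"
    unfolding J_def by (rule integral_dS_cong) (auto simp: E_unit dest: S3_units[OF R])
  then have "J R 0 0 0 0 0 0 = complex_of_real (2 * pi\<^sup>2 * R ^ 3)" by (simp only: area_S3[OF R])
  then show ?case by simp
next
  case (step n)
  have nz: "ci (n + 1) \<noteq> 0" using step.hyps by (metis add_le_same_cancel1 not_one_le_zero of_int_eq_0_iff)
  have "ci (n+1) * (ci (n+1) * (ci (n + 2) * J R 0 (n+1) 0 (n+1) 0 (n+1))) = complex_of_real (R\<^sup>2) * (ci (n+1) * J R 0 n 0 n 0 n)"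
    using J_top_rec[OF R step.hyps] by (simp add: algebra_simps)
  also have "\<dots> = complex_of_real (2 * pi\<^sup>2 * R ^ 3 * (R\<^sup>2 * R\<^sup>2 powi n)) * (ci (n+1) * ifact (n+1)) * (ci (n+1) * ifact (n+1))"
    unfolding step.IH ifact_rec by (simp add: algebra_simps)
  also have "R\<^sup>2 * R\<^sup>2 powi n = R\<^sup>2 powi (n + 1)" using R by (simp add: power_int_add)
  also have "complex_of_real (2 * pi\<^sup>2 * R ^ 3 * R\<^sup>2 powi (n + 1)) * (ci (n+1) * ifact (n+1)) * (ci (n+1) * ifact (n+1))
     = ci (n+1) * (ci (n+1) * (complex_of_real (2 * pi\<^sup>2 * R ^ 3 * R\<^sup>2 powi (n + 1)) * ifact (n+1) * ifact (n+1)))"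
    by (simp only: mult_ac)
  finally have "ci (n + 2) * J R 0 (n+1) 0 (n+1) 0 (n+1) = complex_of_real (2 * pi\<^sup>2 * R ^ 3 * R\<^sup>2 powi (n + 1)) * ifact (n+1) * ifact (n+1)"
    using nz by (metis mult_cancel_left)
  moreover have "n + 1 + 1 = n + 2" by simp
  ultimately show ?case by (simp only:)
qed

text \<open>The sign and the factorials of the Schur orthogonality relation in the normalisation by divided powers.\<close>
definition wt :: "int \<Rightarrow> int \<Rightarrow> int \<Rightarrow> complex" where
  "wt p q r = sg (p + r) * ifact p * ifact q * ifact r * ifact (p + q - r)"

lemma J_diag:
  assumes R: "R > 0" and pos: "p \<ge> 0" "q \<ge> 0" "0 \<le> r"
  shows "of_int (p + q + 1) * J R p q r q p (p + q - r) = complex_of_real (2 * pi\<^sup>2 * R ^ 3 * R\<^sup>2 powi (p + q)) * wt p q r"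
proof -
  define d where "d = p + q"
  have d: "d \<ge> 0" using pos by (simp add: d_def)
  have "ifact d * ifact d * (of_int (d + 1) * J R p q r q p (d - r)) = of_int (d + 1) * (ifact d * (ifact d * J R p q r q p (d - r)))"
    by (simp only: mult_ac)
  also have "\<dots> = wt p q r * (of_int (d + 1) * J R 0 d 0 d 0 d)"
    unfolding d_def J_ladder[OF R pos] wt_def by (simp only: mult_ac)
  also have "\<dots> = ifact d * ifact d * (complex_of_real (2 * pi\<^sup>2 * R ^ 3 * R\<^sup>2 powi d) * wt p q r)"
    unfolding J_top[OF R d] by (simp only: mult_ac)
  finally show ?thesis using ifact_nz[OF d] unfolding d_def by simp
qed

text \<open>The three vanishing conditions (degree, left weight, right weight) leave exactly the index dual to
  \<open>(p,q,r)\<close>.\<close>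
lemma schur:
  assumes R: "R > 0" and II: "(k,p,q,r) \<in> II" "(k',p',q',t) \<in> II"
  shows "(\<integral>X. E (k,p,q,r) X * E (k',p',q',t) X \<partial>dS R) =
    (if p' = q \<and> q' = p \<and> t = p + q - r then complex_of_real (2 * pi\<^sup>2 * R ^ 3 * R\<^sup>2 powi (k + k' + p + q)) * wt p q r / of_int (p + q + 1) else 0)"
proof -
  have pos: "p \<ge> 0" "q \<ge> 0" "0 \<le> r" "p' \<ge> 0" "q' \<ge> 0" using II by (auto simp: II_def)
  have nz: "ci (p + q + 1) \<noteq> 0" using pos by (metis add_nonneg_pos less_irrefl of_int_eq_0_iff zero_less_one add_nonneg_nonneg)
  have R2: "R\<^sup>2 \<noteq> 0" using R by simp
  have "E (k,p,q,r) X * E (k',p',q',t) X = complex_of_real (R\<^sup>2 powi (k + k')) * (E (0,p,q,r) X * E (0,p',q',t) X)" if "X \<in> S3 R" for X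
  proof -
    have "det X = complex_of_real (R\<^sup>2)" using that by (simp add: S3_def)
    then have "det X powi k * det X powi k' = complex_of_real (R\<^sup>2 powi (k + k'))"
      using R2 by (simp add: power_int_add)
    then show ?thesis using S3_units[OF R that] by (simp add: E_unit mult_ac)
  qed
  then have 1: "(\<integral>X. E (k,p,q,r) X * E (k',p',q',t) X \<partial>dS R) = complex_of_real (R\<^sup>2 powi (k + k')) * J R p q r p' q' t"
    unfolding J_def Bochner_Integration.integral_mult_right_zero[symmetric] by (rule integral_dS_cong)
  show ?thesis
  proof (cases "p' = q \<and> q' = p \<and> t = p + q - r")
    case True
    have "J R p q r q p (p + q - r) = complex_of_real (2 * pi\<^sup>2 * R ^ 3 * R\<^sup>2 powi (p + q)) * wt p q r / ci (p + q + 1)"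
      using J_diag[OF R pos(1-3)] nz by (simp add: field_simps del: of_int_add)
    moreover have "R\<^sup>2 powi (k + k' + p + q) = R\<^sup>2 powi (k + k') * R\<^sup>2 powi (p + q)"
      using R2 by (simp add: power_int_add)
    ultimately show ?thesis unfolding 1 using True by (simp add: mult_ac)
  next
    case False
    have "J R p q r p' q' t = 0"
    proof (rule ccontr)
      assume J: "J R p q r p' q' t \<noteq> 0"
      then have "p + q = p' + q'" using J_deg[OF R pos(1,2,4,5)] by blast
      moreover have "p + p' = q + q'" using J J_weight_right[OF R, of p q p' q' r t] pos by force
      moreover have "2 * r + 2 * t = p + q + p' + q'" using J J_weight_left[OF R, of p q p' q' r t] pos by force
      ultimately show False using False by auto
    qed
    then show ?thesis unfolding 1 using False by auto
  qed
qed

lemma wt_nz: "(k,p,q,r) \<in> II \<Longrightarrow> wt p q r \<noteq> 0"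
  by (auto simp: wt_def II_def ifact_nz sg_def)

section \<open>Linear independence\<close>

text \<open>After multiplication by a power of \<open>x\<close>, a polynomial with infinitely many roots.\<close>
lemma powi_independent:
  fixes c :: "int \<Rightarrow> complex"
  assumes K: "finite K" and zero: "\<And>x::real. x > 0 \<Longrightarrow> (\<Sum>k\<in>K. c k * complex_of_real (x powi k)) = 0" and k: "k \<in> K"
  shows "c k = 0"
proof -
  define m where "m = Min K"
  have m: "m \<le> j" if "j \<in> K" for j using K that by (simp add: m_def)
  define P where "P = (\<Sum>j\<in>K. monom (c j) (nat (j - m)))"
  have root: "poly P (complex_of_real x) = 0" if x: "x > 0" for x
  proof -
    have "complex_of_real x ^ nat (j - m) = complex_of_real (x powi (- m)) * complex_of_real (x powi j)" if "j \<in> K" for j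
    proof -
      have "x ^ nat (j - m) = x powi (j - m)" using m[OF that] by (simp add: power_int_def)
      also have "\<dots> = x powi (- m) * x powi j" using x by (simp add: power_int_add[symmetric])
      finally show ?thesis by (metis of_real_mult of_real_power)
    qed
    then have "poly P (complex_of_real x) = complex_of_real (x powi (- m)) * (\<Sum>j\<in>K. c j * complex_of_real (x powi j))"
      by (simp add: P_def poly_sum poly_monom sum_distrib_left mult_ac cong: sum.cong)
    then show ?thesis using zero[OF x] by simp
  qed
  have "P = 0"
  proof (rule ccontr)
    assume "P \<noteq> 0"
    then have "finite {x. poly P x = 0}" by (rule poly_roots_finite)
    moreover have "complex_of_real ` {0<..} \<subseteq> {x. poly P x = 0}" using root by auto
    ultimately have "finite (complex_of_real ` {0<..})" by (rule rev_finite_subset)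
    then have "finite {0::real<..}" by (rule finite_imageD) (auto intro: inj_onI)
    then show False using infinite_Ioi by blast
  qed
  then have "coeff P (nat (k - m)) = 0" by simp
  moreover have "coeff P (nat (k - m)) = (\<Sum>j\<in>K. if j = k then c j else 0)"
    unfolding P_def coeff_sum using m k by (intro sum.cong refl) (auto simp: m nat_eq_iff2)
  ultimately show ?thesis using K k by simp
qed

text \<open>Integration against the dual function over a sphere isolates the coefficients with given \<open>(p,q,r)\<close> and
  arbitrary \<open>k\<close>; these are separated by varying the radius.\<close>
lemma E_coeffs_zero:
  assumes F: "finite F" "F \<subseteq> II" and zero: "\<And>Z. (\<Sum>i\<in>F. c i * E i Z) = 0" and j: "j \<in> F"
  shows "c j = 0"
proof -
  obtain k0 p q r where j0: "j = (k0,p,q,r)" by (cases j)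
  let ?j' = "(0, q, p, p + q - r)"
  have II: "(k0,p,q,r) \<in> II" "?j' \<in> II" using F j j0 by (auto simp: II_def)
  define K where "K = (\<lambda>k. (k,p,q,r)) -` F"
  have finK: "finite K" unfolding K_def by (rule finite_vimageI[OF F(1)]) (auto intro: injI)
  have "(\<Sum>k\<in>K. c (k,p,q,r) * complex_of_real (x powi k)) = 0" if x: "x > 0" for x
  proof -
    \<comment> \<open>On the sphere of radius \<open>R\<close> the determinant is \<open>R\<^sup>2 = x\<close>.\<close>
    define R where "R = sqrt x"
    have R: "R > 0" "R\<^sup>2 = x" using x by (auto simp: R_def)
    define A where "A = complex_of_real (2 * pi\<^sup>2 * R ^ 3 * x powi (p + q)) * wt p q r / ci (p + q + 1)"
    have nz: "ci (p + q + 1) \<noteq> 0" using II(1) by (metis (no_types, lifting) II_def add_nonneg_pos case_prodD less_irrefl mem_Collect_eq of_int_eq_0_iff zero_less_one add_nonneg_nonneg)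
    have A: "A \<noteq> 0" using wt_nz[OF II(1)] R x nz unfolding A_def by auto
    have "0 = (\<integral>X. (\<Sum>i\<in>F. c i * E i X) * E ?j' X \<partial>dS R)" by (simp add: zero)
    also have "\<dots> = (\<integral>X. (\<Sum>i\<in>F. c i * (E i X * E ?j' X)) \<partial>dS R)" by (simp add: sum_distrib_right mult.assoc)
    also have "\<dots> = (\<Sum>i\<in>F. c i * (\<integral>X. E i X * E ?j' X \<partial>dS R))"
      using regular_integrable[OF R(1) EE_regular] by (subst Bochner_Integration.integral_sum) auto
    also have "\<dots> = (\<Sum>i\<in>(\<lambda>k. (k,p,q,r)) ` K. c i * (\<integral>X. E i X * E ?j' X \<partial>dS R))"
    proof (rule sum.mono_neutral_right[OF F(1)])
      show "(\<lambda>k. (k,p,q,r)) ` K \<subseteq> F" by (auto simp: K_def)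
      show "\<forall>i\<in>F - (\<lambda>k. (k,p,q,r)) ` K. c i * (\<integral>X. E i X * E ?j' X \<partial>dS R) = 0"
      proof
        fix i assume i: "i \<in> F - (\<lambda>k. (k,p,q,r)) ` K"
        obtain k' p' q' r' where i': "i = (k',p',q',r')" by (cases i)
        have iI: "(k',p',q',r') \<in> II" using i i' F by auto
        have "\<not> (q = q' \<and> p = p' \<and> p + q - r = p' + q' - r')" using i i' by (auto simp: K_def)
        then show "c i * (\<integral>X. E i X * E ?j' X \<partial>dS R) = 0" unfolding i' schur[OF R(1) iI II(2)] by auto
      qed
    qed
    also have "\<dots> = (\<Sum>k\<in>K. c (k,p,q,r) * (\<integral>X. E (k,p,q,r) X * E ?j' X \<partial>dS R))"
      by (subst sum.reindex) (auto intro: inj_onI)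
    also have "\<dots> = (\<Sum>k\<in>K. A * (c (k,p,q,r) * complex_of_real (x powi k)))"
    proof (intro sum.cong refl)
      fix k assume "k \<in> K"
      have kI: "(k,p,q,r) \<in> II" using II(1) by (auto simp: II_def)
      have "x powi (k + 0 + p + q) = x powi (p + q) * x powi k" using x by (simp add: power_int_add[symmetric] algebra_simps)
      then show "c (k,p,q,r) * (\<integral>X. E (k,p,q,r) X * E ?j' X \<partial>dS R) = A * (c (k,p,q,r) * complex_of_real (x powi k))"
        unfolding schur[OF R(1) kI II(2)] R(2) A_def by (simp add: mult_ac)
    qed
    also have "\<dots> = A * (\<Sum>k\<in>K. c (k,p,q,r) * complex_of_real (x powi k))" by (simp add: sum_distrib_left)
    finally show ?thesis using A by simp
  qed
  from powi_independent[OF finK this, of k0] show ?thesis using j by (simp add: K_def j0)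
qed

lemma inj_E: "inj_on E II"
proof (rule inj_onI, rule ccontr)
  fix i j assume ij: "i \<in> II" "j \<in> II" "E i = E j" "i \<noteq> j"
  have "(\<Sum>x\<in>{i,j}. (if x = i then 1 else -1) * E x Z) = 0" for Z using ij by simp
  from E_coeffs_zero[OF _ _ this, of i] ij show False by auto
qed

lemma fun_sum_apply: "(\<Sum>x\<in>A. f x) Z = (\<Sum>x\<in>A. f x (Z::HC) :: complex)"
  by (induction A rule: infinite_finite_induct) auto

lemma independent_E: "fs.independent (E ` II)"
  unfolding fs.independent_explicit_finite_subsets
proof (intro allI impI ballI)
  fix A u v assume A: "A \<subseteq> E ` II" "finite A" and z: "(\<Sum>v\<in>A. (\<lambda>Z. u v * v Z)) = 0" and v: "v \<in> A"
  obtain F where F: "F \<subseteq> II" "A = E ` F" "finite F" using A finite_subset_image by metis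
  have inj: "inj_on E F" using F inj_E inj_on_subset by blast
  obtain j where j: "j \<in> F" "v = E j" using v F by blast
  have "(\<Sum>i\<in>F. u (E i) * E i Z) = 0" for Z
  proof -
    have "(\<Sum>v\<in>A. (\<lambda>Z. u v * v Z)) Z = 0" using z by simp
    then show ?thesis unfolding fun_sum_apply F by (simp add: sum.reindex[OF inj])
  qed
  from E_coeffs_zero[OF F(3,1) this j(1)] show "u v = 0" using j by simp
qed

section \<open>The matrix coefficients as functions E\<close>

text \<open>All integer powers except \<open>-1\<close> have a primitive on the punctured plane.\<close>
lemma powi_contour_integral:
  "((\<lambda>s. s powi m) has_contour_integral (if m = -1 then 2 * of_real pi * \<i> else 0)) (circlepath 0 1)"
proof (cases "m = -1")
  case True
  have "((\<lambda>u. 1 / (u - 0)) has_contour_integral (2 * of_real pi * \<i> * 1)) (circlepath 0 1)"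
    by (rule Cauchy_integral_circlepath_simple) auto
  then have "((\<lambda>u. inverse u) has_contour_integral (2 * of_real pi * \<i>)) (circlepath 0 1)"
    by (simp add: inverse_eq_divide)
  then show ?thesis using True by (simp add: power_int_minus)
next
  case False
  have nz: "ci (m + 1) \<noteq> 0" using False by (metis add.inverse_inverse add_eq_0_iff of_int_eq_0_iff)
  have "((\<lambda>s. s powi m) has_contour_integral ((pathfinish (circlepath 0 1)) powi (m + 1) / ci (m+1) - (pathstart (circlepath 0 1)) powi (m + 1) / ci (m + 1))) (circlepath 0 1)"
  proof (rule contour_integral_primitive[where S = "- {0}"])
    fix x :: complex assume "x \<in> - {0}"
    then have "((\<lambda>s. s powi (m + 1)) has_field_derivative ci (m + 1) * x powi (m + 1 - 1) * 1) (at x within - {0})"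
      by (intro DERIV_power_int DERIV_ident) auto
    from DERIV_cdivide[OF this, of "ci (m + 1)"] show "((\<lambda>s. s powi (m + 1) / ci (m + 1)) has_field_derivative x powi m) (at x within - {0})"
      using nz by simp
  qed auto
  then show ?thesis using False by simp
qed

text \<open>The binomial theorem for both columns at once: by \<open>S_col1\<close> and \<open>S_col2\<close>, the left side satisfies the
  same recursion in \<open>a\<close> and \<open>b\<close> as the right side. The homogeneous form covers \<open>\<alpha> = 0\<close> and \<open>\<beta> = 0\<close>.\<close>
lemma S_generating_homogeneous:
  "(\<Sum>j\<in>{0..int (a + b)}. S (int a) (int b) j Z * (\<alpha> ^ nat j * \<beta> ^ nat (int (a + b) - j)))
    = ifact (int a) * ifact (int b) * ((\<alpha> * Z$1$1 + \<beta> * Z$2$1) ^ a * (\<alpha> * Z$1$2 + \<beta> * Z$2$2) ^ b)"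
proof -
  define w where "w d j = \<alpha> ^ nat j * \<beta> ^ nat (d - j)" for d j
  define G where "G p q = (\<Sum>j\<in>{0..p+q}. S p q j Z * w (p+q) j)" for p q
  have wa: "\<alpha> * w d j = w (d + 1) (j + 1)" if "0 \<le> j" for d j
    using that by (simp add: w_def nat_add_distrib)
  have wb: "\<beta> * w d j = w (d + 1) j" if "j \<le> d" for d j
  proof -
    have "nat (d + 1 - j) = Suc (nat (d - j))" using that by simp
    then show ?thesis by (simp add: w_def)
  qed
  have a: "\<alpha> * G p q = (\<Sum>j\<in>{0..p+q+1}. S p q (j-1) Z * w (p+q+1) j)" for p q
  proof -
    have "\<alpha> * G p q = (\<Sum>j\<in>{0..p+q}. S p q j Z * w (p+q+1) (j+1))"
      unfolding G_def sum_distrib_left by (intro sum.cong refl) (simp add: wa[symmetric])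
    also have "\<dots> = (\<Sum>j\<in>{-1..p+q}. S p q j Z * w (p+q+1) (j+1))"
      by (intro sum.mono_neutral_left) (auto simp: S_eq_0)
    also have "\<dots> = (\<Sum>j\<in>{0..p+q+1}. S p q (j-1) Z * w (p+q+1) j)"
      using sum_int_shift[of "\<lambda>j. S p q (j-1) Z * w (p+q+1) j" "-1" "p+q"] by simp
    finally show ?thesis .
  qed
  have b: "\<beta> * G p q = (\<Sum>j\<in>{0..p+q+1}. S p q j Z * w (p+q+1) j)" for p q
  proof -
    have "\<beta> * G p q = (\<Sum>j\<in>{0..p+q}. S p q j Z * w (p+q+1) j)"
      unfolding G_def sum_distrib_left by (intro sum.cong refl) (simp add: wb[symmetric])
    also have "\<dots> = (\<Sum>j\<in>{0..p+q+1}. S p q j Z * w (p+q+1) j)"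
      by (intro sum.mono_neutral_left) (auto simp: S_eq_0)
    finally show ?thesis .
  qed
  have 1: "ci (p + 1) * G (p + 1) q = (\<alpha> * Z$1$1 + \<beta> * Z$2$1) * G p q" for p q
  proof -
    have "(\<alpha> * Z$1$1 + \<beta> * Z$2$1) * G p q = Z$1$1 * (\<alpha> * G p q) + Z$2$1 * (\<beta> * G p q)" by (simp add: algebra_simps)
    also have "\<dots> = (\<Sum>j\<in>{0..p+q+1}. (Z$1$1 * S p q (j-1) Z + Z$2$1 * S p q j Z) * w (p+q+1) j)"
      unfolding a b by (simp only: sum_distrib_left sum.distrib[symmetric] distrib_right mult.assoc)
    also have "\<dots> = ci (p + 1) * G (p + 1) q"
      unfolding S_col1 G_def by (simp add: sum_distrib_left mult.assoc add_ac)
    finally show ?thesis ..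
  qed
  have 2: "ci (q + 1) * G p (q + 1) = (\<alpha> * Z$1$2 + \<beta> * Z$2$2) * G p q" for p q
  proof -
    have "(\<alpha> * Z$1$2 + \<beta> * Z$2$2) * G p q = Z$1$2 * (\<alpha> * G p q) + Z$2$2 * (\<beta> * G p q)" by (simp add: algebra_simps)
    also have "\<dots> = (\<Sum>j\<in>{0..p+q+1}. (Z$1$2 * S p q (j-1) Z + Z$2$2 * S p q j Z) * w (p+q+1) j)"
      unfolding a b by (simp only: sum_distrib_left sum.distrib[symmetric] distrib_right mult.assoc)
    also have "\<dots> = ci (q + 1) * G p (q + 1)"
      unfolding S_col2 G_def by (simp add: sum_distrib_left mult.assoc add_ac)
    finally show ?thesis ..
  qed
  have nz: "ci (int n + 1) \<noteq> 0" for n by (metis int_ops(4) of_int_eq_0_iff of_nat_neq_0 of_nat_Suc add.commute of_nat_eq_0_iff nat.distinct(1))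
  have 3: "G (int a) 0 = ifact (int a) * (\<alpha> * Z$1$1 + \<beta> * Z$2$1) ^ a" for a
  proof (induction a)
    case 0
    show ?case by (simp add: G_def w_def)
  next
    case (Suc a)
    have "ci (int a + 1) * G (int a + 1) 0 = ci (int a + 1) * (ifact (int a + 1) * (\<alpha> * Z$1$1 + \<beta> * Z$2$1) ^ Suc a)"
      unfolding 1 Suc ifact_rec[symmetric, of "int a"] by (simp add: mult_ac)
    then have "G (int a + 1) 0 = ifact (int a + 1) * (\<alpha> * Z$1$1 + \<beta> * Z$2$1) ^ Suc a" using nz[of a] by (metis mult_cancel_left)
    then show ?case by (simp add: add.commute)
  qed
  have "G (int a) (int b) = ifact (int a) * ifact (int b) * ((\<alpha> * Z$1$1 + \<beta> * Z$2$1) ^ a * (\<alpha> * Z$1$2 + \<beta> * Z$2$2) ^ b)"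
  proof (induction b)
    case 0
    show ?case using 3[of a] by simp
  next
    case (Suc b)
    have "ci (int b + 1) * G (int a) (int b + 1) = ci (int b + 1) * (ifact (int a) * ifact (int b + 1) * ((\<alpha> * Z$1$1 + \<beta> * Z$2$1) ^ a * (\<alpha> * Z$1$2 + \<beta> * Z$2$2) ^ Suc b))"
      unfolding 2 Suc ifact_rec[symmetric, of "int b"] by (simp add: mult_ac)
    then have "G (int a) (int b + 1) = ifact (int a) * ifact (int b + 1) * ((\<alpha> * Z$1$1 + \<beta> * Z$2$1) ^ a * (\<alpha> * Z$1$2 + \<beta> * Z$2$2) ^ Suc b)" using nz[of b] by (metis mult_cancel_left)
    then show ?case by (simp add: add.commute)
  qed
  then show ?thesis by (simp add: G_def w_def)
qed

lemma S_generating: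
  "(\<Sum>j\<in>{0..int (a + b)}. S (int a) (int b) j Z * s powi j)
    = ifact (int a) * ifact (int b) * ((s * Z$1$1 + Z$2$1) ^ a * (s * Z$1$2 + Z$2$2) ^ b)"
proof -
  have "(\<Sum>j\<in>{0..int (a + b)}. S (int a) (int b) j Z * s powi j)
    = (\<Sum>j\<in>{0..int (a + b)}. S (int a) (int b) j Z * (s ^ nat j * 1 ^ nat (int (a + b) - j)))"
    by (intro sum.cong refl) (auto simp: power_int_def)
  then show ?thesis unfolding S_generating_homogeneous by simp
qed

text \<open>The integrand is the generating function of the \<open>S(p,q,j)\<close>, and the contour integral extracts the
  coefficient with \<open>j = r\<close>.\<close>
lemma tcoeff_eq:
  fixes l m n :: real and p q r :: int
  assumes p: "l - m = of_int p" and q: "l + m = of_int q" and r: "l - n = of_int r" and pq: "p \<ge> 0" "q \<ge> 0" and r': "0 \<le> r" "r \<le> p + q"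
  shows "tcoeff l n m Z = S p q r Z / (ifact p * ifact q)"
proof -
  have fl: "\<lfloor>l - m\<rfloor> = p" "\<lfloor>l + m\<rfloor> = q" using p q by auto
  have "- l + n = of_int (- r)" using r by simp
  then have fl': "\<lfloor>- l + n\<rfloor> = - r" by (metis floor_of_int)
  let ?K = "ifact p * ifact q"
  have K: "?K \<noteq> 0" using pq by (simp add: ifact_nz)
  let ?f = "\<lambda>s. (s * Z $ 1 $ 1 + Z $ 2 $ 1) ^ nat p * (s * Z $ 1 $ 2 + Z $ 2 $ 2) ^ nat q * s powi (- r) / s"
  let ?g = "\<lambda>s. \<Sum>j\<in>{0..p+q}. S p q j Z / ?K * s powi (j - r - 1)"
  have eq: "?f s = ?g s" if s: "s \<noteq> 0" for s
  proof -
    have "(\<Sum>j\<in>{0..p+q}. S p q j Z * s powi j) = ?K * ((s * Z$1$1 + Z$2$1) ^ nat p * (s * Z$1$2 + Z$2$2) ^ nat q)"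
      using S_generating[of "nat p" "nat q" Z s] pq by simp
    then have "((s * Z$1$1 + Z$2$1) ^ nat p * (s * Z$1$2 + Z$2$2) ^ nat q) = (\<Sum>j\<in>{0..p+q}. S p q j Z * s powi j) / ?K"
      using K by simp
    then have "?f s = (\<Sum>j\<in>{0..p+q}. S p q j Z * s powi j) * (inverse ?K * (s powi (-r) * s powi (-1)))"
      by (simp only: power_int_minus divide_inverse mult_ac power_int_1_right)
    also have "\<dots> = (\<Sum>j\<in>{0..p+q}. S p q j Z / ?K * (s powi j * s powi (-r) * s powi (-1)))"
      unfolding sum_distrib_right by (simp only: divide_inverse mult_ac)
    also have "\<dots> = ?g s"
    proof -
      have "s powi j * s powi (-r) * s powi (-1) = s powi (j - r - 1)" for j
      proof -
        have "s powi (j + (-r) + (-1)) = s powi j * s powi (-r) * s powi (-1)"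
          using s power_int_add[of s "j + (-r)" "-1"] power_int_add[of s j "-r"] by (simp only: simp_thms)
        moreover have "j + (-r) + (-1) = j - r - 1" by simp
        ultimately show ?thesis by (simp only:)
      qed
      then show ?thesis by (simp only:)
    qed
    finally show ?thesis .
  qed
  have "(?g has_contour_integral (\<Sum>j\<in>{0..p+q}. S p q j Z / ?K * (if j - r - 1 = -1 then 2 * of_real pi * \<i> else 0))) (circlepath 0 1)"
    by (intro has_contour_integral_sum has_contour_integral_lmul powi_contour_integral) auto
  also have "(\<Sum>j\<in>{0..p+q}. S p q j Z / ?K * (if j - r - 1 = -1 then 2 * of_real pi * \<i> else 0)) = (\<Sum>j\<in>{0..p+q}. if j = r then S p q r Z / ?K * (2 * of_real pi * \<i>) else 0)"
    by (intro sum.cong refl) auto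
  also have "\<dots> = S p q r Z / ?K * (2 * of_real pi * \<i>)" using r' by simp
  finally have "(?g has_contour_integral (S p q r Z / ?K * (2 * of_real pi * \<i>))) (circlepath 0 1)" .
  then have "(?f has_contour_integral (S p q r Z / ?K * (2 * of_real pi * \<i>))) (circlepath 0 1)"
  proof (rule has_contour_integral_eq)
    fix s :: complex assume "s \<in> path_image (circlepath 0 1)"
    then have "s \<noteq> 0" by auto
    then show "?g s = ?f s" by (rule eq[symmetric])
  qed
  then have "contour_integral (circlepath 0 1) ?f = S p q r Z / ?K * (2 * of_real pi * \<i>)"
    by (rule contour_integral_unique)
  then show ?thesis unfolding tcoeff_def fl fl' by simp
qed

lemma det_nz_inverse:
  assumes "det (Z :: HC) \<noteq> 0"
  shows "matrix_inv Z = smul (inverse (det Z)) (adj Z)"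
proof -
  have a: "Z ** adj Z = smul (det Z) (mat 1)" "adj Z ** Z = smul (det Z) (mat 1)"
    by (rule matrix_entries_eqI; simp add: mult_2_entry mat_def det_2 algebra_simps)+
  have b: "smul (inverse (det Z)) (smul (det Z) (mat 1)) = mat 1"
    using assms by (intro matrix_entries_eqI) (auto simp: mat_def)
  have 1: "Z ** smul (inverse (det Z)) (adj Z) = mat 1" and 2: "smul (inverse (det Z)) (adj Z) ** Z = mat 1"
    by (simp_all only: smul_mult a b)
  have "matrix_inv Z ** Z = mat 1" using matrix_invertible 1 2
    by (metis (mono_tags, lifting) matrix_inv_def someI_ex)
  then show ?thesis using 1 by (metis matrix_mul_assoc matrix_mul_lid matrix_mul_rid)
qed

lemma dpow_scale: "c \<noteq> 0 \<Longrightarrow> dpow n (c * z) = c powi n * dpow n z"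
  by (auto simp: dpow_def power_int_def power_mult_distrib)

lemma S_smul:
  assumes "c \<noteq> 0" shows "S p q r (smul c Z) = c powi (p + q) * S p q r Z"
proof -
  have "sterm p q r (smul c Z) a = c powi (p + q) * sterm p q r Z a" for a
  proof -
    have "p + q = a + (r - a) + (p - a) + (q - r + a)" by simp
    then have "c powi (p + q) = c powi a * c powi (r - a) * c powi (p - a) * c powi (q - r + a)"
      using assms by (simp add: power_int_add[symmetric])
    then show ?thesis by (simp add: sterm_def dpow_scale[OF assms] mult_ac)
  qed
  then show ?thesis by (simp add: S_def sum_distrib_left)
qed

text \<open>The inverse is the adjugate divided by the determinant.\<close>
lemma S_inverse:
  assumes "det Z \<noteq> 0"
  shows "S p q r (matrix_inv Z) = sg (p + r) * (det Z powi (- p - q) * S (p+q-r) r q Z)"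
proof -
  have "S p q r (matrix_inv Z) = inverse (det Z) powi (p + q) * (sg (p + r) * S (p+q-r) r q Z)"
    unfolding det_nz_inverse[OF assms] using assms by (simp add: S_smul S_adj)
  moreover have "inverse (det Z) powi (p + q) = det Z powi (- p - q)"
    by (metis power_int_inverse power_int_minus minus_add uminus_add_conv_diff add.commute diff_conv_add_uminus minus_add_distrib)
  ultimately show ?thesis by simp
qed

text \<open>Up to a scalar, \<open>E (dual i)\<close> is the function with a tilde that belongs to \<open>E i\<close>, for \<open>k\<close> equal to \<open>0\<close> or
  \<open>1\<close>.\<close>
definition dual :: "idx \<Rightarrow> idx" where "dual i = (case i of (k,p,q,r) \<Rightarrow> (- k - p - q, q, p, p + q - r))"

lemma dual_simp [simp]: "dual (k,p,q,r) = (- k - p - q, q, p, p + q - r)" by (simp add: dual_def)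
lemma dual_dual [simp]: "dual (dual i) = i" by (cases i) simp
lemma dual_II: "i \<in> II \<Longrightarrow> dual i \<in> II" by (cases i) (auto simp: II_def)

text \<open>The indices of the bases of \<open>BH\<^sup>+\<close>, of \<open>BH\<^sup>-\<close> and of \<open>BH\<close>.\<close>
definition PI :: "idx set" where "PI = {(k,p,q,r). (k,p,q,r) \<in> II \<and> (k = 0 \<or> k = 1)}"
definition MI :: "idx set" where "MI = {(k,p,q,r). (k,p,q,r) \<in> II \<and> (k = -p-q \<or> k = -p-q-1)}"
definition BI :: "idx set" where "BI = PI \<union> MI"

lemma dual_PI: "i \<in> PI \<Longrightarrow> dual i \<in> MI" "i \<in> MI \<Longrightarrow> dual i \<in> PI"
  by (cases i; auto simp: PI_def MI_def II_def)+

lemma PI_II: "PI \<subseteq> II" and MI_II: "MI \<subseteq> II" and BI_II: "BI \<subseteq> II" by (auto simp: PI_def MI_def BI_def)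

text \<open>For \<open>\<alpha> = 2\<close> the function is \<open>N(Z)\<close> times a coefficient of weight \<open>l - 1\<close>.\<close>
definition phi_ix :: "nat \<Rightarrow> real \<Rightarrow> real \<Rightarrow> real \<Rightarrow> idx" where
  "phi_ix \<alpha> l m n = (let l' = l - (real \<alpha> - 1) in (int \<alpha> - 1, \<lfloor>l' - m\<rfloor>, \<lfloor>l' + m\<rfloor>, \<lfloor>l' - n\<rfloor>))"

text \<open>The factors between the functions \<open>\<phi>\<close>, respectively their partners with a tilde, and the functions
  \<open>E\<close>.\<close>
definition phi_coeff :: "idx \<Rightarrow> complex" where "phi_coeff i = (case i of (k,p,q,r) \<Rightarrow> 1 / (ifact p * ifact q))"
definition phi_t_coeff :: "idx \<Rightarrow> complex" where "phi_t_coeff i = (case i of (k,p,q,r) \<Rightarrow> sg (p + r) / (ifact r * ifact (p + q - r)))"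

lemma phi_coeff_nz: "i \<in> II \<Longrightarrow> phi_coeff i \<noteq> 0" "i \<in> II \<Longrightarrow> phi_t_coeff i \<noteq> 0"
  by (auto simp: phi_coeff_def phi_t_coeff_def II_def ifact_nz sg_def split: prod.splits)

lemma indices_ints:
  assumes "\<alpha> \<in> {1,2}" "(l,m,n) \<in> indices \<alpha>"
  obtains p q r :: int where "l - (real \<alpha> - 1) - m = of_int p" "l - (real \<alpha> - 1) + m = of_int q"
    "l - (real \<alpha> - 1) - n = of_int r" "l - (real \<alpha> - 1) + n = of_int (p + q - r)" "0 \<le> p" "0 \<le> q" "0 \<le> r" "r \<le> p + q"
    "phi_ix \<alpha> l m n = (int \<alpha> - 1, p, q, r)"
proof -
  define l' where "l' = l - (real \<alpha> - 1)"
  have w: "m \<in> weights l'" "n \<in> weights l'" and h: "l \<in> half_integers"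
    using assms by (auto simp: indices_def l'_def)
  from h obtain k :: nat where k: "l = real k / 2" by (auto simp: half_integers_def)
  have "m - l' \<in> \<int>" "n - l' \<in> \<int>" using w by (auto simp: weights_def)
  then obtain a b :: int where ab: "m - l' = of_int a" "n - l' = of_int b" by (auto elim!: Ints_cases)
  have bounds: "- l' \<le> m" "m \<le> l'" "- l' \<le> n" "n \<le> l'" using w by (auto simp: weights_def)
  have q: "l' + m = of_int (int k - 2 * (int \<alpha> - 1) + a)"
    using ab k by (simp add: l'_def algebra_simps)
  have p: "l' - m = of_int (- a)" and r: "l' - n = of_int (- b)" using ab by simp_all
  have n: "l' + n = of_int (- a + (int k - 2 * (int \<alpha> - 1) + a) - (- b))"
    using ab k by (simp add: l'_def algebra_simps)
  show ?thesis
  proof (rule that)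
    show "l - (real \<alpha> - 1) - m = of_int (- a)" "l - (real \<alpha> - 1) + m = of_int (int k - 2 * (int \<alpha> - 1) + a)"
      "l - (real \<alpha> - 1) - n = of_int (- b)" "l - (real \<alpha> - 1) + n = of_int (- a + (int k - 2 * (int \<alpha> - 1) + a) - (- b))"
      using p q r n by (simp_all only: l'_def)
    have "(0::real) \<le> of_int (- a)" "(0::real) \<le> of_int (int k - 2 * (int \<alpha> - 1) + a)" "(0::real) \<le> of_int (- b)"
      "(0::real) \<le> of_int (- a + (int k - 2 * (int \<alpha> - 1) + a) - (- b))"
      using bounds p q r n by linarith+
    then show "0 \<le> - a" "0 \<le> int k - 2 * (int \<alpha> - 1) + a" "0 \<le> - b" "- b \<le> - a + (int k - 2 * (int \<alpha> - 1) + a)"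
      unfolding of_int_0_le_iff by linarith+
    show "phi_ix \<alpha> l m n = (int \<alpha> - 1, - a, int k - 2 * (int \<alpha> - 1) + a, - b)"
      unfolding phi_ix_def Let_def l'_def[symmetric] p q r floor_of_int ..
  qed
qed

lemma phi_ix_PI:
  assumes "\<alpha> \<in> {1,2}" "(l,m,n) \<in> indices \<alpha>" shows "phi_ix \<alpha> l m n \<in> PI"
proof -
  have "int \<alpha> - 1 = 0 \<or> int \<alpha> - 1 = 1" using assms by auto
  moreover obtain p q r :: int where "0 \<le> p" "0 \<le> q" "0 \<le> r" "r \<le> p + q" and phi_ix: "phi_ix \<alpha> l m n = (int \<alpha> - 1, p, q, r)"
    by (rule indices_ints[OF assms])
  ultimately show ?thesis unfolding phi_ix by (simp add: PI_def II_def)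
qed

text \<open>The exponent of \<open>E (dual i)\<close> is \<open>-d\<close> or \<open>-d-1\<close>: the degree contributes \<open>-d\<close> to the determinant of the
  inverse, and the prefactor for \<open>\<alpha> = 2\<close> one more.\<close>
lemma phi_eq:
  assumes "\<alpha> \<in> {1,2}" "(l,m,n) \<in> indices \<alpha>"
  shows "phi \<alpha> l m n = (\<lambda>Z. phi_coeff (phi_ix \<alpha> l m n) * E (phi_ix \<alpha> l m n) Z)"
    "phi_t \<alpha> l m n = (\<lambda>Z. phi_t_coeff (phi_ix \<alpha> l m n) * E (dual (phi_ix \<alpha> l m n)) Z)"
proof -
  obtain p q r :: int where pqr: "l - (real \<alpha> - 1) - m = of_int p" "l - (real \<alpha> - 1) + m = of_int q"
    "l - (real \<alpha> - 1) - n = of_int r" "l - (real \<alpha> - 1) + n = of_int (p + q - r)" and pos: "0 \<le> p" "0 \<le> q" "0 \<le> r" "r \<le> p + q"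
    and phi_ix: "phi_ix \<alpha> l m n = (int \<alpha> - 1, p, q, r)" by (rule indices_ints[OF assms])
  have t1: "tcoeff (l - (real \<alpha> - 1)) n m Z = S p q r Z / (ifact p * ifact q)" for Z
    by (rule tcoeff_eq[OF pqr(1-3)]) (use pos in auto)
  have t2: "tcoeff (l - (real \<alpha> - 1)) m n Z = S r (p + q - r) p Z / (ifact r * ifact (p + q - r))" for Z
    by (rule tcoeff_eq[OF pqr(3,4,1)]) (use pos in auto)
  have t2': "tcoeff (l - (real \<alpha> - 1)) m n (matrix_inv Z) = phi_t_coeff (phi_ix \<alpha> l m n) * (det Z powi (- p - q) * S q p (p + q - r) Z)" if "det Z \<noteq> 0" for Z
    unfolding t2 S_inverse[OF that] phi_t_coeff_def phi_ix by (simp add: add.commute)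
  have *: "\<alpha> = 1 \<or> \<alpha> = 2" using assms by auto
  then show "phi \<alpha> l m n = (\<lambda>Z. phi_coeff (phi_ix \<alpha> l m n) * E (phi_ix \<alpha> l m n) Z)"
    using t1 by (auto simp: phi_def on_units_def fun_eq_iff phi_ix phi_coeff_def E.simps)
  show "phi_t \<alpha> l m n = (\<lambda>Z. phi_t_coeff (phi_ix \<alpha> l m n) * E (dual (phi_ix \<alpha> l m n)) Z)"
  proof
    fix Z
    show "phi_t \<alpha> l m n Z = phi_t_coeff (phi_ix \<alpha> l m n) * E (dual (phi_ix \<alpha> l m n)) Z"
    proof (cases "det Z = 0")
      case True
      then show ?thesis by (simp add: phi_t_def on_units_def E_sing)
    next
      case False
      note t2'' = t2'[OF False, unfolded phi_ix]
      from * show ?thesis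
      proof
        assume "\<alpha> = 1"
        then show ?thesis unfolding phi_ix dual_simp using t2'' by (simp add: phi_t_def on_units_def False E_unit[OF False])
      next
        assume a: "\<alpha> = 2"
        have "det Z powi (- p - q) = det Z * det Z powi (- 1 - p - q)"
        proof -
          have "- p - q - 1 = - 1 - p - q" by simp
          then show ?thesis using powi_minus_1[OF False, of "- p - q"] by (simp only:)
        qed
        then have "inverse (det Z) * det Z powi (- p - q) = det Z powi (- 1 - p - q)" using False by simp
        then show ?thesis unfolding phi_ix dual_simp using a t2'' by (simp add: phi_t_def on_units_def False E_unit[OF False])
      qed
    qed
  qed
qed

lemma phi_ix_inj:
  assumes "\<alpha> \<in> {1,2}" "(l,m,n) \<in> indices \<alpha>" "(l',m',n') \<in> indices \<alpha>"
  shows "phi_ix \<alpha> l m n = phi_ix \<alpha> l' m' n' \<longleftrightarrow> l = l' \<and> m = m' \<and> n = n'"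
proof -
  obtain p q r :: int where 1: "l - (real \<alpha> - 1) - m = of_int p" "l - (real \<alpha> - 1) + m = of_int q"
    "l - (real \<alpha> - 1) - n = of_int r" "phi_ix \<alpha> l m n = (int \<alpha> - 1, p, q, r)" by (rule indices_ints[OF assms(1,2)])
  obtain p' q' r' :: int where 2: "l' - (real \<alpha> - 1) - m' = of_int p'" "l' - (real \<alpha> - 1) + m' = of_int q'"
    "l' - (real \<alpha> - 1) - n' = of_int r'" "phi_ix \<alpha> l' m' n' = (int \<alpha> - 1, p', q', r')" by (rule indices_ints[OF assms(1,3)])
  have "p = p' \<Longrightarrow> q = q' \<Longrightarrow> r = r' \<Longrightarrow> l = l' \<and> m = m' \<and> n = n'" using 1(1-3) 2(1-3) by auto
  then show ?thesis using 1(4) 2(4) by auto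
qed

lemma phi_ix_surj:
  assumes "i \<in> PI"
  obtains \<alpha> l m n where "\<alpha> \<in> {1,2}" "(l,m,n) \<in> indices \<alpha>" "phi_ix \<alpha> l m n = i"
proof -
  obtain k p q r where i: "i = (k,p,q,r)" by (cases i)
  have pos: "0 \<le> p" "0 \<le> q" "0 \<le> r" "r \<le> p + q" "k = 0 \<or> k = 1" using assms by (auto simp: PI_def II_def i)
  define \<alpha> where "\<alpha> = nat (k + 1)"
  define d where "d = (real_of_int p + real_of_int q) / 2"
  define l where "l = d + real_of_int k"
  define m where "m = (real_of_int q - real_of_int p) / 2"
  define n where "n = d - real_of_int r"
  have \<alpha>: "\<alpha> \<in> {1,2}" "real \<alpha> - 1 = real_of_int k" "int \<alpha> - 1 = k" using pos by (auto simp: \<alpha>_def)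
  have dm: "d - m = of_int p" "d + m = of_int q" "d - n = of_int r" by (auto simp: d_def m_def n_def field_simps)
  have "m - d = of_int (- p)" "n - d = of_int (- r)" using dm by simp_all
  then have "m - d \<in> \<int>" "n - d \<in> \<int>" by (metis Ints_of_int)+
  moreover have "- d \<le> m" "m \<le> d" using pos by (auto simp: d_def m_def field_simps)
  moreover have "real_of_int r \<le> real_of_int p + real_of_int q" using pos(4) by linarith
  then have "- d \<le> n" "n \<le> d" using pos by (auto simp: d_def n_def field_simps)
  ultimately have w: "m \<in> weights d" "n \<in> weights d" by (auto simp: weights_def)
  have "l = real (nat (p + q + 2 * k)) / 2" using pos by (auto simp: l_def d_def field_simps)
  then have h: "l \<in> half_integers" unfolding half_integers_def by blast
  have dl: "d = l - (real \<alpha> - 1)" by (simp add: l_def \<alpha>)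
  have "(l,m,n) \<in> indices \<alpha>" using w h \<alpha>(1) dl by (auto simp: indices_def)
  moreover have "phi_ix \<alpha> l m n = i" unfolding phi_ix_def Let_def dl[symmetric] dm floor_of_int \<alpha>(3) i ..
  ultimately show ?thesis using that \<alpha> by blast
qed

lemma E_from_phi:
  assumes "c \<noteq> 0" "f = (\<lambda>Z. c * E i Z)" shows "E i = (\<lambda>Z. (1 / c) * f Z)"
  using assms by auto

lemma BH_plus_eq: "BH_plus = fs.span (E ` PI)"
proof -
  let ?P = "{phi \<alpha> l m n | \<alpha> l m n. \<alpha> \<in> {1, 2} \<and> (l, m, n) \<in> indices \<alpha>}"
  have "?P \<subseteq> fs.span (E ` PI)"
  proof
    fix f assume "f \<in> ?P"
    then obtain \<alpha> l m n where a: "\<alpha> \<in> {1, 2}" "(l, m, n) \<in> indices \<alpha>" "f = phi \<alpha> l m n" by blast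
    show "f \<in> fs.span (E ` PI)" unfolding a(3) phi_eq[OF a(1,2)]
      by (intro fs.span_scale fs.span_base imageI phi_ix_PI a)
  qed
  moreover have "E ` PI \<subseteq> fs.span ?P"
  proof
    fix f assume "f \<in> E ` PI"
    then obtain i where i: "i \<in> PI" "f = E i" by blast
    from phi_ix_surj[OF i(1)] obtain \<alpha> l m n where a: "\<alpha> \<in> {1,2}" "(l,m,n) \<in> indices \<alpha>" "phi_ix \<alpha> l m n = i" .
    have "phi_coeff i \<noteq> 0" using i PI_II by (intro phi_coeff_nz) auto
    note E_c = E_from_phi[OF this phi_eq(1)[OF a(1,2), unfolded a(3)]]
    show "f \<in> fs.span ?P" unfolding i(2) using a(1,2) by (intro ssubst[OF E_c, of "\<lambda>f. f \<in> fs.span ?P"] fs.span_scale fs.span_base) blast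
  qed
  ultimately show ?thesis unfolding BH_plus_def cspan_eq by (simp add: fs.span_eq)
qed

lemma BH_minus_eq: "BH_minus = fs.span (E ` MI)"
proof -
  let ?P = "{phi_t \<alpha> l m n | \<alpha> l m n. \<alpha> \<in> {1, 2} \<and> (l, m, n) \<in> indices \<alpha>}"
  have "?P \<subseteq> fs.span (E ` MI)"
  proof
    fix f assume "f \<in> ?P"
    then obtain \<alpha> l m n where a: "\<alpha> \<in> {1, 2}" "(l, m, n) \<in> indices \<alpha>" "f = phi_t \<alpha> l m n" by blast
    show "f \<in> fs.span (E ` MI)" unfolding a(3) phi_eq[OF a(1,2)]
      by (intro fs.span_scale fs.span_base imageI phi_ix_PI dual_PI a)
  qed
  moreover have "E ` MI \<subseteq> fs.span ?P"
  proof
    fix f assume "f \<in> E ` MI"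
    then obtain i where i: "i \<in> MI" "f = E i" by blast
    from phi_ix_surj[OF dual_PI(2)[OF i(1)]] obtain \<alpha> l m n where a: "\<alpha> \<in> {1,2}" "(l,m,n) \<in> indices \<alpha>" "phi_ix \<alpha> l m n = dual i" .
    have "phi_t_coeff (dual i) \<noteq> 0" using i MI_II by (intro phi_coeff_nz dual_II) auto
    note E_c = E_from_phi[OF this phi_eq(2)[OF a(1,2), unfolded a(3)], unfolded dual_dual]
    show "f \<in> fs.span ?P" unfolding i(2) using a(1,2) by (intro ssubst[OF E_c, of "\<lambda>f. f \<in> fs.span ?P"] fs.span_scale fs.span_base) blast
  qed
  ultimately show ?thesis unfolding BH_minus_def cspan_eq by (simp add: fs.span_eq)
qed

section \<open>The biharmonic functions as a span\<close>

lemma span_finite_sum: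
  "f \<in> fs.span (E ` A) \<Longrightarrow> \<exists>F c. finite F \<and> F \<subseteq> A \<and> f = (\<lambda>Z. \<Sum>i\<in>F. c i * E i Z)"
proof (induction rule: span_induct_E)
  case zero
  show ?case by (intro exI[of _ "{}"]) auto
next
  case (step a i g)
  then obtain F c where F: "finite F" "F \<subseteq> A" "g = (\<lambda>Z. \<Sum>i\<in>F. c i * E i Z)" by blast
  let ?c = "\<lambda>j. (if j = i then a else 0) + (if j \<in> F then c j else 0)"
  have "(\<Sum>j\<in>insert i F. ?c j * E j Z) = a * E i Z + g Z" for Z
  proof -
    have "(\<Sum>j\<in>insert i F. ?c j * E j Z) = (\<Sum>j\<in>insert i F. if j = i then a * E j Z else 0) + (\<Sum>j\<in>insert i F. if j \<in> F then c j * E j Z else 0)"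
      by (simp add: distrib_right sum.distrib if_distrib[of "\<lambda>x. x * _"] cong: if_cong)
    also have "(\<Sum>j\<in>insert i F. if j \<in> F then c j * E j Z else 0) = g Z"
      unfolding F(3) using F(1) by (intro sum.mono_neutral_cong_right) auto
    finally show ?thesis using F(1) by simp
  qed
  then show ?case using F step by (intro exI[of _ "insert i F"] exI[of _ ?c]) auto
qed

lemma finite_sum_in_span:
  "finite F \<Longrightarrow> (\<And>i. i \<in> F \<Longrightarrow> c i = 0 \<or> i \<in> A) \<Longrightarrow> (\<lambda>Z. \<Sum>i\<in>F. c i * E i Z) \<in> fs.span (E ` A)"
proof (induction F rule: finite_induct)
  case empty
  then show ?case using span_zero'[of "E ` A"] by simp
next
  case (insert i F)
  have "(\<lambda>Z. c i * E i Z) \<in> fs.span (E ` A)"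
  proof (cases "c i = 0")
    case True
    then show ?thesis using span_zero'[of "E ` A"] by simp
  next
    case False
    then show ?thesis using insert.prems[of i] by (intro fs.span_scale fs.span_base) auto
  qed
  then have "(\<lambda>Z. c i * E i Z + (\<Sum>i\<in>F. c i * E i Z)) \<in> fs.span (E ` A)" using insert by (intro span_add') auto
  then show ?case using insert by simp
qed

lemma box_box_sum:
  assumes F: "finite F" and Z: "det Z \<noteq> 0"
  shows "Defs.box (Defs.box (\<lambda>Z. \<Sum>i\<in>F. c i * E i Z)) Z = (\<Sum>i\<in>F. c i * box_coeff i * box_coeff (lower i) * E (lower (lower i)) Z)"
proof -
  obtain xs where xs: "set xs = F" "distinct xs" using finite_distinct_list[OF F] by blast
  let ?ys = "map (\<lambda>i. (c i, i)) xs"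
  have sl: "(\<Sum>i\<in>F. f i) = (\<Sum>i\<leftarrow>xs. f i)" for f :: "idx \<Rightarrow> complex" using xs by (simp add: sum_list_distinct_conv_sum_set)
  have 1: "(\<lambda>Z. \<Sum>i\<in>F. c i * E i Z) = lin ?ys" by (simp add: sl lin_def fun_eq_iff comp_def)
  have "Defs.box (Defs.box (lin ?ys)) Z = Defs.box (lin (boxl ?ys)) Z"
    by (rule box_cong[OF box_lin Z])
  also have "\<dots> = lin (boxl (boxl ?ys)) Z" by (rule box_lin[OF Z])
  also have "\<dots> = (\<Sum>i\<in>F. c i * box_coeff i * box_coeff (lower i) * E (lower (lower i)) Z)"
    by (simp add: sl lin_def boxl_def comp_def)
  finally show ?thesis unfolding 1 .
qed

lemma box_coeff_BI: "i \<in> II \<Longrightarrow> box_coeff i * box_coeff (lower i) = 0 \<longleftrightarrow> i \<in> BI"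
proof -
  assume i: "i \<in> II"
  obtain k p q r where phi_ix: "i = (k,p,q,r)" by (cases i)
  have "box_coeff i * box_coeff (lower i) = ci (4 * k * (k + p + q + 1) * (4 * (k - 1) * (k - 1 + p + q + 1)))"
    by (simp only: phi_ix box_coeff_def lower_def prod.case of_int_mult)
  then have "box_coeff i * box_coeff (lower i) = 0 \<longleftrightarrow> 4 * k * (k + p + q + 1) * (4 * (k - 1) * (k - 1 + p + q + 1)) = 0"
    by (metis of_int_eq_0_iff)
  also have "\<dots> \<longleftrightarrow> i \<in> BI" using i by (auto simp: BI_def PI_def MI_def phi_ix)
  finally show ?thesis .
qed

text \<open>The square of the Laplacian maps \<open>E (k,\<dots>)\<close> to a multiple of \<open>E (k-2,\<dots>)\<close>, and distinct indices
  stay distinct, so by independence each coefficient is killed separately.\<close>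
lemma BH_eq: "BH = fs.span (E ` BI)"
proof (intro set_eqI iffI)
  fix f assume "f \<in> fs.span (E ` BI)"
  then obtain F c where F: "finite F" "F \<subseteq> BI" "f = (\<lambda>Z. \<Sum>i\<in>F. c i * E i Z)" using span_finite_sum by blast
  have "Defs.box (Defs.box f) Z = 0" if "det Z \<noteq> 0" for Z
    unfolding F(3) box_box_sum[OF F(1) that]
  proof (intro sum.neutral ballI)
    fix i assume "i \<in> F"
    then have "box_coeff i * box_coeff (lower i) = 0" using F BI_II box_coeff_BI by blast
    then show "c i * box_coeff i * box_coeff (lower i) * E (lower (lower i)) Z = 0" by (simp only: mult.assoc) simp
  qed
  moreover have "f \<in> regular_functions" using \<open>f \<in> fs.span (E ` BI)\<close> by (rule span_regular)
  ultimately show "f \<in> BH" by (simp add: BH_def)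
next
  fix f assume f: "f \<in> BH"
  then have "f \<in> fs.span (E ` II)" unfolding BH_def regular_eq_span by blast
  then obtain F c where F: "finite F" "F \<subseteq> II" "f = (\<lambda>Z. \<Sum>i\<in>F. c i * E i Z)" using span_finite_sum by blast
  let ?L = "\<lambda>i. lower (lower i)"
  let ?raise = "\<lambda>i. case i of (k,p,q,r) \<Rightarrow> (k+2,p,q,r)"
  have inv: "?raise (?L i) = i" for i by (cases i) (simp add: lower_def)
  have inj: "inj_on ?L F" by (rule inj_on_inverseI[of F ?raise]) (rule inv)
  have L: "?L ` F \<subseteq> II" using F(2) by (auto simp: lower_def II_def)
  let ?c' = "\<lambda>i. c (?raise i) * box_coeff (?raise i) * box_coeff (lower (?raise i))"
  have zero: "(\<Sum>i\<in>?L ` F. ?c' i * E i Z) = 0" for Z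
  proof (cases "det Z = 0")
    case True
    then show ?thesis by (simp add: E_sing)
  next
    case False
    have "(\<Sum>i\<in>?L ` F. ?c' i * E i Z) = Defs.box (Defs.box f) Z"
      unfolding F(3) box_box_sum[OF F(1) False] by (subst sum.reindex[OF inj]) (simp only: comp_def inv)
    then show ?thesis using f False by (simp add: BH_def)
  qed
  have "c i * box_coeff i * box_coeff (lower i) = 0" if "i \<in> F" for i
  proof -
    have "?c' (?L i) = 0"
      by (rule E_coeffs_zero[where c = ?c', OF finite_imageI[OF F(1)] L zero]) (use that in blast)
    then show ?thesis unfolding inv .
  qed
  then have "c i = 0 \<or> box_coeff i * box_coeff (lower i) = 0" if "i \<in> F" for i
    using that by (metis mult.assoc mult_eq_0_iff)
  then have "c i = 0 \<or> i \<in> BI" if "i \<in> F" for i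
    using that F(2) box_coeff_BI[of i] by blast
  then show "f \<in> fs.span (E ` BI)" unfolding F(3) by (intro finite_sum_in_span F(1)) auto
qed

section \<open>The pairing\<close>

text \<open>The coordinates with respect to the basis \<open>E\<close> of the regular functions.\<close>
definition E_coord :: "(HC \<Rightarrow> complex) \<Rightarrow> idx \<Rightarrow> complex" where
  "E_coord f i = fs.representation (E ` II) f (E i)"

lemma E_coord_add: "f \<in> regular_functions \<Longrightarrow> g \<in> regular_functions \<Longrightarrow> E_coord (\<lambda>Z. f Z + g Z) i = E_coord f i + E_coord g i"
  using fs.representation_add[OF independent_E, of g f] unfolding E_coord_def regular_eq_span plus_fun_def by simp

lemma E_coord_scale: "f \<in> regular_functions \<Longrightarrow> E_coord (\<lambda>Z. c * f Z) i = c * E_coord f i"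
  unfolding E_coord_def regular_eq_span by (simp add: fs.representation_scale[OF independent_E])

lemma E_coord_E: "i \<in> II \<Longrightarrow> j \<in> II \<Longrightarrow> E_coord (E j) i = (if i = j then 1 else 0)"
  unfolding E_coord_def using inj_onD[OF inj_E, of i j] by (subst fs.representation_basis[OF independent_E]) auto

definition E_support :: "(HC \<Rightarrow> complex) \<Rightarrow> idx set" where "E_support f = {i \<in> II. E_coord f i \<noteq> 0}"

lemma finite_supp: "finite (E_support f)"
proof (rule finite_imageD)
  show "finite (E ` E_support f)"
    by (rule finite_subset[OF _ fs.finite_representation[of "E ` II" f]]) (auto simp: E_support_def E_coord_def)
  show "inj_on E (E_support f)" by (rule inj_on_subset[OF inj_E]) (auto simp: E_support_def)
qed

lemma E_support_II: "E_support f \<subseteq> II" by (auto simp: E_support_def)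

text \<open>For \<open>d = 0\<close> and \<open>k = 0\<close> the value is \<open>0\<close>: the constant function, which lies in both \<open>BH\<^sup>+\<close> and
  \<open>BH\<^sup>-\<close>, is orthogonal to everything.\<close>
definition level_const :: "int \<Rightarrow> int \<Rightarrow> complex" where
  "level_const k d = (if k = 0 \<or> k = - d then of_int d else if k = 1 \<or> k = - d - 1 then - of_int (d + 2) else 0)"

definition dual_value :: "idx \<Rightarrow> complex" where
  "dual_value i = (case i of (k,p,q,r) \<Rightarrow> level_const k (p + q) * wt p q r)"

lemma wt_dual: "wt q p (p + q - r) = wt p q r"
  by (simp add: wt_def sg_add sg_diff sg_def)

lemma dual_value_dual: "dual_value (dual i) = dual_value i"
proof (cases i)
  case (fields k p q r)
  have "wt q p (p + q - r) = wt p q r" by (rule wt_dual)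
  moreover have "level_const (- k - p - q) (q + p) = level_const k (p + q)" by (auto simp: level_const_def)
  ultimately show ?thesis by (simp add: dual_value_def fields)
qed

definition pairing :: "(HC \<Rightarrow> complex) \<Rightarrow> (HC \<Rightarrow> complex) \<Rightarrow> complex" where
  "pairing f g = (if f \<in> BH \<and> g \<in> BH then \<Sum>i\<in>E_support f. dual_value i * E_coord f i * E_coord g (dual i) else 0)"

lemma BH_regular: "f \<in> BH \<Longrightarrow> f \<in> regular_functions" by (simp add: BH_def)

lemma BH_add: "f \<in> BH \<Longrightarrow> g \<in> BH \<Longrightarrow> (\<lambda>Z. f Z + g Z) \<in> BH" unfolding BH_eq by (rule span_add')
lemma BH_scale: "f \<in> BH \<Longrightarrow> (\<lambda>Z. c * f Z) \<in> BH" unfolding BH_eq by (rule fs.span_scale)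
lemma E_BH: "i \<in> BI \<Longrightarrow> E i \<in> BH" unfolding BH_eq by (intro fs.span_base imageI)

text \<open>Any finite set of indices that contains the support may be used, which makes additivity in the first
  argument visible.\<close>
lemma pairing_sum:
  assumes "f \<in> BH" "g \<in> BH" "finite F" "E_support f \<subseteq> F" "F \<subseteq> II"
  shows "pairing f g = (\<Sum>i\<in>F. dual_value i * E_coord f i * E_coord g (dual i))"
proof -
  have "(\<Sum>i\<in>E_support f. dual_value i * E_coord f i * E_coord g (dual i)) = (\<Sum>i\<in>F. dual_value i * E_coord f i * E_coord g (dual i))"
    using assms by (intro sum.mono_neutral_left) (auto simp: E_support_def)
  then show ?thesis using assms by (simp add: pairing_def)
qed

lemma pairing_bilinear: "bilinear_on BH pairing"
  unfolding bilinear_on_def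
proof (intro ballI allI conjI)
  fix f g h c assume f: "f \<in> BH" and g: "g \<in> BH" and h: "h \<in> BH"
  note reg = BH_regular[OF f] BH_regular[OF g] BH_regular[OF h]
  let ?fg = "\<lambda>Z. f Z + g Z" and ?cf = "\<lambda>Z. c * f Z"
  let ?F = "E_support f \<union> E_support g \<union> E_support ?fg \<union> E_support ?cf \<union> E_support h"
  have F: "finite ?F" "?F \<subseteq> II" using E_support_II by (auto simp: finite_supp)
  note P = pairing_sum[OF _ _ F(1) _ F(2)]
  have "pairing ?fg h = (\<Sum>i\<in>?F. dual_value i * E_coord ?fg i * E_coord h (dual i))" by (rule P) (auto intro: BH_add f g h)
  also have "\<dots> = (\<Sum>i\<in>?F. dual_value i * E_coord f i * E_coord h (dual i)) + (\<Sum>i\<in>?F. dual_value i * E_coord g i * E_coord h (dual i))"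
    by (simp only: E_coord_add[OF reg(1,2)] sum.distrib[symmetric] distrib_left distrib_right)
  also have "(\<Sum>i\<in>?F. dual_value i * E_coord f i * E_coord h (dual i)) = pairing f h" by (rule P[symmetric]) (auto intro: f h)
  also have "(\<Sum>i\<in>?F. dual_value i * E_coord g i * E_coord h (dual i)) = pairing g h" by (rule P[symmetric]) (auto intro: g h)
  finally show "pairing ?fg h = pairing f h + pairing g h" .
  have "pairing ?cf h = (\<Sum>i\<in>?F. dual_value i * E_coord ?cf i * E_coord h (dual i))" by (rule P) (auto intro: BH_scale f h)
  also have "\<dots> = c * (\<Sum>i\<in>?F. dual_value i * E_coord f i * E_coord h (dual i))"
    by (simp only: E_coord_scale[OF reg(1)] sum_distrib_left mult_ac)
  also have "(\<Sum>i\<in>?F. dual_value i * E_coord f i * E_coord h (dual i)) = pairing f h" by (rule P[symmetric]) (auto intro: f h)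
  finally show "pairing ?cf h = c * pairing f h" .
  have Ph: "pairing h x = (\<Sum>i\<in>?F. dual_value i * E_coord h i * E_coord x (dual i))" if "x \<in> BH" for x by (rule P) (auto intro: h that)
  show "pairing h ?fg = pairing h f + pairing h g"
    unfolding Ph[OF BH_add[OF f g]] Ph[OF f] Ph[OF g] by (simp only: E_coord_add[OF reg(1,2)] sum.distrib[symmetric] distrib_left)
  show "pairing h ?cf = c * pairing h f"
    unfolding Ph[OF BH_scale[OF f]] Ph[OF f] by (simp only: E_coord_scale[OF reg(1)] sum_distrib_left mult_ac)
qed

text \<open>The involution \<open>dual\<close> reindexes the sum and leaves \<open>dual_value\<close> unchanged.\<close>
lemma pairing_symmetric: "symmetric_on BH pairing"
  unfolding symmetric_on_def
proof (intro ballI)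
  fix f g assume f: "f \<in> BH" and g: "g \<in> BH"
  let ?S = "E_support f \<union> E_support g" let ?F = "?S \<union> dual ` ?S"
  have "dual ` ?S \<subseteq> II" using dual_II E_support_II by blast
  then have F: "finite ?F" "?F \<subseteq> II" using E_support_II by (auto simp: finite_supp)
  have d: "dual i \<in> ?F" if "i \<in> ?F" for i using that by auto
  have "pairing f g = (\<Sum>i\<in>?F. dual_value i * E_coord f i * E_coord g (dual i))" by (rule pairing_sum) (use f g F in auto)
  also have "\<dots> = (\<Sum>i\<in>?F. dual_value i * E_coord g i * E_coord f (dual i))"
    by (rule sum.reindex_bij_witness[of _ dual dual]) (use d in \<open>auto simp: dual_value_dual\<close>)
  also have "\<dots> = pairing g f" by (rule pairing_sum[symmetric]) (use f g F in auto)
  finally show "pairing f g = pairing g f" .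
qed

lemma pairing_E:
  assumes "i \<in> BI" "j \<in> BI"
  shows "pairing (E i) (E j) = (if j = dual i then dual_value i else 0)"
proof -
  have ij: "i \<in> II" "j \<in> II" using assms BI_II by blast+
  note II = ij dual_II[OF ij(1)]
  have "E_support (E i) \<subseteq> {i}" using II by (auto simp: E_support_def E_coord_E split: if_splits)
  then have "pairing (E i) (E j) = (\<Sum>i'\<in>{i}. dual_value i' * E_coord (E i) i' * E_coord (E j) (dual i'))"
    using II by (intro pairing_sum E_BH assms) auto
  then show ?thesis using II by (auto simp: E_coord_E)
qed

lemma bilinear_onD:
  assumes "bilinear_on V B" "f \<in> V" "g \<in> V" "h \<in> V"
  shows "B (\<lambda>Z. f Z + g Z) h = B f h + B g h" "B (\<lambda>Z. c * f Z) h = c * B f h"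
     "B h (\<lambda>Z. f Z + g Z) = B h f + B h g" "B h (\<lambda>Z. c * f Z) = c * B h f"
  using assms unfolding bilinear_on_def by blast+

lemma BH_zero: "(\<lambda>Z. 0) \<in> BH" unfolding BH_eq by (rule span_zero')

lemma bilinear_zero:
  assumes "bilinear_on BH B" "h \<in> BH" shows "B (\<lambda>Z. 0) h = 0" "B h (\<lambda>Z. 0) = 0"
  using bilinear_onD(2,4)[OF assms(1) BH_zero BH_zero assms(2), of 0] by simp_all

lemma bilinear_ext:
  assumes B: "bilinear_on BH B" "bilinear_on BH B'"
    and eq: "\<And>i j. i \<in> BI \<Longrightarrow> j \<in> BI \<Longrightarrow> B (E i) (E j) = B' (E i) (E j)"
    and f: "f \<in> BH" and g: "g \<in> BH"
  shows "B f g = B' f g"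
proof -
  have 1: "B (E i) g = B' (E i) g" if i: "i \<in> BI" for i
    using g unfolding BH_eq
  proof (induction rule: span_induct_E)
    case zero
    show ?case by (simp add: bilinear_zero[OF B(1) E_BH[OF i]] bilinear_zero[OF B(2) E_BH[OF i]])
  next
    case (step c j g)
    have j: "E j \<in> BH" "(\<lambda>Z. c * E j Z) \<in> BH" and g: "g \<in> BH"
      using E_BH[OF step.hyps(1)] step.hyps(2) BH_scale by (blast, blast, simp add: BH_eq)
    show ?case unfolding bilinear_onD(3)[OF B(1) j(2) g E_BH[OF i]] bilinear_onD(3)[OF B(2) j(2) g E_BH[OF i]]
       bilinear_onD(4)[OF B(1) j(1) g E_BH[OF i]] bilinear_onD(4)[OF B(2) j(1) g E_BH[OF i]] step.IH eq[OF i step.hyps(1)] ..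
  qed
  show ?thesis
    using f unfolding BH_eq
  proof (induction rule: span_induct_E)
    case zero
    show ?case by (simp add: bilinear_zero[OF B(1) g] bilinear_zero[OF B(2) g])
  next
    case (step c j f)
    have j: "E j \<in> BH" "(\<lambda>Z. c * E j Z) \<in> BH" and f: "f \<in> BH"
      using E_BH[OF step.hyps(1)] step.hyps(2) BH_scale by (blast, blast, simp add: BH_eq)
    show ?case unfolding bilinear_onD(1)[OF B(1) j(2) f g] bilinear_onD(1)[OF B(2) j(2) f g]
       bilinear_onD(2)[OF B(1) j(1) f g] bilinear_onD(2)[OF B(2) j(1) f g] step.IH 1[OF step.hyps(1)] ..
  qed
qed

lemma BH_plus_sub: "BH_plus \<subseteq> BH" and BH_minus_sub: "BH_minus \<subseteq> BH"
  unfolding BH_plus_eq BH_minus_eq BH_eq BI_def by (intro fs.span_mono image_mono; blast)+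

lemma bilinear_zero_on_span:
  assumes B: "bilinear_on BH B" and AB: "A \<subseteq> BI"
    and eq: "\<And>i j. i \<in> A \<Longrightarrow> j \<in> A \<Longrightarrow> B (E i) (E j) = 0"
    and f: "f \<in> fs.span (E ` A)" and g: "g \<in> fs.span (E ` A)"
  shows "B f g = 0"
proof -
  have sub: "h \<in> BH" if "h \<in> fs.span (E ` A)" for h using fs.span_mono[OF image_mono[OF AB, of E]] that unfolding BH_eq by blast
  have 1: "B (E i) g = 0" if i: "i \<in> A" for i
  proof -
    have Ei: "E i \<in> BH" using i AB E_BH by blast
    from g show ?thesis
    proof (induction rule: span_induct_E)
      case zero
      show ?case by (simp add: bilinear_zero[OF B Ei])
    next
      case (step c j g)
      have j: "E j \<in> BH" "(\<lambda>Z. c * E j Z) \<in> BH" and g: "g \<in> BH" using step AB sub by (auto simp: E_BH BH_scale)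
      show ?case unfolding bilinear_onD(3)[OF B j(2) g Ei] bilinear_onD(4)[OF B j(1) g Ei] step.IH eq[OF i step.hyps(1)] by simp
    qed
  qed
  have gB: "g \<in> BH" using g sub by blast
  from f show ?thesis
  proof (induction rule: span_induct_E)
    case zero
    show ?case by (simp add: bilinear_zero[OF B gB])
  next
    case (step c j f)
    have j: "E j \<in> BH" "(\<lambda>Z. c * E j Z) \<in> BH" and f: "f \<in> BH" using step AB sub by (auto simp: E_BH BH_scale)
    show ?case unfolding bilinear_onD(1)[OF B j(2) f gB] bilinear_onD(2)[OF B j(1) f gB] step.IH 1[OF step.hyps(1)] by simp
  qed
qed

text \<open>The exponents of \<open>i\<close> and \<open>dual i\<close> add up to \<open>-d\<close>, which cancels the power \<open>R\<^sup>2\<^sup>d\<close> of the degree.\<close>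
lemma integral_dual:
  assumes R: "R > 0" and i: "i \<in> II" "i' \<in> II" "fst i = fst i'"
  shows "(\<integral>X. E i X * E (dual i') X \<partial>dS R) = (if i = i' then
     (case i of (k,p,q,r) \<Rightarrow> complex_of_real (2 * pi\<^sup>2 * R ^ 3) * wt p q r / of_int (p + q + 1)) else 0)"
proof -
  obtain k p q r where ii: "i = (k,p,q,r)" by (cases i)
  obtain p' q' r' where ii': "i' = (k,p',q',r')" using i(3) by (cases i') (auto simp: ii)
  have d: "(- k - p' - q', q', p', p' + q' - r') \<in> II" using dual_II[OF i(2)] by (simp add: ii')
  have "R\<^sup>2 \<noteq> 0" using R by simp
  then show ?thesis unfolding ii ii' dual_simp schur[OF R i(1)[unfolded ii] d] by auto
qed

lemma phi_coeff_wt: "(k,p,q,r) \<in> II \<Longrightarrow> phi_coeff (k,p,q,r) * phi_t_coeff (k,p,q,r) * wt p q r = 1"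
proof -
  assume "(k,p,q,r) \<in> II"
  then have "ifact p \<noteq> 0" "ifact q \<noteq> 0" "ifact r \<noteq> 0" "ifact (p + q - r) \<noteq> 0" by (auto simp: II_def ifact_nz)
  then show ?thesis by (simp add: phi_coeff_def phi_t_coeff_def wt_def)
qed

lemma phi_BH_plus: "\<alpha> \<in> {1,2} \<Longrightarrow> (l,m,n) \<in> indices \<alpha> \<Longrightarrow> phi \<alpha> l m n \<in> BH_plus"
  unfolding BH_plus_def cspan_eq by (intro fs.span_base) blast
lemma phi_t_BH_minus: "\<alpha> \<in> {1,2} \<Longrightarrow> (l,m,n) \<in> indices \<alpha> \<Longrightarrow> phi_t \<alpha> l m n \<in> BH_minus"
  unfolding BH_minus_def cspan_eq by (intro fs.span_base) blast

lemma phi_integral: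
  assumes R: "R > 0" and a: "\<alpha> \<in> {1,2}" "(l,m,n) \<in> indices \<alpha>" "(l',m',n') \<in> indices \<alpha>"
  shows "(\<integral>X. phi \<alpha> l m n X * phi_t \<alpha> l' m' n' X / complex_of_real (R ^ 3) \<partial>dS R)
    = (if l = l' \<and> m = m' \<and> n = n' then complex_of_real (2 * pi\<^sup>2 / (2 * (l - (real \<alpha> - 1)) + 1)) else 0)"
proof -
  let ?i = "phi_ix \<alpha> l m n" and ?i' = "phi_ix \<alpha> l' m' n'"
  obtain p q r :: int where pqr: "l - (real \<alpha> - 1) - m = of_int p" "l - (real \<alpha> - 1) + m = of_int q" and phi_ix: "?i = (int \<alpha> - 1, p, q, r)"
    by (rule indices_ints[OF a(1,2)])
  have II: "?i \<in> II" "?i' \<in> II" using phi_ix_PI[OF a(1,2)] phi_ix_PI[OF a(1,3)] PI_II by auto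
  have fst: "fst ?i = fst ?i'" by (simp add: phi_ix_def Let_def)
  have "(\<integral>X. phi \<alpha> l m n X * phi_t \<alpha> l' m' n' X / complex_of_real (R ^ 3) \<partial>dS R)
    = (\<integral>X. (phi_coeff ?i * phi_t_coeff ?i' / complex_of_real (R ^ 3)) * (E ?i X * E (dual ?i') X) \<partial>dS R)"
    unfolding phi_eq[OF a(1,2)] phi_eq[OF a(1,3)] by (intro Bochner_Integration.integral_cong refl) (simp add: field_simps)
  also have "\<dots> = (phi_coeff ?i * phi_t_coeff ?i' / complex_of_real (R ^ 3)) * (\<integral>X. E ?i X * E (dual ?i') X \<partial>dS R)"
    by (rule Bochner_Integration.integral_mult_right_zero)
  also have "\<dots> = (if l = l' \<and> m = m' \<and> n = n' then complex_of_real (2 * pi\<^sup>2 / (2 * (l - (real \<alpha> - 1)) + 1)) else 0)"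
  proof (cases "l = l' \<and> m = m' \<and> n = n'")
    case False
    then have "?i \<noteq> ?i'" using phi_ix_inj[OF a] by simp
    then show ?thesis unfolding integral_dual[OF R II fst] using False by auto
  next
    case True
    have c: "phi_coeff ?i * phi_t_coeff ?i * wt p q r = 1" unfolding phi_ix by (rule phi_coeff_wt) (use II(1) phi_ix in simp)
    have "2 * (l - (real \<alpha> - 1)) + 1 = real_of_int (p + q + 1)" using pqr by simp
    then have e: "complex_of_real (2 * (l - (real \<alpha> - 1)) + 1) = ci (p + q + 1)" by (metis of_real_of_int_eq)
    have "(phi_coeff ?i * phi_t_coeff ?i / complex_of_real (R ^ 3)) * (complex_of_real (2 * pi\<^sup>2 * R ^ 3) * wt p q r / ci (p + q + 1))
       = (phi_coeff ?i * phi_t_coeff ?i * wt p q r) * (complex_of_real (2 * pi\<^sup>2) / ci (p + q + 1))" using R by (simp add: field_simps)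
    also have "\<dots> = complex_of_real (2 * pi\<^sup>2 / (2 * (l - (real \<alpha> - 1)) + 1))" unfolding c of_real_divide e by simp
    finally have main: "(phi_coeff ?i * phi_t_coeff ?i / complex_of_real (R ^ 3)) * (complex_of_real (2 * pi\<^sup>2 * R ^ 3) * wt p q r / ci (p + q + 1))
       = complex_of_real (2 * pi\<^sup>2 / (2 * (l - (real \<alpha> - 1)) + 1))" .
    have ii: "?i' = ?i" using True by simp
    have "(\<integral>X. E ?i X * E (dual ?i') X \<partial>dS R) = complex_of_real (2 * pi\<^sup>2 * R ^ 3) * wt p q r / ci (p + q + 1)"
      using integral_dual[OF R II fst] unfolding ii unfolding phi_ix by (simp only: simp_thms if_True prod.case)
    then show ?thesis unfolding ii using main True by (simp only: simp_thms if_True)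
  qed
  finally show ?thesis .
qed

lemma phi_in_BH: "\<alpha> \<in> {1,2} \<Longrightarrow> (l,m,n) \<in> indices \<alpha> \<Longrightarrow> phi \<alpha> l m n \<in> BH" "\<alpha> \<in> {1,2} \<Longrightarrow> (l,m,n) \<in> indices \<alpha> \<Longrightarrow> phi_t \<alpha> l m n \<in> BH"
  using phi_BH_plus BH_plus_sub phi_t_BH_minus BH_minus_sub by blast+

text \<open>The scalars that relate \<open>\<phi>\<close> and its partner to \<open>E\<close> cancel \<open>wt\<close>; what remains is \<open>level_const\<close>, with
  \<open>d = 2l\<close> for \<open>\<alpha> = 1\<close> and \<open>d = 2l - 2\<close> for \<open>\<alpha> = 2\<close>.\<close>
lemma pairing_phi:
  assumes a: "\<alpha> \<in> {1,2}" "(l,m,n) \<in> indices \<alpha>" "\<alpha>' \<in> {1,2}" "(l',m',n') \<in> indices \<alpha>'"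
  shows "pairing (phi \<alpha> l m n) (phi_t \<alpha>' l' m' n') =
     (if \<alpha> = \<alpha>' \<and> l = l' \<and> m = m' \<and> n = n' then (if \<alpha> = 1 then complex_of_real (2 * l) else - complex_of_real (2 * l)) else 0)"
proof -
  let ?i = "phi_ix \<alpha> l m n" and ?i' = "phi_ix \<alpha>' l' m' n'"
  obtain p q r :: int where pqr: "l - (real \<alpha> - 1) - m = of_int p" "l - (real \<alpha> - 1) + m = of_int q" and phi_ix: "?i = (int \<alpha> - 1, p, q, r)"
     and pos: "0 \<le> p" "0 \<le> q"
    by (rule indices_ints[OF a(1,2)])
  have PI: "?i \<in> PI" "?i' \<in> PI" using phi_ix_PI a by auto
  then have BI: "?i \<in> BI" "dual ?i' \<in> BI" using dual_PI by (auto simp: BI_def)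
  have "pairing (phi \<alpha> l m n) (phi_t \<alpha>' l' m' n') = phi_coeff ?i * (phi_t_coeff ?i' * pairing (E ?i) (E (dual ?i')))"
    unfolding phi_eq[OF a(1,2)] phi_eq[OF a(3,4)]
    by (simp add: bilinear_onD(2)[OF pairing_bilinear E_BH[OF BI(1)] BH_zero] bilinear_onD(4)[OF pairing_bilinear E_BH[OF BI(2)] BH_zero]
       BH_scale E_BH BI)
  also have "pairing (E ?i) (E (dual ?i')) = (if ?i = ?i' then dual_value ?i else 0)"
    unfolding pairing_E[OF BI] by (metis dual_dual)
  finally have 1: "pairing (phi \<alpha> l m n) (phi_t \<alpha>' l' m' n') = phi_coeff ?i * (phi_t_coeff ?i' * (if ?i = ?i' then dual_value ?i else 0))" .
  have "?i = ?i' \<Longrightarrow> \<alpha> = \<alpha>'" by (simp add: phi_ix_def Let_def)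
  then have eq: "?i = ?i' \<longleftrightarrow> \<alpha> = \<alpha>' \<and> l = l' \<and> m = m' \<and> n = n'" using phi_ix_inj[OF a(1,2)] a(4) by blast
  have c: "phi_coeff ?i * phi_t_coeff ?i * wt p q r = 1" unfolding phi_ix by (rule phi_coeff_wt) (use PI(1) PI_II phi_ix in auto)
  have d: "real_of_int (p + q) = 2 * (l - (real \<alpha> - 1))" using pqr by simp
  have "phi_coeff ?i * (phi_t_coeff ?i * dual_value ?i) = (phi_coeff ?i * phi_t_coeff ?i * wt p q r) * level_const (int \<alpha> - 1) (p + q)" by (simp add: dual_value_def phi_ix)
  also have "\<dots> = level_const (int \<alpha> - 1) (p + q)" by (simp only: c mult_1_left)
  also have "\<dots> = (if \<alpha> = 1 then complex_of_real (2 * l) else - complex_of_real (2 * l))"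
  proof (cases "\<alpha> = 1")
    case True
    then have "complex_of_real (2 * l) = ci (p + q)" using d by (metis diff_self diff_zero of_real_of_int_eq of_nat_1)
    then show ?thesis using True by (simp add: level_const_def)
  next
    case False
    then have "\<alpha> = 2" using a by auto
    then have "2 * l = real_of_int (p + q + 2)" using d by simp
    then have "complex_of_real (2 * l) = ci (p + q + 2)" by (metis of_real_of_int_eq)
    then show ?thesis using \<open>\<alpha> = 2\<close> pos by (simp add: level_const_def)
  qed
  finally show ?thesis unfolding 1 eq[symmetric] by auto
qed

lemma dual_value_dual_plus: "i \<in> PI \<Longrightarrow> dual i \<in> PI \<Longrightarrow> dual_value i = 0"
  by (cases i) (auto simp: PI_def II_def dual_value_def level_const_def)
lemma dual_value_dual_minus: "i \<in> MI \<Longrightarrow> dual i \<in> MI \<Longrightarrow> dual_value i = 0"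
  by (cases i) (auto simp: MI_def II_def dual_value_def level_const_def)

lemma pi_cancel: "y \<noteq> 0 \<Longrightarrow> x * y / (2 * pi\<^sup>2) * (2 * pi\<^sup>2 / y) = (x::real)"
  by simp

text \<open>The prefactors \<open>2l(2l+1)\<close> and \<open>2l(2l-1)\<close> contain the dimension \<open>d + 1\<close>, which cancels the denominator of
  the Schur relation.\<close>
lemma is_BH_pairing_pairing:
  assumes R: "R > 0" shows "is_BH_pairing R pairing"
  unfolding is_BH_pairing_def
proof (intro conjI pairing_bilinear pairing_symmetric)
  show "\<forall>(l, m, n)\<in>indices 1. \<forall>(l', m', n')\<in>indices 1.
       pairing (phi 1 l m n) (phi_t 1 l' m' n') =
       complex_of_real (2 * l * (2 * l + 1) / (2 * pi\<^sup>2)) *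
       (\<integral>X. phi 1 l m n X * phi_t 1 l' m' n' X / complex_of_real (R ^ 3) \<partial>dS R)"
  proof (clarify)
    fix l m n l' m' n' assume i: "(l,m,n) \<in> indices 1" "(l',m',n') \<in> indices 1"
    have "l \<ge> 0" using i(1) by (auto simp: indices_def half_integers_def)
    then have nz: "2 * l + 1 \<noteq> 0" by simp
    have "2 * l * (2 * l + 1) / (2 * pi\<^sup>2) * (2 * pi\<^sup>2 / (2 * l + 1)) = 2 * l" by (rule pi_cancel[OF nz])
    then have "complex_of_real (2 * l * (2 * l + 1) / (2 * pi\<^sup>2)) * complex_of_real (2 * pi\<^sup>2 / (2 * l + 1)) = complex_of_real (2 * l)"
      by (metis of_real_mult)
    note c = this
    have e: "2 * (l - (real 1 - 1)) + 1 = 2 * l + 1" by simp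
    have a: "(1::nat) \<in> {1,2}" by simp
    have P: "pairing (phi 1 l m n) (phi_t 1 l' m' n') = (if l = l' \<and> m = m' \<and> n = n' then complex_of_real (2 * l) else 0)"
      unfolding pairing_phi[OF a i(1) a i(2)] by simp
    show "pairing (phi 1 l m n) (phi_t 1 l' m' n') =
       complex_of_real (2 * l * (2 * l + 1) / (2 * pi\<^sup>2)) *
       (\<integral>X. phi 1 l m n X * phi_t 1 l' m' n' X / complex_of_real (R ^ 3) \<partial>dS R)"
      unfolding P phi_integral[OF R a i] e
      by (simp only: if_distrib[of "\<lambda>x. (complex_of_real (2 * l * (2 * l + 1) / (2 * pi\<^sup>2))) * x"] c mult_zero_right mult_minus_left)
  qed
  show "\<forall>(l, m, n)\<in>indices 2. \<forall>(l', m', n')\<in>indices 2.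
       pairing (phi 2 l m n) (phi_t 2 l' m' n') =
       - complex_of_real (2 * l * (2 * l - 1) / (2 * pi\<^sup>2)) *
       (\<integral>X. phi 2 l m n X * phi_t 2 l' m' n' X / complex_of_real (R ^ 3) \<partial>dS R)"
  proof (clarify)
    fix l m n l' m' n' assume i: "(l,m,n) \<in> indices 2" "(l',m',n') \<in> indices 2"
    have "l \<ge> 1" using i(1) by (auto simp: indices_def weights_def)
    then have nz: "2 * l - 1 \<noteq> 0" by simp
    have "2 * l * (2 * l - 1) / (2 * pi\<^sup>2) * (2 * pi\<^sup>2 / (2 * l - 1)) = 2 * l" by (rule pi_cancel[OF nz])
    then have "complex_of_real (2 * l * (2 * l - 1) / (2 * pi\<^sup>2)) * complex_of_real (2 * pi\<^sup>2 / (2 * l - 1)) = complex_of_real (2 * l)"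
      by (metis of_real_mult)
    note c = this
    have e: "2 * (l - (real 2 - 1)) + 1 = 2 * l - 1" by simp
    have a: "(2::nat) \<in> {1,2}" by simp
    have P: "pairing (phi 2 l m n) (phi_t 2 l' m' n') = (if l = l' \<and> m = m' \<and> n = n' then - complex_of_real (2 * l) else 0)"
      unfolding pairing_phi[OF a i(1) a i(2)] by simp
    show "pairing (phi 2 l m n) (phi_t 2 l' m' n') =
       - complex_of_real (2 * l * (2 * l - 1) / (2 * pi\<^sup>2)) *
       (\<integral>X. phi 2 l m n X * phi_t 2 l' m' n' X / complex_of_real (R ^ 3) \<partial>dS R)"
      unfolding P phi_integral[OF R a i] e
      by (simp only: mult_minus_left if_distrib[of "\<lambda>x. complex_of_real (2 * l * (2 * l - 1) / (2 * pi\<^sup>2)) * x"] c mult_zero_right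
           if_distrib[of uminus] minus_zero)
  qed
  show "\<forall>\<alpha>\<in>{1, 2}. \<forall>\<alpha>'\<in>{1, 2}. \<alpha> \<noteq> \<alpha>' \<longrightarrow> (\<forall>(l, m, n)\<in>indices \<alpha>. \<forall>(l', m', n')\<in>indices \<alpha>'. pairing (phi \<alpha> l m n) (phi_t \<alpha>' l' m' n') = 0)"
  proof (intro ballI impI)
    fix \<alpha> \<alpha>' x assume a: "\<alpha> \<in> {1,2::nat}" "\<alpha>' \<in> {1,2::nat}" "\<alpha> \<noteq> \<alpha>'" and x: "x \<in> indices \<alpha>"
    obtain l m n where e: "x = (l,m,n)" by (metis prod_cases3)
    have "pairing (phi \<alpha> l m n) (phi_t \<alpha>' l' m' n') = 0" if y: "(l',m',n') \<in> indices \<alpha>'" for l' m' n'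
      using pairing_phi[OF a(1) x[unfolded e] a(2) y] a(3) by simp
    then show "case x of (l, m, n) \<Rightarrow> \<forall>(l', m', n')\<in>indices \<alpha>'. pairing (phi \<alpha> l m n) (phi_t \<alpha>' l' m' n') = 0"
      unfolding e by auto
  qed
  show "\<forall>f\<in>BH_plus. \<forall>g\<in>BH_plus. pairing f g = 0"
  proof (intro ballI)
    fix f g assume fg: "f \<in> BH_plus" "g \<in> BH_plus"
    show "pairing f g = 0"
    proof (rule bilinear_zero_on_span[OF pairing_bilinear _ _ fg[unfolded BH_plus_eq]])
      show "PI \<subseteq> BI" by (simp add: BI_def)
      fix i j assume ij: "i \<in> PI" "j \<in> PI"
      then have BI: "i \<in> BI" "j \<in> BI" by (simp_all add: BI_def)
      show "pairing (E i) (E j) = 0"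
        unfolding pairing_E[OF BI] using dual_value_dual_plus[OF ij(1)] ij(2) by (cases "j = dual i") (simp_all only: simp_thms if_True if_False)
    qed
  qed
  show "\<forall>f\<in>BH_minus. \<forall>g\<in>BH_minus. pairing f g = 0"
  proof (intro ballI)
    fix f g assume fg: "f \<in> BH_minus" "g \<in> BH_minus"
    show "pairing f g = 0"
    proof (rule bilinear_zero_on_span[OF pairing_bilinear _ _ fg[unfolded BH_minus_eq]])
      show "MI \<subseteq> BI" by (simp add: BI_def)
      fix i j assume ij: "i \<in> MI" "j \<in> MI"
      then have BI: "i \<in> BI" "j \<in> BI" by (simp_all add: BI_def)
      show "pairing (E i) (E j) = 0"
        unfolding pairing_E[OF BI] using dual_value_dual_minus[OF ij(1)] ij(2) by (cases "j = dual i") (simp_all only: simp_thms if_True if_False)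
    qed
  qed
qed

lemma is_BH_pairing_phi:
  assumes "is_BH_pairing R B" "is_BH_pairing R B'" "\<alpha> \<in> {1,2}" "(l,m,n) \<in> indices \<alpha>" "\<alpha>' \<in> {1,2}" "(l',m',n') \<in> indices \<alpha>'"
  shows "B (phi \<alpha> l m n) (phi_t \<alpha>' l' m' n') = B' (phi \<alpha> l m n) (phi_t \<alpha>' l' m' n')"
proof -
  have *: "B (phi \<alpha> l m n) (phi_t \<alpha>' l' m' n') = (if \<alpha> \<noteq> \<alpha>' then 0 else if \<alpha> = 1 then complex_of_real (2 * l * (2 * l + 1) / (2 * pi\<^sup>2)) *
       (\<integral>X. phi 1 l m n X * phi_t 1 l' m' n' X / complex_of_real (R ^ 3) \<partial>dS R) else - complex_of_real (2 * l * (2 * l - 1) / (2 * pi\<^sup>2)) *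
       (\<integral>X. phi 2 l m n X * phi_t 2 l' m' n' X / complex_of_real (R ^ 3) \<partial>dS R))" if "is_BH_pairing R B" for B
  proof -
    consider "\<alpha> \<noteq> \<alpha>'" | "\<alpha> = 1" "\<alpha>' = 1" | "\<alpha> = 2" "\<alpha>' = 2" using assms by auto
    then show ?thesis
    proof cases
      case 1
      have "\<forall>\<alpha> \<in> {1, 2}. \<forall>\<alpha>' \<in> {1, 2}. \<alpha> \<noteq> \<alpha>' \<longrightarrow>
        (\<forall>(l, m, n) \<in> indices \<alpha>. \<forall>(l', m', n') \<in> indices \<alpha>'. B (phi \<alpha> l m n) (phi_t \<alpha>' l' m' n') = 0)"
        using that unfolding is_BH_pairing_def by (elim conjE)
      from bspec[OF bspec[OF this assms(3)] assms(5)] 1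
      have "\<forall>(l, m, n) \<in> indices \<alpha>. \<forall>(l', m', n') \<in> indices \<alpha>'. B (phi \<alpha> l m n) (phi_t \<alpha>' l' m' n') = 0"
        by (rule mp)
      from bspec[OF this assms(4)] have "\<forall>(l', m', n') \<in> indices \<alpha>'. B (phi \<alpha> l m n) (phi_t \<alpha>' l' m' n') = 0" by simp
      from bspec[OF this assms(6)] show ?thesis using 1 by simp
    next
      case 2
      have "\<forall>(l, m, n) \<in> indices 1. \<forall>(l', m', n') \<in> indices 1.
        B (phi 1 l m n) (phi_t 1 l' m' n') = complex_of_real (2 * l * (2 * l + 1) / (2 * pi\<^sup>2)) *
          (\<integral>X. phi 1 l m n X * phi_t 1 l' m' n' X / complex_of_real (R ^ 3) \<partial>dS R)"
        using that unfolding is_BH_pairing_def by (elim conjE)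
      from bspec[OF this assms(4)[unfolded 2]] have "\<forall>(l', m', n') \<in> indices 1.
        B (phi 1 l m n) (phi_t 1 l' m' n') = complex_of_real (2 * l * (2 * l + 1) / (2 * pi\<^sup>2)) *
          (\<integral>X. phi 1 l m n X * phi_t 1 l' m' n' X / complex_of_real (R ^ 3) \<partial>dS R)" by simp
      from bspec[OF this assms(6)[unfolded 2]] show ?thesis unfolding 2 by simp
    next
      case 3
      have "\<forall>(l, m, n) \<in> indices 2. \<forall>(l', m', n') \<in> indices 2.
        B (phi 2 l m n) (phi_t 2 l' m' n') = - complex_of_real (2 * l * (2 * l - 1) / (2 * pi\<^sup>2)) *
          (\<integral>X. phi 2 l m n X * phi_t 2 l' m' n' X / complex_of_real (R ^ 3) \<partial>dS R)"
        using that unfolding is_BH_pairing_def by (elim conjE)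
      from bspec[OF this assms(4)[unfolded 3]] have "\<forall>(l', m', n') \<in> indices 2.
        B (phi 2 l m n) (phi_t 2 l' m' n') = - complex_of_real (2 * l * (2 * l - 1) / (2 * pi\<^sup>2)) *
          (\<integral>X. phi 2 l m n X * phi_t 2 l' m' n' X / complex_of_real (R ^ 3) \<partial>dS R)" by simp
      from bspec[OF this assms(6)[unfolded 3]] show ?thesis unfolding 3 by simp
    qed
  qed
  show ?thesis unfolding *[OF assms(1)] *[OF assms(2)] ..
qed

text \<open>The defining conditions determine the values on all pairs of basis functions \<open>E\<close>.\<close>
lemma is_BH_pairing_unique:
  assumes B: "is_BH_pairing R B" and B': "is_BH_pairing R B'" and "f \<in> BH" "g \<in> BH"
  shows "B f g = B' f g"
proof (rule bilinear_ext[of B B'])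
  have bil: "bilinear_on BH B" "bilinear_on BH B'" and sym: "symmetric_on BH B" "symmetric_on BH B'"
    using B B' by (auto simp: is_BH_pairing_def)
  then show "bilinear_on BH B" "bilinear_on BH B'" by auto
  have PM: "B (E i) (E j) = B' (E i) (E j)" if i: "i \<in> PI" and j: "j \<in> MI" for i j
  proof -
    from phi_ix_surj[OF i] obtain \<alpha> l m n where a: "\<alpha> \<in> {1,2}" "(l,m,n) \<in> indices \<alpha>" "phi_ix \<alpha> l m n = i" .
    from phi_ix_surj[OF dual_PI(2)[OF j]] obtain \<alpha>' l' m' n' where a': "\<alpha>' \<in> {1,2}" "(l',m',n') \<in> indices \<alpha>'" "phi_ix \<alpha>' l' m' n' = dual j" .
    have BI: "E i \<in> BH" "E j \<in> BH" using i j by (auto intro!: E_BH simp: BI_def)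
    have *: "B (phi \<alpha> l m n) (phi_t \<alpha>' l' m' n') = phi_coeff i * (phi_t_coeff (dual j) * B (E i) (E j))" if "bilinear_on BH B" for B
      unfolding phi_eq[OF a(1,2)] phi_eq[OF a'(1,2)] a(3) a'(3) dual_dual
      by (simp add: bilinear_onD(2)[OF that BI(1) BH_zero] bilinear_onD(4)[OF that BI(2) BH_zero] BH_scale BI)
    have "phi_coeff i \<noteq> 0" "phi_t_coeff (dual j) \<noteq> 0" using i j PI_II MI_II by (auto intro!: phi_coeff_nz dual_II)
    then show ?thesis using is_BH_pairing_phi[OF B B' a(1,2) a'(1,2)] unfolding *[OF bil(1)] *[OF bil(2)] by simp
  qed
  fix i j assume "i \<in> BI" "j \<in> BI"
  then consider "i \<in> PI" "j \<in> PI" | "i \<in> PI" "j \<in> MI" | "i \<in> MI" "j \<in> PI" | "i \<in> MI" "j \<in> MI" by (auto simp: BI_def)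
  then show "B (E i) (E j) = B' (E i) (E j)"
  proof cases
    case 1
    then have "E i \<in> BH_plus" "E j \<in> BH_plus" unfolding BH_plus_eq by (auto intro: fs.span_base)
    then show ?thesis using B B' by (simp add: is_BH_pairing_def)
  next
    case 2
    then show ?thesis by (rule PM)
  next
    case 3
    have "E i \<in> BH" "E j \<in> BH" using 3 by (auto intro!: E_BH simp: BI_def)
    then show ?thesis using PM[OF 3(2,1)] sym unfolding symmetric_on_def by metis
  next
    case 4
    then have "E i \<in> BH_minus" "E j \<in> BH_minus" unfolding BH_minus_eq by (auto intro: fs.span_base)
    then show ?thesis using B B' by (simp add: is_BH_pairing_def)
  qed
qed (fact assms)+

text \<open>The form on the right does not mention the radius; independence of \<open>R\<close> is contained in this equation.\<close>
lemma BH_pairing_eq: "R > 0 \<Longrightarrow> BH_pairing R = pairing"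
  unfolding BH_pairing_def
proof (rule the_equality)
  assume R: "R > 0"
  show "is_BH_pairing R pairing \<and> (\<forall>f g. f \<notin> BH \<or> g \<notin> BH \<longrightarrow> pairing f g = 0)"
    using is_BH_pairing_pairing[OF R] by (auto simp: pairing_def)
  fix B assume B: "is_BH_pairing R B \<and> (\<forall>f g. f \<notin> BH \<or> g \<notin> BH \<longrightarrow> B f g = 0)"
  show "B = pairing"
  proof (intro ext)
    fix f g
    show "B f g = pairing f g"
    proof (cases "f \<in> BH \<and> g \<in> BH")
      case True
      then show ?thesis using is_BH_pairing_unique[OF _ is_BH_pairing_pairing[OF R]] B by blast
    next
      case False
      then show ?thesis using B by (auto simp: pairing_def)
    qed
  qed
qed

section \<open>Invariance under SU(2) x SU(2)\<close>

text \<open>Substituting \<open>AZ\<close> into the generating function in \<open>s\<close> gives the homogeneous generating function at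
  \<open>(s a\<^sub>1\<^sub>1 + a\<^sub>2\<^sub>1, s a\<^sub>1\<^sub>2 + a\<^sub>2\<^sub>2)\<close>, whose powers are again generating functions, for the matrix \<open>A\<close>. Comparison
  of the coefficients of \<open>s\<close> gives the multiplicativity of the matrix coefficients.\<close>
lemma S_left_mult:
  assumes pos: "0 \<le> p" "0 \<le> q" and r: "0 \<le> r" "r \<le> p + q"
  shows "S p q r (A ** Z) = (\<Sum>j\<in>{0..p+q}. S p q j Z * (S j (p+q-j) r A / (ifact j * ifact (p+q-j))))"
proof -
  define d where "d = p + q"
  \<comment> \<open>The difference of both sides, as a function of \<open>r\<close>, has vanishing generating function.\<close>
  define c where "c r = S p q r (A ** Z) - (\<Sum>j\<in>{0..d}. S p q j Z * (S j (d-j) r A / (ifact j * ifact (d-j))))" for r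
  have "(\<Sum>r\<in>{0..d}. c r * complex_of_real (x powi r)) = 0" if x: "x > 0" for x :: real
  proof -
    define s where "s = complex_of_real x"
    let ?a = "s * A$1$1 + A$2$1" and ?b = "s * A$1$2 + A$2$2"
    have "(\<Sum>r\<in>{0..d}. S p q r (A ** Z) * s powi r) = ifact p * ifact q * ((s * (A ** Z)$1$1 + (A ** Z)$2$1) ^ nat p * (s * (A ** Z)$1$2 + (A ** Z)$2$2) ^ nat q)"
      using S_generating[of "nat p" "nat q" "A ** Z" s] pos by (simp add: d_def)
    also have "\<dots> = ifact p * ifact q * ((?a * Z$1$1 + ?b * Z$2$1) ^ nat p * (?a * Z$1$2 + ?b * Z$2$2) ^ nat q)"
      by (simp add: mult_2_entry algebra_simps)
    also have "\<dots> = (\<Sum>j\<in>{0..d}. S p q j Z * (?a ^ nat j * ?b ^ nat (d - j)))"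
      using S_generating_homogeneous[of "nat p" "nat q" Z ?a ?b] pos by (simp add: d_def)
    also have "\<dots> = (\<Sum>j\<in>{0..d}. S p q j Z * (\<Sum>r\<in>{0..d}. S j (d-j) r A / (ifact j * ifact (d-j)) * s powi r))"
    proof (intro sum.cong refl)
      fix j assume j: "j \<in> {0..d}"
      have "(\<Sum>r\<in>{0..d}. S j (d-j) r A * s powi r) = ifact j * ifact (d-j) * (?a ^ nat j * ?b ^ nat (d - j))"
        using S_generating[of "nat j" "nat (d - j)" A s] j by simp
      moreover have "ifact j * ifact (d-j) \<noteq> 0" using j by (simp add: ifact_nz)
      ultimately have "?a ^ nat j * ?b ^ nat (d - j) = (\<Sum>r\<in>{0..d}. S j (d-j) r A * s powi r) / (ifact j * ifact (d-j))" by simp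
      then show "S p q j Z * (?a ^ nat j * ?b ^ nat (d - j)) = S p q j Z * (\<Sum>r\<in>{0..d}. S j (d-j) r A / (ifact j * ifact (d-j)) * s powi r)"
        by (simp add: sum_divide_distrib)
    qed
    also have "\<dots> = (\<Sum>r\<in>{0..d}. (\<Sum>j\<in>{0..d}. S p q j Z * (S j (d-j) r A / (ifact j * ifact (d-j)))) * s powi r)"
      unfolding sum_distrib_left sum_distrib_right by (subst sum.swap) (simp only: mult.assoc)
    finally show ?thesis by (simp add: c_def left_diff_distrib sum_subtractf s_def[symmetric] of_real_power_int)
  qed
  from powi_independent[OF _ this, of r] r have "c r = 0" by (simp add: d_def)
  then show ?thesis by (simp add: c_def d_def)
qed

lemma adj_adj [simp]: "adj (adj Z) = Z" by (rule matrix_entries_eqI) auto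
lemma adj_mult: "adj (A ** B) = adj B ** adj A" by (rule matrix_entries_eqI) (auto simp: mult_2_entry)

text \<open>For fixed \<open>k\<close> and degree \<open>d\<close> the functions \<open>E\<close> span an irreducible representation of \<open>SU(2) \<times> SU(2)\<close>.\<close>
definition level :: "int \<Rightarrow> int \<Rightarrow> idx set" where "level k d = {(k',p,q,r). (k',p,q,r) \<in> II \<and> k' = k \<and> p + q = d}"

lemma span_translate:
  assumes f: "f \<in> fs.span (E ` A)" and T: "\<And>i. i \<in> A \<Longrightarrow> (\<lambda>Z. E i (g Z)) \<in> fs.span (E ` B)"
  shows "(\<lambda>Z. f (g Z)) \<in> fs.span (E ` B)"
  using f
proof (induction rule: span_induct_E)
  case zero
  show ?case by (rule span_zero')
next
  case (step c i f)
  show ?case by (intro span_add' fs.span_scale T step)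
qed

lemma E_left_mult:
  assumes A: "det A = 1" and i: "i \<in> level k d"
  shows "(\<lambda>Z. E i (A ** Z)) \<in> fs.span (E ` level k d)"
proof -
  obtain p q r where ii: "i = (k,p,q,r)" and pos: "0 \<le> p" "0 \<le> q" "0 \<le> r" "r \<le> p + q" and d: "p + q = d"
    using i by (auto simp: level_def II_def)
  define F where "F = (\<lambda>j. (k,p,q,j)) ` {0..d}"
  define c where "c i' = (case i' of (k',p',q',j) \<Rightarrow> S j (d-j) r A / (ifact j * ifact (d-j)))" for i' :: idx
  have "E i (A ** Z) = (\<Sum>i'\<in>F. c i' * E i' Z)" for Z
  proof (cases "det Z = 0")
    case True
    then have "det (A ** Z) = 0" by (simp add: det_mul)
    then show ?thesis using True by (simp add: E_sing)
  next
    case False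
    have dA: "det (A ** Z) = det Z" by (simp add: det_mul A)
    have "E i (A ** Z) = (\<Sum>j\<in>{0..d}. S j (d-j) r A / (ifact j * ifact (d-j)) * E (k,p,q,j) Z)"
      unfolding ii using False dA d pos by (simp add: E_unit S_left_mult sum_distrib_left mult_ac)
    also have "\<dots> = (\<Sum>i'\<in>F. c i' * E i' Z)"
      unfolding F_def by (subst sum.reindex) (auto intro: inj_onI simp: c_def)
    finally show ?thesis .
  qed
  moreover have "(\<lambda>Z. \<Sum>i'\<in>F. c i' * E i' Z) \<in> fs.span (E ` level k d)"
    by (rule finite_sum_in_span) (use pos d in \<open>auto simp: F_def level_def II_def\<close>)
  ultimately show ?thesis by simp
qed

lemma E_adj: "E (k,p,q,r) (adj Z) = sg (p + r) * E (k, p+q-r, r, q) Z"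
  by (cases "det Z = 0") (simp_all add: E_sing E_unit S_adj)

text \<open>Conjugation by the adjugate turns left into right multiplication.\<close>
lemma E_adj_span:
  assumes i: "i \<in> level k d"
  shows "(\<lambda>Z. E i (adj Z)) \<in> fs.span (E ` level k d)"
proof -
  obtain p q r where ii: "i = (k,p,q,r)" and pos: "0 \<le> p" "0 \<le> q" "0 \<le> r" "r \<le> p + q" and d: "p + q = d"
    using i by (auto simp: level_def II_def)
  show ?thesis unfolding ii E_adj
    by (intro fs.span_scale fs.span_base imageI) (use pos d in \<open>auto simp: level_def II_def\<close>)
qed

lemma E_right_mult:
  assumes B: "det B = 1" and i: "i \<in> level k d"
  shows "(\<lambda>Z. E i (Z ** B)) \<in> fs.span (E ` level k d)"
proof -
  obtain p q r where ii: "i = (k,p,q,r)" and pos: "0 \<le> p" "0 \<le> q" "0 \<le> r" "r \<le> p + q" and d: "p + q = d"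
    using i by (auto simp: level_def II_def)
  let ?i = "(k, d - r, r, q)"
  have iD: "?i \<in> level k d" using pos d by (auto simp: level_def II_def)
  have e: "E i (Z ** B) = sg (p + r) * E ?i (adj B ** adj Z)" for Z
  proof -
    have "E i (Z ** B) = E i (adj (adj B ** adj Z))" by (simp add: adj_mult)
    then show ?thesis unfolding ii E_adj d .
  qed
  have "(\<lambda>Z. E ?i (adj B ** Z)) \<in> fs.span (E ` level k d)" by (rule E_left_mult[OF _ iD]) (simp add: B)
  from span_translate[OF this E_adj_span]
  have "(\<lambda>Z. E ?i (adj B ** adj Z)) \<in> fs.span (E ` level k d)" .
  then show ?thesis unfolding e by (rule fs.span_scale)
qed

lemma regular_times: "f \<in> regular_functions \<Longrightarrow> g \<in> regular_functions \<Longrightarrow> integrable (dS 1) (\<lambda>X. f X * g X)"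
  by (intro regular_integrable regular_functions.mult) auto

definition level_factor :: "int \<Rightarrow> int \<Rightarrow> int \<Rightarrow> int \<Rightarrow> complex" where
  "level_factor k d k' d' = (if k' = - k - d \<and> d' = d then level_const k d * of_int (d + 1) / complex_of_real (2 * pi\<^sup>2) else 0)"

lemma pairing_integral_E:
  assumes i: "i \<in> level k d" "i \<in> BI" and j: "j \<in> level k' d'" "j \<in> BI"
  shows "pairing (E i) (E j) = level_factor k d k' d' * (\<integral>X. E i X * E j X \<partial>dS 1)"
proof -
  obtain p q r where ii: "i = (k,p,q,r)" and d: "p + q = d" using i by (auto simp: level_def)
  obtain p' q' r' where jj: "j = (k',p',q',r')" and d': "p' + q' = d'" using j by (auto simp: level_def)
  have II: "(k,p,q,r) \<in> II" "(k',p',q',r') \<in> II" using i j BI_II ii jj by auto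
  have "0 \<le> d" using II(1) d by (auto simp: II_def)
  then have nz: "ci (d + 1) \<noteq> 0" by (metis add_nonneg_pos less_irrefl of_int_eq_0_iff zero_less_one)
  have int: "(\<integral>X. E i X * E j X \<partial>dS 1) = (if p' = q \<and> q' = p \<and> r' = p + q - r then complex_of_real (2 * pi\<^sup>2) * wt p q r / ci (d + 1) else 0)"
    unfolding ii jj schur[OF zero_less_one II] d[symmetric] by simp
  have P: "pairing (E i) (E j) = (if k' = - k - d \<and> p' = q \<and> q' = p \<and> r' = p + q - r then level_const k d * wt p q r else 0)"
    unfolding pairing_E[OF i(2) j(2)] by (auto simp: ii jj dual_value_def d[symmetric])
  show ?thesis
  proof (cases "k' = - k - d \<and> p' = q \<and> q' = p \<and> r' = p + q - r")
    case True
    then have "d' = d" using d d' by simp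
    then show ?thesis unfolding P int level_factor_def using True nz by (simp add: field_simps del: of_int_add)
  next
    case False
    then show ?thesis unfolding P int level_factor_def by auto
  qed
qed

lemma level_span_BH:
  assumes "i \<in> level k d" "i \<in> BI" "f \<in> fs.span (E ` level k d)"
  shows "f \<in> BH"
proof -
  have "level k d \<subseteq> BI" using assms(1,2) by (auto simp: level_def BI_def PI_def MI_def)
  then show ?thesis unfolding BH_eq using fs.span_mono[OF image_mono] assms(3) by blast
qed

text \<open>On one level the pairing is proportional to the integral over the unit sphere, whose invariance is
  known.\<close>
lemma pairing_integral:
  assumes i: "i \<in> level k d" "i \<in> BI" and j: "j \<in> level k' d'" "j \<in> BI"
    and f: "f \<in> fs.span (E ` level k d)" and g: "g \<in> fs.span (E ` level k' d')"
  shows "pairing f g = level_factor k d k' d' * (\<integral>X. f X * g X \<partial>dS 1)"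
proof -
  have sub: "level k d \<subseteq> BI" "level k' d' \<subseteq> BI" using i j by (auto simp: level_def BI_def PI_def MI_def)
  have gB: "g \<in> BH" by (rule level_span_BH[OF j g])
  have 1: "pairing (E i) g = level_factor k d k' d' * (\<integral>X. E i X * g X \<partial>dS 1)" if i: "i \<in> level k d" for i
    using g
  proof (induction rule: span_induct_E)
    case zero
    have "E i \<in> BH" using sub i E_BH by blast
    then show ?case by (simp add: bilinear_zero[OF pairing_bilinear])
  next
    case (step c j g)
    have B: "E i \<in> BH" "E j \<in> BH" "g \<in> BH" using sub i step.hyps(1) E_BH level_span_BH[OF assms(3,4) step.hyps(2)] by blast+
    have "(\<integral>X. E i X * (c * E j X + g X) \<partial>dS 1) = (\<integral>X. c * (E i X * E j X) + E i X * g X \<partial>dS 1)"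
      by (simp only: distrib_left mult.left_commute)
    also have "\<dots> = c * (\<integral>X. E i X * E j X \<partial>dS 1) + (\<integral>X. E i X * g X \<partial>dS 1)"
      using regular_times[OF BH_regular[OF B(1)] BH_regular[OF B(2)]] regular_times[OF BH_regular[OF B(1)] BH_regular[OF B(3)]]
      by (subst Bochner_Integration.integral_add) auto
    finally show ?case
      unfolding bilinear_onD(3)[OF pairing_bilinear BH_scale[OF B(2)] B(3,1)] bilinear_onD(4)[OF pairing_bilinear B(2,2,1)]
       step.IH pairing_integral_E[OF i subsetD[OF sub(1) i] step.hyps(1) subsetD[OF sub(2) step.hyps(1)]]
      by (simp add: algebra_simps)
  qed
  show ?thesis
    using f
  proof (induction rule: span_induct_E)
    case zero
    show ?case by (simp add: bilinear_zero[OF pairing_bilinear gB])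
  next
    case (step c j f)
    have B: "E j \<in> BH" "f \<in> BH" using sub step.hyps(1) E_BH level_span_BH[OF assms(1,2) step.hyps(2)] by blast+
    have "(\<integral>X. (c * E j X + f X) * g X \<partial>dS 1) = (\<integral>X. c * (E j X * g X) + f X * g X \<partial>dS 1)"
      by (simp only: distrib_right mult.assoc)
    also have "\<dots> = c * (\<integral>X. E j X * g X \<partial>dS 1) + (\<integral>X. f X * g X \<partial>dS 1)"
      using regular_times[OF BH_regular[OF B(1)] BH_regular[OF gB]] regular_times[OF BH_regular[OF B(2)] BH_regular[OF gB]]
      by (subst Bochner_Integration.integral_add) auto
    finally show ?case
      unfolding bilinear_onD(1)[OF pairing_bilinear BH_scale[OF B(1)] B(2) gB] bilinear_onD(2)[OF pairing_bilinear B(1,1) gB]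
       step.IH 1[OF step.hyps(1)] by (simp add: algebra_simps)
  qed
qed

text \<open>Together with \<open>bilinear_ext\<close> this reduces the invariance of the pairing to pairs of basis functions.\<close>
lemma bilinear_comp:
  assumes T: "\<And>f. f \<in> BH \<Longrightarrow> T f \<in> BH"
    and add: "\<And>f g. f \<in> BH \<Longrightarrow> g \<in> BH \<Longrightarrow> T (\<lambda>Z. f Z + g Z) = (\<lambda>Z. T f Z + T g Z)"
    and scale: "\<And>f c. f \<in> BH \<Longrightarrow> T (\<lambda>Z. c * f Z) = (\<lambda>Z. c * T f Z)"
  shows "bilinear_on BH (\<lambda>f g. pairing (T f) (T g))" "bilinear_on BH (\<lambda>f g. pairing (T f) g + pairing f (T g))"
  unfolding bilinear_on_def
  by (auto simp: add scale bilinear_onD[OF pairing_bilinear] T BH_add BH_scale algebra_simps)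

lemma operator_BH:
  assumes E: "\<And>i. i \<in> BI \<Longrightarrow> T (E i) \<in> BH"
    and add: "\<And>f g. f \<in> BH \<Longrightarrow> g \<in> BH \<Longrightarrow> T (\<lambda>Z. f Z + g Z) = (\<lambda>Z. T f Z + T g Z)"
    and scale: "\<And>f c. f \<in> BH \<Longrightarrow> T (\<lambda>Z. c * f Z) = (\<lambda>Z. c * T f Z)" and f: "f \<in> BH"
  shows "T f \<in> BH"
  using f unfolding BH_eq
proof (induction rule: span_induct_E)
  case zero
  have "T (\<lambda>Z. 0 * 0) = (\<lambda>Z. 0 * T (\<lambda>Z. 0) Z)" by (rule scale[OF BH_zero])
  then show ?case using span_zero'[of "E ` BI"] by simp
next
  case (step c i g)
  have B: "E i \<in> BH" "g \<in> BH" "T g \<in> BH" using step E_BH by (auto simp: BH_eq)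
  have "T (\<lambda>Z. c * E i Z + g Z) = (\<lambda>Z. c * T (E i) Z + T g Z)"
    unfolding add[OF BH_scale[OF B(1)] B(2)] scale[OF B(1)] ..
  then show ?case using BH_add[OF BH_scale[OF E[OF step.hyps(1)]] B(3)] by (simp add: BH_eq)
qed

lemma matrix_inv_eqI:
  fixes A :: "complex^'n^'n"
  assumes "A ** B = mat 1" "B ** A = mat 1" shows "matrix_inv A = B"
proof -
  have "\<exists>A'. A ** A' = mat 1 \<and> A' ** A = mat 1" using assms by blast
  then have "A ** matrix_inv A = mat 1 \<and> matrix_inv A ** A = mat 1" unfolding matrix_inv_def by (rule someI_ex)
  then show ?thesis using assms by (metis matrix_mul_assoc matrix_mul_lid matrix_mul_rid)
qed

lemma sum_UNIV_sum: "(\<Sum>x\<in>(UNIV :: ('a::finite + 'b::finite) set). f x) = (\<Sum>x\<in>UNIV. f (Inl x)) + (\<Sum>x\<in>UNIV. f (Inr x))"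
proof -
  show ?thesis using sum.Plus[of "UNIV :: 'a set" "UNIV :: 'b set" f] by (simp add: comp_def)
qed

lemma blocks_entries [simp]:
  "blocks a b c d $ Inl p $ Inl q = a $ p $ q" "blocks a b c d $ Inl p $ Inr q = b $ p $ q"
  "blocks a b c d $ Inr p $ Inl q = c $ p $ q" "blocks a b c d $ Inr p $ Inr q = d $ p $ q"
  by (simp_all add: blocks_def)

lemma HC22_eqI:
  "block_a h = block_a h' \<Longrightarrow> block_b h = block_b h' \<Longrightarrow> block_c h = block_c h' \<Longrightarrow> block_d h = block_d h' \<Longrightarrow> h = h'"
  unfolding vec_eq_iff block_a_def block_b_def block_c_def block_d_def
  by (auto simp: split_sum_all)

lemma block_blocks [simp]: "block_a (blocks a b c d) = a" "block_b (blocks a b c d) = b"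
  "block_c (blocks a b c d) = c" "block_d (blocks a b c d) = d"
  by (simp_all add: vec_eq_iff block_a_def block_b_def block_c_def block_d_def)

lemma block_mult:
  "block_a (A ** B) = block_a A ** block_a B + block_b A ** block_c B"
  "block_b (A ** B) = block_a A ** block_b B + block_b A ** block_d B"
  "block_c (A ** B) = block_c A ** block_a B + block_d A ** block_c B"
  "block_d (A ** B) = block_c A ** block_b B + block_d A ** block_d B"
  by (simp_all add: vec_eq_iff block_a_def block_b_def block_c_def block_d_def matrix_matrix_mult_def sum_UNIV_sum)

lemma block_mat1: "block_a (mat 1) = mat 1" "block_b (mat 1) = 0" "block_c (mat 1) = 0" "block_d (mat 1) = mat 1"
  by (simp_all add: vec_eq_iff block_a_def block_b_def block_c_def block_d_def mat_def)

lemma rho_diag: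
  assumes a: "a ** a' = mat 1" "a' ** a = mat 1" and d: "det d = 1" and f: "\<And>Z. det Z = 0 \<Longrightarrow> f Z = 0"
  shows "rho (blocks a 0 0 d) f = (\<lambda>Z. f (a' ** Z ** d))"
proof
  fix Z
  have dd: "d ** adj d = mat 1" "adj d ** d = mat 1"
    using d by (auto intro!: matrix_entries_eqI simp: mult_2_entry mat_def det_2 algebra_simps)
  have inv: "matrix_inv (blocks a 0 0 d) = blocks a' 0 0 (adj d)"
    by (rule matrix_inv_eqI; rule HC22_eqI) (simp_all add: block_mult block_mat1 a dd)
  have "matrix_inv (adj d) = d" by (rule matrix_inv_eqI) (simp_all add: dd)
  then have "rho (blocks a 0 0 d) f Z = (if det Z = 0 then 0 else f (a' ** Z ** d))"
    using d by (simp add: rho_def inv on_units_def)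
  then show "rho (blocks a 0 0 d) f Z = f (a' ** Z ** d)" using f[of "a' ** Z ** d"] by (simp add: det_mul)
qed

lemma quat_adj: "adj (quat x) = quat (qinv (adj (quat x)))"
  by (rule matrix_entries_eqI) (auto simp: complex_eq_iff)

lemma HR_unit:
  assumes "a \<in> HR" "det a = 1" obtains u where "a = quat u" "norm u = 1"
proof -
  obtain u where u: "a = quat u" using assms by (auto simp: HR_def)
  then have "complex_of_real ((norm u)\<^sup>2) = complex_of_real 1" using assms det_quat[of u] by simp
  then have "(norm u)\<^sup>2 = 1" unfolding of_real_eq_iff .
  then have "norm u = 1" by (metis norm_ge_zero power2_eq_1_iff not_one_le_zero one_neq_neg_one order_trans neg_0_le_iff_le)
  with u show ?thesis by (rule that)
qed

text \<open>Translations preserve the levels, so both sides are the same multiple of integrals that agree by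
  invariance of \<open>dS\<close>.\<close>
lemma SU2_translate_invariance:
  assumes u: "norm u = 1" "norm v = 1"
  defines "T \<equiv> \<lambda>f Z. f (quat u ** Z ** quat v)"
  shows "f \<in> BH \<Longrightarrow> T f \<in> BH" "f \<in> BH \<Longrightarrow> g \<in> BH \<Longrightarrow> pairing (T f) (T g) = pairing f g"
proof -
  have du: "det (quat u) = 1" "det (quat v) = 1" using u by (simp_all add: det_quat)
  have TE: "T (E i) \<in> fs.span (E ` level k d)" if "i \<in> level k d" for i k d
  proof -
    have "(\<lambda>Z. E i (Z ** quat v)) \<in> fs.span (E ` level k d)" by (rule E_right_mult[OF du(2) that])
    from span_translate[OF this E_left_mult[OF du(1)]] show ?thesis by (simp add: T_def)
  qed
  have inD: "i \<in> level (fst i) (fst (snd i) + fst (snd (snd i)))" if "i \<in> BI" for i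
    using that BI_II by (cases i) (auto simp: level_def)
  have TE_BH: "T (E i) \<in> BH" if "i \<in> BI" for i
    by (rule level_span_BH[OF inD[OF that] that TE[OF inD[OF that]]])
  have add: "T (\<lambda>Z. f Z + g Z) = (\<lambda>Z. T f Z + T g Z)" and scale: "T (\<lambda>Z. c * f Z) = (\<lambda>Z. c * T f Z)" for f g c by (simp_all add: T_def)
  show T: "T f \<in> BH" if "f \<in> BH" for f by (rule operator_BH[of T, OF TE_BH add scale that])
  assume f: "f \<in> BH" and g: "g \<in> BH"
  show "pairing (T f) (T g) = pairing f g"
  proof (rule bilinear_ext[OF bilinear_comp(1)[of T, OF T add scale] pairing_bilinear _ f g])
    fix i j assume i: "i \<in> BI" and j: "j \<in> BI"
    have reg: "(\<lambda>X. E i X * E j X) \<in> regular_functions" by (rule EE_regular)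
    have reg': "(\<lambda>X. E i (X ** quat v) * E j (X ** quat v)) \<in> regular_functions"
      by (intro regular_functions.mult span_regular[OF E_right_mult[OF du(2) inD]] i j)
    have "(\<integral>X. T (E i) X * T (E j) X \<partial>dS 1) = (\<integral>X. E i X * E j X \<partial>dS 1)"
      using integral_dS_quat_mult(1)[OF zero_less_one u(1) reg'] integral_dS_quat_mult(2)[OF zero_less_one u(2) reg]
      by (simp add: T_def)
    then show "pairing (T (E i)) (T (E j)) = pairing (E i) (E j)"
      unfolding pairing_integral[OF inD[OF i] i inD[OF j] j TE[OF inD[OF i]] TE[OF inD[OF j]]] pairing_integral_E[OF inD[OF i] i inD[OF j] j] by simp
  qed
qed

lemma SU2_invariance:
  assumes h: "h \<in> SU2_SU2"
  shows "f \<in> BH \<Longrightarrow> rho h f \<in> BH" "f \<in> BH \<Longrightarrow> g \<in> BH \<Longrightarrow> pairing (rho h f) (rho h g) = pairing f g"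
proof -
  obtain a d where h: "h = blocks a 0 0 d" "a \<in> HR" "d \<in> HR" "det a = 1" "det d = 1" using h by (auto simp: SU2_SU2_def)
  obtain x where x: "a = quat x" "norm x = 1" by (rule HR_unit[OF h(2,4)])
  obtain v where v: "d = quat v" "norm v = 1" by (rule HR_unit[OF h(3,5)])
  define u where "u = qinv (adj (quat x))"
  have au: "adj a = quat u" unfolding u_def x by (rule quat_adj)
  have "complex_of_real ((norm u)\<^sup>2) = 1" unfolding det_quat[symmetric] au[symmetric] by (simp add: h)
  then have "(norm u)\<^sup>2 = 1" by (metis of_real_eq_1_iff)
  then have u: "norm u = 1" by (metis norm_ge_zero power2_eq_1_iff not_one_le_zero one_neq_neg_one order_trans neg_0_le_iff_le)
  have aa: "a ** quat u = mat 1" "quat u ** a = mat 1" unfolding au[symmetric]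
    using h(4) by (auto intro!: matrix_entries_eqI simp: mult_2_entry mat_def det_2 algebra_simps)
  have rho: "rho h f = (\<lambda>Z. f (quat u ** Z ** quat v))" if "f \<in> BH" for f
    unfolding h(1) v(1)[symmetric] by (rule rho_diag[OF aa h(5)]) (rule regular_sing[OF BH_regular[OF that]])
  show "f \<in> BH \<Longrightarrow> rho h f \<in> BH" using SU2_translate_invariance(1)[OF u v(2)] by (simp add: rho)
  show "f \<in> BH \<Longrightarrow> g \<in> BH \<Longrightarrow> pairing (rho h f) (rho h g) = pairing f g"
    using SU2_translate_invariance(2)[OF u v(2)] by (simp add: rho)
qed

section \<open>Invariance under the inversion\<close>

lemma rho_inversion: "rho inversion f = on_units (\<lambda>Z. f (matrix_inv Z))"
proof -
  have "matrix_inv inversion = inversion"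
    unfolding inversion_def by (rule matrix_inv_eqI; rule HC22_eqI) (simp_all add: block_mult block_mat1)
  then show ?thesis unfolding rho_def by (simp add: inversion_def on_units_def fun_eq_iff)
qed

text \<open>The index of \<open>E (k,p,q,r)\<close> composed with the inversion, up to sign.\<close>
definition inversion_ix :: "idx \<Rightarrow> idx" where "inversion_ix i = (case i of (k,p,q,r) \<Rightarrow> (- k - p - q, p + q - r, r, q))"

lemma inversion_ix_facts: "inversion_ix (inversion_ix i) = i" "dual (inversion_ix i) = inversion_ix (dual i)" "i \<in> BI \<Longrightarrow> inversion_ix i \<in> BI"
  by (cases i; auto simp: inversion_ix_def BI_def PI_def MI_def II_def)+

lemma rho_inversion_E: "rho inversion (E (k,p,q,r)) = (\<lambda>Z. sg (p + r) * E (inversion_ix (k,p,q,r)) Z)"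
proof
  fix Z
  show "rho inversion (E (k,p,q,r)) Z = sg (p + r) * E (inversion_ix (k,p,q,r)) Z"
  proof (cases "det Z = 0")
    case True
    then show ?thesis by (simp add: rho_inversion on_units_def E_sing)
  next
    case False
    have "Z ** matrix_inv Z = mat 1"
    proof -
      have "Z ** adj Z = smul (det Z) (mat 1)"
        by (rule matrix_entries_eqI; simp add: mult_2_entry mat_def det_2 algebra_simps)
      moreover have "smul (inverse (det Z)) (smul (det Z) (mat 1)) = mat 1"
        using False by (intro matrix_entries_eqI) (auto simp: mat_def)
      ultimately show ?thesis unfolding det_nz_inverse[OF False] by (simp only: smul_mult)
    qed
    then have "det Z * det (matrix_inv Z) = 1" by (metis det_mul det_I)
    then have di: "det (matrix_inv Z) = inverse (det Z)" using False by (simp add: field_simps)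
    have "det Z powi (- k - p - q) = det Z powi (- k) * det Z powi (- p - q)"
      using False power_int_add[of "det Z" "- k" "- p - q"] by (simp add: algebra_simps)
    moreover have "det (matrix_inv Z) powi k = det Z powi (- k)" unfolding di by (simp add: power_int_inverse power_int_minus)
    ultimately show ?thesis
      using False di by (simp add: rho_inversion on_units_def E_unit inversion_ix_def S_inverse mult_ac)
  qed
qed

text \<open>The inversion permutes the basis up to signs, commutes with \<open>dual\<close> and preserves \<open>dual_value\<close>; the signs of
  an index and of its dual agree.\<close>
lemma inversion_invariance:
  shows "f \<in> BH \<Longrightarrow> rho inversion f \<in> BH"
    "f \<in> BH \<Longrightarrow> g \<in> BH \<Longrightarrow> pairing (rho inversion f) (rho inversion g) = pairing f g"
proof -
  let ?T = "rho inversion"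
  have add: "?T (\<lambda>Z. f Z + g Z) = (\<lambda>Z. ?T f Z + ?T g Z)" and scale: "?T (\<lambda>Z. c * f Z) = (\<lambda>Z. c * ?T f Z)" for f g c
    by (simp_all add: rho_inversion on_units_def fun_eq_iff)
  have TE: "?T (E i) \<in> BH" if "i \<in> BI" for i
    using inversion_ix_facts(3)[OF that] by (cases i) (simp add: rho_inversion_E BH_scale E_BH)
  show T: "?T f \<in> BH" if "f \<in> BH" for f by (rule operator_BH[of ?T, OF TE add scale that])
  assume f: "f \<in> BH" and g: "g \<in> BH"
  show "pairing (?T f) (?T g) = pairing f g"
  proof (rule bilinear_ext[OF bilinear_comp(1)[of ?T, OF T add scale] pairing_bilinear _ f g])
    fix i j assume i: "i \<in> BI" and j: "j \<in> BI"
    obtain k p q r where ii: "i = (k,p,q,r)" by (cases i)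
    obtain k' p' q' r' where jj: "j = (k',p',q',r')" by (cases j)
    have I: "inversion_ix i \<in> BI" "inversion_ix j \<in> BI" using i j inversion_ix_facts by auto
    have 1: "pairing (?T (E i)) (?T (E j)) = sg (p + r) * (sg (p' + r') * pairing (E (inversion_ix i)) (E (inversion_ix j)))"
      unfolding ii jj rho_inversion_E
      using bilinear_onD(2)[OF pairing_bilinear E_BH[OF I(1)] BH_zero] bilinear_onD(4)[OF pairing_bilinear E_BH[OF I(2)] BH_zero]
        BH_scale E_BH[OF I(1)] E_BH[OF I(2)] by (simp add: ii jj)
    have 2: "inversion_ix j = dual (inversion_ix i) \<longleftrightarrow> j = dual i" unfolding inversion_ix_facts(2) by (metis inversion_ix_facts(1))
    have 3: "dual_value (inversion_ix i) = dual_value i"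
    proof -
      have "level_const (- k - p - q) (p + q) = level_const k (p + q)" by (auto simp: level_const_def)
      moreover have "wt (p + q - r) r q = wt p q r" by (simp add: wt_def sg_add sg_diff sg_def)
      ultimately show ?thesis by (simp add: dual_value_def inversion_ix_def ii)
    qed
    have 4: "j = dual i \<Longrightarrow> sg (p + r) * sg (p' + r') = 1" by (simp add: ii jj sg_def)
    show "pairing (?T (E i)) (?T (E j)) = pairing (E i) (E j)"
      unfolding 1 pairing_E[OF I] pairing_E[OF i j] 2 3 using 4 by (simp add: mult.assoc[symmetric])
  qed
qed

section \<open>Skew symmetry of the generators of the Lie algebra\<close>

text \<open>The changes of \<open>wt\<close> under the index shifts of translations and special conformal generators; the next
  lemma treats those of left and right multiplication.\<close>
lemma wt_q: "ci (p+q-r+1) * ci (q+1) * wt p (q+1) r = wt p q r"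
  and wt_p: "ci (p+q-r+1) * ci (p+1) * wt (p+1) q r = - wt p q r"
  and wt_qr: "ci (r+1) * ci (q+1) * wt p (q+1) (r+1) = - wt p q r"
  and wt_pr: "ci (r+1) * ci (p+1) * wt (p+1) q (r+1) = wt p q r"
proof -
  have sq: "sg (p + (r + 1)) = - sg (p + r)" "sg (p + 1 + r) = - sg (p + r)" "sg (p + 1 + (r + 1)) = sg (p + r)"
    by (auto simp: sg_def)
  have e: "p + (q + 1) - r = p+q-r+1" "p + 1 + q - r = p+q-r+1" "p + (q + 1) - (r + 1) = p + q - r" "p + 1 + q - (r + 1) = p + q - r" by simp_all
  note r = ifact_rec[of p, symmetric] ifact_rec[of q, symmetric] ifact_rec[of r, symmetric] ifact_rec[of "p+q-r", symmetric]
  show "ci (p+q-r+1) * ci (q+1) * wt p (q+1) r = wt p q r"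
    unfolding wt_def e r(2) r(4) by (simp only: mult_ac)
  show "ci (p+q-r+1) * ci (p+1) * wt (p+1) q r = - wt p q r"
    unfolding wt_def e sq r(1) r(4) by (simp only: mult_ac mult_minus_left mult_minus_right)
  show "ci (r+1) * ci (q+1) * wt p (q+1) (r+1) = - wt p q r"
    unfolding wt_def e sq r(2) r(3) by (simp only: mult_ac mult_minus_left mult_minus_right)
  show "ci (r+1) * ci (p+1) * wt (p+1) q (r+1) = wt p q r"
    unfolding wt_def e sq r(1) r(3) by (simp only: mult_ac)
qed

lemma wt_r: "ci (r+1) * wt p q (r+1) = - ci (p+q-r) * wt p q r"
  and wt_pq: "ci (p+1) * wt (p+1) (q-1) r = - ci q * wt p q r"
proof -
  have sq: "sg (p + (r + 1)) = - sg (p + r)" "sg (p + 1 + r) = - sg (p + r)" by (auto simp: sg_def)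
  have e: "p + q - (r + 1) = p+q-r-1" "p + 1 + (q - 1) - r = p + q - r" by simp_all
  have 1: "ci (r+1) * ifact (r+1) = ifact r" "ci (p+q-r) * ifact (p+q-r) = ifact (p+q-r-1)"
    "ci (p+1) * ifact (p+1) = ifact p" "ci q * ifact q = ifact (q-1)" by (rule ifact_rec ifact_rec')+
  show "ci (r+1) * wt p q (r+1) = - ci (p+q-r) * wt p q r"
    unfolding wt_def e sq 1(2)[symmetric] 1(1)[symmetric] by (simp only: mult_ac mult_minus_left mult_minus_right)
  show "ci (p+1) * wt (p+1) (q-1) r = - ci q * wt p q r"
    unfolding wt_def e sq 1(4)[symmetric] 1(3)[symmetric] by (simp only: mult_ac mult_minus_left mult_minus_right)
qed

definition BH_exponent :: "int \<Rightarrow> int \<Rightarrow> bool" where "BH_exponent k d \<longleftrightarrow> k = 0 \<or> k = 1 \<or> k = - d \<or> k = - d - 1"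

lemma BI_iff: "(k,p,q,r) \<in> BI \<longleftrightarrow> 0 \<le> p \<and> 0 \<le> q \<and> 0 \<le> r \<and> r \<le> p + q \<and> BH_exponent k (p + q)"
  by (auto simp: BI_def PI_def MI_def II_def BH_exponent_def)

lemma level_const_values: "level_const 0 d = ci d" "level_const (- d) d = ci d" "0 \<le> d \<Longrightarrow> level_const 1 d = - ci (d + 2)" "0 \<le> d \<Longrightarrow> level_const (- d - 1) d = - ci (d + 2)"
  by (auto simp: level_const_def)

text \<open>This identity is the invariance under translations. A translation changes \<open>(k,d)\<close> to \<open>(k-1,d+1)\<close> or to
  \<open>(k,d-1)\<close>; on the dual index these two moves are exchanged, and the two coefficients must cancel.\<close>
lemma level_const_trans:
  assumes d: "0 \<le> d" and k: "BH_exponent k d" "BH_exponent (k - 1) (d + 1)"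
  shows "ci k / ci (d + 1) * level_const (k - 1) (d + 1) + ci (2 - k) / ci (d + 2) * level_const k d = 0"
proof -
  have nz: "ci (d + 1) \<noteq> 0" "ci (d + 2) \<noteq> 0" unfolding of_int_eq_0_iff using d by linarith+
  have "k = 0 \<and> d = 0 \<or> k = 1 \<or> k = - d \<or> k = - d - 1" using d k unfolding BH_exponent_def by presburger
  then consider "k = 0" "d = 0" | "k = 1" | "k = - d" | "k = - d - 1" by blast
  then show ?thesis
  proof cases
    case 1
    then show ?thesis by (simp add: level_const_def)
  next
    case 2
    have "level_const (k - 1) (d + 1) = ci (d + 1)" "level_const k d = - ci (d + 2)" unfolding 2 using level_const_values(1)[of "d+1"] level_const_values(3)[OF d] by simp_all
    moreover have "2 - k = 1" using 2 by simp
    ultimately show ?thesis using nz 2 by (simp del: of_int_add)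
  next
    case 3
    have "level_const (- d - 1) (d + 1) = ci (d + 1)" using level_const_values(2)[of "d + 1"] by simp
    then have e: "level_const (k - 1) (d + 1) = ci (d + 1)" "level_const k d = ci d" "2 - k = d + 2" unfolding 3 using level_const_values(2)[of d] by simp_all
    have "ci k = - ci d" unfolding 3 by (rule of_int_minus)
    then show ?thesis unfolding e using nz by (simp del: of_int_add)
  next
    case 4
    have "level_const (- d - 1 - 1) (d + 1) = - ci (d + 3)" using level_const_values(4)[of "d + 1"] d by simp
    then have e: "level_const (k - 1) (d + 1) = - ci (d + 3)" "level_const k d = - ci (d + 2)" "2 - k = d + 3" "k = - (d + 1)" unfolding 4 using level_const_values(4)[OF d] by simp_all
    have "ci k = - ci (d + 1)" unfolding e(4) by (rule of_int_minus)
    then show ?thesis unfolding e(1-3) using nz by (simp del: of_int_add)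
  qed
qed

text \<open>The mirror image of \<open>level_const_trans\<close> under the inversion, for the special conformal generators.\<close>
lemma level_const_spec:
  assumes d: "0 \<le> d" and k: "BH_exponent k d" "BH_exponent k (d + 1)"
  shows "ci (k + d) / ci (d + 1) * level_const k (d + 1) + ci (- k - d - 2) / ci (d + 2) * level_const k d = 0"
proof -
  have nz: "ci (d + 1) \<noteq> 0" "ci (d + 2) \<noteq> 0" unfolding of_int_eq_0_iff using d by linarith+
  have "k = 0 \<or> k = 1 \<or> k = - d - 1" using d k unfolding BH_exponent_def by presburger
  then consider "k = 0" | "k = 1" | "k = - d - 1" by blast
  then show ?thesis
  proof cases
    case 1
    have e: "level_const k (d + 1) = ci (d + 1)" "level_const k d = ci d" "k + d = d" "- k - d - 2 = - (d + 2)" unfolding 1 by (simp_all add: level_const_values)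
    show ?thesis unfolding e of_int_minus using nz by (simp del: of_int_add)
  next
    case 2
    have "level_const 1 (d + 1) = - ci (d + 3)" using level_const_values(3)[of "d + 1"] d by simp
    then have e: "level_const k (d + 1) = - ci (d + 3)" "level_const k d = - ci (d + 2)" "k + d = d + 1" "- k - d - 2 = - (d + 3)" unfolding 2 using level_const_values(3)[OF d] by simp_all
    show ?thesis unfolding e of_int_minus using nz by (simp del: of_int_add)
  next
    case 3
    have "level_const (- d - 1) (d + 1) = ci (d + 1)" using level_const_values(2)[of "d + 1"] by simp
    then have e: "level_const k (d + 1) = ci (d + 1)" "level_const k d = - ci (d + 2)" "k + d = - 1" "- k - d - 2 = - 1" unfolding 3 using level_const_values(4)[OF d] by simp_all
    show ?thesis unfolding e of_int_minus using nz by (simp del: of_int_add)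
  qed
qed

text \<open>The pairing on formal combinations. It makes sense for indices outside \<open>BI\<close>, so the skew symmetry can be
  computed before membership in \<open>BH\<close> is discussed.\<close>
definition dual_form :: "idx \<Rightarrow> idx \<Rightarrow> complex" where "dual_form i j = (if j = dual i then dual_value i else 0)"

definition dual_form_lin :: "(complex \<times> idx) list \<Rightarrow> idx \<Rightarrow> complex" where "dual_form_lin xs j = (\<Sum>x\<leftarrow>xs. fst x * dual_form (snd x) j)"

text \<open>A term may be dropped when its coefficient is zero or its function vanishes identically.\<close>
definition lands_in_BH :: "(complex \<times> idx) list \<Rightarrow> bool" where
  "lands_in_BH xs \<longleftrightarrow> (\<forall>(c, i) \<in> set xs. c = 0 \<or> i \<in> BI \<or> i \<notin> II)"

lemma lands_in_BH_append [simp]: "lands_in_BH (xs @ ys) \<longleftrightarrow> lands_in_BH xs \<and> lands_in_BH ys" by (auto simp: lands_in_BH_def)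
lemma dual_form_lin_append [simp]: "dual_form_lin (xs @ ys) j = dual_form_lin xs j + dual_form_lin ys j" by (simp add: dual_form_lin_def)

lemma lands_in_BH_lin_BH: "lands_in_BH xs \<Longrightarrow> lin xs \<in> BH"
  unfolding BH_eq by (rule lin_in_span) (use E_outside in \<open>auto simp: lands_in_BH_def\<close>)

lemma pairing_lin: "lands_in_BH xs \<Longrightarrow> j \<in> BI \<Longrightarrow> pairing (lin xs) (E j) = dual_form_lin xs j"
proof (induction xs)
  case Nil
  then show ?case using bilinear_zero[OF pairing_bilinear E_BH] by (simp add: dual_form_lin_def)
next
  case (Cons x xs)
  obtain c i where x: "x = (c,i)" by (cases x)
  have lands_in_BH: "lands_in_BH xs" "c = 0 \<or> i \<in> BI \<or> i \<notin> II" using Cons.prems(1) x by (auto simp: lands_in_BH_def)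
  have xsB: "lin xs \<in> BH" by (rule lands_in_BH_lin_BH[OF lands_in_BH(1)])
  have Ej: "E j \<in> BH" by (rule E_BH[OF Cons.prems(2)])
  have iB: "(\<lambda>Z. c * E i Z) \<in> BH \<and> pairing (\<lambda>Z. c * E i Z) (E j) = c * dual_form i j"
    using lands_in_BH(2)
  proof (elim disjE)
    assume "c = 0"
    then show ?thesis using BH_zero bilinear_zero[OF pairing_bilinear Ej] by simp
  next
    assume i: "i \<in> BI"
    then show ?thesis using BH_scale[OF E_BH[OF i]] bilinear_onD(2)[OF pairing_bilinear E_BH[OF i] BH_zero Ej] pairing_E[OF i Cons.prems(2)]
      by (simp add: dual_form_def)
  next
    assume i: "i \<notin> II"
    have "j \<noteq> dual i" using Cons.prems(2) BI_II i dual_II[of "dual i"] by auto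
    then show ?thesis using E_outside[OF i] BH_zero bilinear_zero[OF pairing_bilinear Ej] by (simp add: dual_form_def)
  qed
  have "pairing (lin (x # xs)) (E j) = pairing (\<lambda>Z. c * E i Z) (E j) + pairing (lin xs) (E j)"
    unfolding lin_Cons x fst_conv snd_conv by (rule bilinear_onD(1)[OF pairing_bilinear _ xsB Ej]) (use iB in blast)
  then show ?case using iB Cons.IH[OF lands_in_BH(1) Cons.prems(2)] by (simp add: dual_form_lin_def x)
qed

text \<open>If \<open>j\<close> is not dual to \<open>i1 i\<close> both terms vanish; otherwise the claim is the numerical identity.\<close>
lemma two_term:
  assumes i1: "\<And>i. i2 (dual (i1 i)) = dual i" and i2: "\<And>j. i1 (dual (i2 j)) = dual j"
    and num: "dual (i1 i) \<in> BI \<Longrightarrow> c1 i * dual_value (i1 i) + c2 (dual (i1 i)) * dual_value i = 0"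
    and j: "j \<in> BI"
  shows "c1 i * dual_form (i1 i) j + c2 j * dual_form (i2 j) i = (0::complex)"
proof (cases "j = dual (i1 i)")
  case True
  then have "i2 j = dual i" using i1 by simp
  then have "dual_form (i2 j) i = dual_value i" by (simp add: dual_form_def dual_value_dual)
  then show ?thesis using num j True by (simp add: dual_form_def)
next
  case False
  have "i \<noteq> dual (i2 j)"
  proof
    assume "i = dual (i2 j)"
    then have "i1 i = dual j" using i2 by simp
    then show False using False by simp
  qed
  then show ?thesis using False by (simp add: dual_form_def)
qed

text \<open>The four matrix units differ only by the shifts \<open>s\<close>, \<open>u\<close> and a sign, and the coefficient \<open>w\<close> is chosen so
  that the change of \<open>wt\<close> is this sign. What remains is \<open>level_const_trans\<close>.\<close>
lemma trans_invariant_aux: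
  assumes i: "i \<in> BI" and j: "j \<in> BI"
    and i1: "\<And>k p q r. i1 (k,p,q,r) = (k - 1, p + s, q + (1 - s), r + u)"
    and i2: "\<And>k p q r. i2 (k,p,q,r) = (k, p - (1 - s), q - s, r - (1 - u))"
    and c1: "\<And>k p q r. c1 (k,p,q,r) = \<epsilon> * ci k * w p q r / ci (p + q + 1)"
    and c2: "\<And>k p q r. c2 (k,p,q,r) = ci (k + p + q + 1) / ci (p + q + 1)"
    and w: "\<And>p q r. w p q r * wt (p + s) (q + (1 - s)) (r + u) = \<epsilon> * wt p q r" and \<epsilon>: "\<epsilon> * \<epsilon> = 1"
  shows "c1 i * dual_form (i1 i) j + c2 j * dual_form (i2 j) i = 0"
proof (rule two_term[OF _ _ _ j])
  fix i show "i2 (dual (i1 i)) = dual i" by (cases i) (simp add: i1 i2)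
  show "i1 (dual (i2 i)) = dual i" by (cases i) (simp add: i1 i2)
next
  assume D: "dual (i1 i) \<in> BI"
  obtain k p q r where ii: "i = (k,p,q,r)" by (cases i)
  have pos: "0 \<le> p + q" "BH_exponent k (p + q)" using i by (auto simp: ii BI_iff)
  have D': "dual (i1 i) = (- k - p - q, q + (1 - s), p + s, p + q + 1 - (r + u))" by (simp add: ii i1)
  have "- k - p - q = - (k - 1) - (p + q + 1)" by simp
  then have "BH_exponent (- (k - 1) - (p + q + 1)) (p + q + 1)" using D unfolding D' BI_iff by (simp add: algebra_simps)
  then have k': "BH_exponent (k - 1) (p + q + 1)" by (auto simp: BH_exponent_def)
  have dim: "p + s + (q + (1 - s)) = p + q + 1" by simp
  have "c1 i * dual_value (i1 i) = \<epsilon> * (ci k / ci (p + q + 1) * level_const (k - 1) (p + q + 1)) * (w p q r * wt (p + s) (q + (1 - s)) (r + u))"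
    unfolding ii i1 c1 dual_value_def prod.case dim by (simp only: times_divide_eq_left times_divide_eq_right mult_ac)
  also have "\<dots> = (\<epsilon> * \<epsilon>) * (ci k / ci (p + q + 1) * level_const (k - 1) (p + q + 1) * wt p q r)" unfolding w by (simp only: mult_ac)
  finally have 1: "c1 i * dual_value (i1 i) = ci k / ci (p + q + 1) * level_const (k - 1) (p + q + 1) * wt p q r" unfolding \<epsilon> by simp
  have "- k - p - q + (q + (1 - s)) + (p + s) + 1 = 2 - k" "q + (1 - s) + (p + s) + 1 = p + q + 2" by simp_all
  then have "c2 (dual (i1 i)) = ci (2 - k) / ci (p + q + 2)" unfolding D' c2 by (simp only:)
  then have 2: "c2 (dual (i1 i)) * dual_value i = ci (2 - k) / ci (p + q + 2) * level_const k (p + q) * wt p q r" by (simp add: ii dual_value_def)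
  show "c1 i * dual_value (i1 i) + c2 (dual (i1 i)) * dual_value i = 0"
    unfolding 1 2 using level_const_trans[OF pos k'] by (simp only: distrib_right[symmetric] mult_zero_left)
qed

lemma spec_invariant_aux:
  assumes i: "i \<in> BI" and j: "j \<in> BI"
    and i1: "\<And>k p q r. i1 (k,p,q,r) = (k, p + s, q + (1 - s), r + u)"
    and i2: "\<And>k p q r. i2 (k,p,q,r) = (k + 1, p - (1 - s), q - s, r - (1 - u))"
    and c1: "\<And>k p q r. c1 (k,p,q,r) = ci (k + p + q) * w p q r / ci (p + q + 1)"
    and c2: "\<And>k p q r. c2 (k,p,q,r) = \<epsilon> * ci (k - 1) / ci (p + q + 1)"
    and w: "\<And>p q r. w p q r * wt (p + s) (q + (1 - s)) (r + u) = \<epsilon> * wt p q r"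
  shows "c1 i * dual_form (i1 i) j + c2 j * dual_form (i2 j) i = 0"
proof (rule two_term[OF _ _ _ j])
  fix i show "i2 (dual (i1 i)) = dual i" by (cases i) (simp add: i1 i2)
  show "i1 (dual (i2 i)) = dual i" by (cases i) (simp add: i1 i2)
next
  assume D: "dual (i1 i) \<in> BI"
  obtain k p q r where ii: "i = (k,p,q,r)" by (cases i)
  have pos: "0 \<le> p + q" "BH_exponent k (p + q)" using i by (auto simp: ii BI_iff)
  have D': "dual (i1 i) = (- k - p - q - 1, q + (1 - s), p + s, p + q + 1 - (r + u))" by (simp add: ii i1)
  have "BH_exponent (- k - p - q - 1) (p + q + 1)" using D unfolding D' BI_iff by (simp add: algebra_simps)
  then have k': "BH_exponent k (p + q + 1)" by (auto simp: BH_exponent_def)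
  have dim: "p + s + (q + (1 - s)) = p + q + 1" by simp
  have "c1 i * dual_value (i1 i) = (ci (k + p + q) / ci (p + q + 1) * level_const k (p + q + 1)) * (w p q r * wt (p + s) (q + (1 - s)) (r + u))"
    unfolding ii i1 c1 dual_value_def prod.case dim by (simp only: times_divide_eq_left times_divide_eq_right mult_ac)
  also have "\<dots> = \<epsilon> * wt p q r * (ci (k + (p + q)) / ci (p + q + 1) * level_const k (p + q + 1))" unfolding w by (simp only: mult_ac add.assoc)
  finally have 1: "c1 i * dual_value (i1 i) = \<epsilon> * wt p q r * (ci (k + (p + q)) / ci (p + q + 1) * level_const k (p + q + 1))" .
  have "- k - p - q - 1 - 1 = - k - (p + q) - 2" "q + (1 - s) + (p + s) + 1 = p + q + 2" by simp_all
  then have "c2 (dual (i1 i)) = \<epsilon> * ci (- k - (p + q) - 2) / ci (p + q + 2)" unfolding D' c2 by (simp only:)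
  then have 2: "c2 (dual (i1 i)) * dual_value i = \<epsilon> * wt p q r * (ci (- k - (p + q) - 2) / ci (p + q + 2) * level_const k (p + q))" by (simp add: ii dual_value_def)
  show "c1 i * dual_value (i1 i) + c2 (dual (i1 i)) * dual_value i = 0"
    unfolding 1 2 using level_const_spec[OF pos k'] by (simp only: distrib_left[symmetric] mult_zero_right)
qed

text \<open>This property passes to sums and scalar multiples, so that it suffices to establish it for matrix units.\<close>
definition invariant :: "(idx \<Rightarrow> (complex \<times> idx) list) \<Rightarrow> bool" where
  "invariant op \<longleftrightarrow> (\<forall>i\<in>BI. lands_in_BH (op i)) \<and> (\<forall>i\<in>BI. \<forall>j\<in>BI. dual_form_lin (op i) j + dual_form_lin (op j) i = 0)"

lemma invariant_two:
  assumes "\<And>i. i \<in> BI \<Longrightarrow> lands_in_BH (op i)" "\<And>i. op i = [(c1 i, i1 i), (c2 i, i2 i)]"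
    "\<And>i j. i \<in> BI \<Longrightarrow> j \<in> BI \<Longrightarrow> c1 i * dual_form (i1 i) j + c2 j * dual_form (i2 j) i = 0"
  shows "invariant op"
  unfolding invariant_def
proof (intro conjI ballI assms(1))
  fix i j assume ij: "i \<in> BI" "j \<in> BI"
  have "dual_form_lin (op i) j + dual_form_lin (op j) i = (c1 i * dual_form (i1 i) j + c2 j * dual_form (i2 j) i) + (c1 j * dual_form (i1 j) i + c2 i * dual_form (i2 i) j)"
    by (simp add: dual_form_lin_def assms(2))
  then show "dual_form_lin (op i) j + dual_form_lin (op j) i = 0" using assms(3)[OF ij] assms(3)[OF ij(2,1)] by simp
qed

lemma invariant_one:
  assumes "\<And>i. i \<in> BI \<Longrightarrow> lands_in_BH (op i)" and op: "\<And>i. op i = [(c i, i1 i)]" and i1: "\<And>i. i1 (dual (i1 i)) = dual i"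
    and num: "\<And>i. i \<in> BI \<Longrightarrow> c i * dual_value (i1 i) + c (dual (i1 i)) * dual_value i = 0"
  shows "invariant op"
  unfolding invariant_def
proof (intro conjI ballI assms(1))
  fix i j assume ij: "i \<in> BI" "j \<in> BI"
  have "c i * dual_form (i1 i) j + c j * dual_form (i1 j) i = 0"
    by (rule two_term[where ?i1.0 = i1 and ?i2.0 = i1 and ?c1.0 = c and ?c2.0 = c, OF i1 i1 num[OF ij(1)] ij(2)])
  then show "dual_form_lin (op i) j + dual_form_lin (op j) i = 0" by (simp add: dual_form_lin_def op)
qed

text \<open>A move that would leave \<open>BH\<close> carries a vanishing coefficient.\<close>
lemma BH_exponent_moves:
  assumes "0 \<le> d" "BH_exponent k d"
  shows "k = 0 \<or> BH_exponent (k - 1) (d + 1)" "k + d + 1 = 0 \<or> BH_exponent k (d - 1)"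
    "k + d = 0 \<or> BH_exponent k (d + 1)" "k - 1 = 0 \<or> BH_exponent (k + 1) (d - 1)"
  using assms unfolding BH_exponent_def by presburger+

lemma BI_II_iff: "(k,p,q,r) \<in> BI \<longleftrightarrow> (k,p,q,r) \<in> II \<and> BH_exponent k (p + q)" by (auto simp: BI_iff II_def)

lemma ok2: "c1 = 0 \<or> i1 \<in> BI \<or> i1 \<notin> II \<Longrightarrow> c2 = 0 \<or> i2 \<in> BI \<or> i2 \<notin> II \<Longrightarrow> lands_in_BH [(c1,i1),(c2,i2)]"
  by (simp add: lands_in_BH_def)

lemma lands_in_BH_trans:
  assumes i: "i \<in> BI" shows "lands_in_BH (trans_op a b i)"
proof -
  obtain k p q r where ii: "i = (k,p,q,r)" by (cases i)
  have d: "0 \<le> p + q" "BH_exponent k (p + q)" using i by (auto simp: ii BI_iff)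
  have 1: "ci (k * x * y) / z = 0 \<or> (k - 1,p',q',r') \<in> BI \<or> (k - 1,p',q',r') \<notin> II"
    "- ci (k * x * y) / z = 0 \<or> (k - 1,p',q',r') \<in> BI \<or> (k - 1,p',q',r') \<notin> II" if "p' + q' = p + q + 1" for p' q' r' x y z
  proof -
    have "k = 0 \<or> (k - 1,p',q',r') \<in> BI \<or> (k - 1,p',q',r') \<notin> II" unfolding BI_II_iff that using BH_exponent_moves(1)[OF d] by blast
    then show "ci (k * x * y) / z = 0 \<or> (k - 1,p',q',r') \<in> BI \<or> (k - 1,p',q',r') \<notin> II"
      "- ci (k * x * y) / z = 0 \<or> (k - 1,p',q',r') \<in> BI \<or> (k - 1,p',q',r') \<notin> II" by auto
  qed
  have 2: "ci (k + p + q + 1) / z = 0 \<or> (k,p',q',r') \<in> BI \<or> (k,p',q',r') \<notin> II" if "p' + q' = p + q - 1" for p' q' r' z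
  proof -
    have "k + (p + q) + 1 = 0 \<or> (k,p',q',r') \<in> BI \<or> (k,p',q',r') \<notin> II" unfolding BI_II_iff that using BH_exponent_moves(2)[OF d] by blast
    moreover have "k + (p + q) + 1 = k + p + q + 1" by simp
    ultimately show ?thesis by (metis div_0 of_int_0)
  qed
  have "lands_in_BH (trans_op 1 1 (k,p,q,r))"
    unfolding trans_op.simps by (simp only: simp_thms if_True if_False two_neq_one, intro ok2 1 2) simp_all
  moreover have "lands_in_BH (trans_op 1 2 (k,p,q,r))"
    unfolding trans_op.simps by (simp only: simp_thms if_True if_False two_neq_one, intro ok2 1 2) simp_all
  moreover have "lands_in_BH (trans_op 2 1 (k,p,q,r))"
    unfolding trans_op.simps by (simp only: simp_thms if_True if_False two_neq_one, intro ok2 1 2) simp_all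
  moreover have "lands_in_BH (trans_op 2 2 (k,p,q,r))"
    unfolding trans_op.simps by (simp only: simp_thms if_True if_False two_neq_one, intro ok2 1 2) simp_all
  ultimately show ?thesis unfolding ii using exhaust_2[of a] exhaust_2[of b] by auto
qed

lemma lands_in_BH_spec:
  assumes i: "i \<in> BI" shows "lands_in_BH (spec_op a b i)"
proof -
  obtain k p q r where ii: "i = (k,p,q,r)" by (cases i)
  have d: "0 \<le> p + q" "BH_exponent k (p + q)" using i by (auto simp: ii BI_iff)
  have 1: "ci ((k + p + q) * x * y) / z = 0 \<or> (k,p',q',r') \<in> BI \<or> (k,p',q',r') \<notin> II" if "p' + q' = p + q + 1" for p' q' r' x y z
  proof -
    have "k + (p + q) = 0 \<or> (k,p',q',r') \<in> BI \<or> (k,p',q',r') \<notin> II" unfolding BI_II_iff that using BH_exponent_moves(3)[OF d] by blast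
    moreover have "k + (p + q) = k + p + q" by simp
    ultimately show ?thesis by (metis div_0 of_int_0 mult_zero_left)
  qed
  have 2: "ci (k - 1) / z = 0 \<or> (k+1,p',q',r') \<in> BI \<or> (k+1,p',q',r') \<notin> II"
    "- ci (k - 1) / z = 0 \<or> (k+1,p',q',r') \<in> BI \<or> (k+1,p',q',r') \<notin> II" if "p' + q' = p + q - 1" for p' q' r' z
  proof -
    have "k - 1 = 0 \<or> (k+1,p',q',r') \<in> BI \<or> (k+1,p',q',r') \<notin> II" unfolding BI_II_iff that using BH_exponent_moves(4)[OF d] by blast
    then show "ci (k - 1) / z = 0 \<or> (k+1,p',q',r') \<in> BI \<or> (k+1,p',q',r') \<notin> II"
      "- ci (k - 1) / z = 0 \<or> (k+1,p',q',r') \<in> BI \<or> (k+1,p',q',r') \<notin> II" by auto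
  qed
  have "lands_in_BH (spec_op 1 1 (k,p,q,r))"
    unfolding spec_op.simps by (simp only: simp_thms if_True if_False two_neq_one, intro ok2 1 2) simp_all
  moreover have "lands_in_BH (spec_op 1 2 (k,p,q,r))"
    unfolding spec_op.simps by (simp only: simp_thms if_True if_False two_neq_one, intro ok2 1 2) simp_all
  moreover have "lands_in_BH (spec_op 2 1 (k,p,q,r))"
    unfolding spec_op.simps by (simp only: simp_thms if_True if_False two_neq_one, intro ok2 1 2) simp_all
  moreover have "lands_in_BH (spec_op 2 2 (k,p,q,r))"
    unfolding spec_op.simps by (simp only: simp_thms if_True if_False two_neq_one, intro ok2 1 2) simp_all
  ultimately show ?thesis unfolding ii using exhaust_2[of a] exhaust_2[of b] by auto
qed

lemma lands_in_BH_left: "i \<in> BI \<Longrightarrow> lands_in_BH (left_op a b i)" and lands_in_BH_right: "i \<in> BI \<Longrightarrow> lands_in_BH (right_op a b i)"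
  by (cases i; auto simp: lands_in_BH_def left_op.simps right_op.simps BI_II_iff)+

lemma invariant_trans_of_form:
  assumes s: "\<And>k p q r. trans_op a b (k,p,q,r) = [(\<epsilon> * ci k * w p q r / ci (p + q + 1), (k - 1, p + s, q + (1 - s), r + u)),
       (ci (k + p + q + 1) / ci (p + q + 1), (k, p - (1 - s), q - s, r - (1 - u)))]"
    and w: "\<And>p q r. w p q r * wt (p + s) (q + (1 - s)) (r + u) = \<epsilon> * wt p q r" and \<epsilon>: "\<epsilon> * \<epsilon> = 1"
  shows "invariant (trans_op a b)"
proof (rule invariant_two)
  define c1 where "c1 = (\<lambda>(k,p,q,r). \<epsilon> * ci k * w p q r / ci (p + q + 1))"
  define c2 where "c2 = (\<lambda>(k,p,q::int,r::int). ci (k + p + q + 1) / ci (p + q + 1))"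
  define i1 where "i1 = (\<lambda>(k,p,q,r). (k - 1 :: int, p + s, q + (1 - s), r + u))"
  define i2 where "i2 = (\<lambda>(k::int,p,q,r). (k, p - (1 - s), q - s, r - (1 - u)))"
  show "lands_in_BH (trans_op a b i)" if "i \<in> BI" for i by (rule lands_in_BH_trans[OF that])
  show "trans_op a b i = [(c1 i, i1 i), (c2 i, i2 i)]" for i
    by (cases i) (simp only: s c1_def c2_def i1_def i2_def prod.case)
  show "c1 i * dual_form (i1 i) j + c2 j * dual_form (i2 j) i = 0" if "i \<in> BI" "j \<in> BI" for i j
    by (rule trans_invariant_aux[OF that, where s = s and u = u and w = w and \<epsilon> = \<epsilon>])
      (simp_all only: c1_def c2_def i1_def i2_def prod.case w \<epsilon>)
qed

lemma invariant_trans: "invariant (trans_op a b)"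
proof -
  have "invariant (trans_op 1 1)"
    by (rule invariant_trans_of_form[where s = 0 and u = 0 and \<epsilon> = 1 and w = "\<lambda>p q r. ci (p+q-r+1) * ci (q+1)"]) (use wt_q in \<open>auto simp: trans_op.simps\<close>)
  moreover have "invariant (trans_op 1 2)"
    by (rule invariant_trans_of_form[where s = 1 and u = 0 and \<epsilon> = "-1" and w = "\<lambda>p q r. ci (p+q-r+1) * ci (p+1)"]) (use wt_p in \<open>auto simp: trans_op.simps\<close>)
  moreover have "invariant (trans_op 2 1)"
    by (rule invariant_trans_of_form[where s = 0 and u = 1 and \<epsilon> = "-1" and w = "\<lambda>p q r. ci (r+1) * ci (q+1)"]) (use wt_qr in \<open>auto simp: trans_op.simps\<close>)
  moreover have "invariant (trans_op 2 2)"
    by (rule invariant_trans_of_form[where s = 1 and u = 1 and \<epsilon> = 1 and w = "\<lambda>p q r. ci (r+1) * ci (p+1)"]) (use wt_pr in \<open>auto simp: trans_op.simps\<close>)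
  ultimately show ?thesis using exhaust_2[of a] exhaust_2[of b] by auto
qed

lemma invariant_spec_of_form:
  assumes s: "\<And>k p q r. spec_op a b (k,p,q,r) = [(ci (k + p + q) * w p q r / ci (p + q + 1), (k, p + s, q + (1 - s), r + u)),
       (\<epsilon> * ci (k - 1) / ci (p + q + 1), (k + 1, p - (1 - s), q - s, r - (1 - u)))]"
    and w: "\<And>p q r. w p q r * wt (p + s) (q + (1 - s)) (r + u) = \<epsilon> * wt p q r"
  shows "invariant (spec_op a b)"
proof (rule invariant_two)
  define c1 where "c1 = (\<lambda>(k,p,q,r). ci (k + p + q) * w p q r / ci (p + q + 1))"
  define c2 where "c2 = (\<lambda>(k,p,q::int,r::int). \<epsilon> * ci (k - 1) / ci (p + q + 1))"
  define i1 where "i1 = (\<lambda>(k::int,p,q,r). (k, p + s, q + (1 - s), r + u))"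
  define i2 where "i2 = (\<lambda>(k::int,p,q,r). (k + 1, p - (1 - s), q - s, r - (1 - u)))"
  show "lands_in_BH (spec_op a b i)" if "i \<in> BI" for i by (rule lands_in_BH_spec[OF that])
  show "spec_op a b i = [(c1 i, i1 i), (c2 i, i2 i)]" for i
    by (cases i) (simp only: s c1_def c2_def i1_def i2_def prod.case)
  show "c1 i * dual_form (i1 i) j + c2 j * dual_form (i2 j) i = 0" if "i \<in> BI" "j \<in> BI" for i j
    by (rule spec_invariant_aux[OF that, where s = s and u = u and w = w and \<epsilon> = \<epsilon>])
      (simp_all only: c1_def c2_def i1_def i2_def prod.case w)
qed

lemma invariant_spec: "invariant (spec_op a b)"
proof -
  have "invariant (spec_op 1 1)"
    by (rule invariant_spec_of_form[where s = 1 and u = 1 and \<epsilon> = 1 and w = "\<lambda>p q r. ci (r+1) * ci (p+1)"]) (use wt_pr in \<open>auto simp: spec_op.simps\<close>)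
  moreover have "invariant (spec_op 1 2)"
    by (rule invariant_spec_of_form[where s = 1 and u = 0 and \<epsilon> = "-1" and w = "\<lambda>p q r. ci (p+q-r+1) * ci (p+1)"]) (use wt_p in \<open>auto simp: spec_op.simps\<close>)
  moreover have "invariant (spec_op 2 1)"
    by (rule invariant_spec_of_form[where s = 0 and u = 1 and \<epsilon> = "-1" and w = "\<lambda>p q r. ci (r+1) * ci (q+1)"]) (use wt_qr in \<open>auto simp: spec_op.simps\<close>)
  moreover have "invariant (spec_op 2 2)"
    by (rule invariant_spec_of_form[where s = 0 and u = 0 and \<epsilon> = 1 and w = "\<lambda>p q r. ci (p+q-r+1) * ci (q+1)"]) (use wt_q in \<open>auto simp: spec_op.simps\<close>)
  ultimately show ?thesis using exhaust_2[of a] exhaust_2[of b] by auto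
qed

lemma dual_value_simp: "dual_value (k,p,q,r) = level_const k (p + q) * wt p q r" by (simp add: dual_value_def)

text \<open>Left and right multiplication preserve \<open>k\<close> and \<open>d\<close>, so \<open>level_const\<close> factors out and only \<open>wt\<close> matters.\<close>
lemma invariant_one_quad:
  assumes lands_in_BH: "\<And>i. i \<in> BI \<Longrightarrow> lands_in_BH (op i)"
    and op: "\<And>k p q r. op (k,p,q,r) = [(c k p q r, (k, p + s, q - s, r + u))]"
    and num: "\<And>k p q r. c k p q r * wt (p + s) (q - s) (r + u) + c (- k - p - q) (q - s) (p + s) (p + q - (r + u)) * wt p q r = 0"
  shows "invariant op"
proof (rule invariant_one[OF lands_in_BH])
  define c1 where "c1 = (\<lambda>(k,p,q,r). c k p q r)"
  define i1 where "i1 = (\<lambda>(k::int,p,q,r). (k, p + s, q - s, r + u))"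
  show "op i = [(c1 i, i1 i)]" for i by (cases i) (simp only: op c1_def i1_def prod.case)
  show "i1 (dual (i1 i)) = dual i" for i by (cases i) (simp add: i1_def)
  show "c1 i * dual_value (i1 i) + c1 (dual (i1 i)) * dual_value i = 0" for i
  proof (cases i)
    case (fields k p q r)
    have e: "p + s + (q - s) = p + q" "- k - (p + s) - (q - s) = - k - p - q" by simp_all
    have "c1 i * dual_value (i1 i) + c1 (dual (i1 i)) * dual_value i = level_const k (p + q) *
      (c k p q r * wt (p + s) (q - s) (r + u) + c (- k - p - q) (q - s) (p + s) (p + q - (r + u)) * wt p q r)"
      unfolding fields c1_def i1_def prod.case dual_simp dual_value_simp e by (simp only: distrib_left mult_ac)
    then show ?thesis unfolding num by simp
  qed
qed

lemma invariant_left: "invariant (left_op a b)"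
proof -
  have "invariant (left_op 1 1)"
    by (rule invariant_one_quad[where s = 0 and u = 0 and c = "\<lambda>k p q r. ci (k + r)", OF lands_in_BH_left])
      (simp_all add: left_op.simps algebra_simps)
  moreover have "invariant (left_op 1 2)"
  proof (rule invariant_one_quad[where s = 0 and u = 1 and c = "\<lambda>k p q r. ci (r + 1)", OF lands_in_BH_left])
    fix k p q r :: int
    have e: "p + q - (r + 1) + 1 = p + q - r" "p + 0 = p" "q - 0 = q" by simp_all
    show "ci (r + 1) * wt (p + 0) (q - 0) (r + 1) + ci (p + q - (r + 1) + 1) * wt p q r = 0"
      unfolding e wt_r by (simp del: of_int_diff of_int_add)
  qed (simp_all add: left_op.simps)
  moreover have "invariant (left_op 2 1)"
  proof (rule invariant_one_quad[where s = 0 and u = "-1" and c = "\<lambda>k p q r. ci (p + q - r + 1)", OF lands_in_BH_left])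
    fix k p q r :: int
    have e: "q - 0 + (p + 0) - (p + q - (r + - 1)) + 1 = r" "p + 0 = p" "q - 0 = q" "p + q - r + 1 = p + q - (r - 1)" "r + - 1 = r - 1" by simp_all
    have "ci r * wt p q r = - ci (p + q - (r - 1)) * wt p q (r - 1)" using wt_r[of "r - 1" p q] by (simp only: diff_add_cancel)
    then show "ci (p + q - r + 1) * wt (p + 0) (q - 0) (r + - 1) + ci (q - 0 + (p + 0) - (p + q - (r + - 1)) + 1) * wt p q r = 0"
      unfolding e(1) unfolding e(2-) by (simp del: of_int_diff of_int_add)
  qed (simp_all add: left_op.simps)
  moreover have "invariant (left_op 2 2)"
    by (rule invariant_one_quad[where s = 0 and u = 0 and c = "\<lambda>k p q r. ci (k + p + q - r)", OF lands_in_BH_left])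
      (simp_all add: left_op.simps algebra_simps)
  ultimately show ?thesis using exhaust_2[of a] exhaust_2[of b] by auto
qed

lemma invariant_right: "invariant (right_op a b)"
proof -
  have "invariant (right_op 1 1)"
    by (rule invariant_one_quad[where s = 0 and u = 0 and c = "\<lambda>k p q r. ci (k + p)", OF lands_in_BH_right])
      (simp_all add: right_op.simps algebra_simps)
  moreover have "invariant (right_op 1 2)"
  proof (rule invariant_one_quad[where s = 1 and u = 0 and c = "\<lambda>k p q r. ci (p + 1)", OF lands_in_BH_right])
    fix k p q r :: int
    have e: "q - 1 + 1 = q" "r + 0 = r" by simp_all
    show "ci (p + 1) * wt (p + 1) (q - 1) (r + 0) + ci (q - 1 + 1) * wt p q r = 0"
      unfolding e wt_pq by (simp del: of_int_diff of_int_add)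
  qed (simp_all add: right_op.simps)
  moreover have "invariant (right_op 2 1)"
  proof (rule invariant_one_quad[where s = "-1" and u = 0 and c = "\<lambda>k p q r. ci (q + 1)", OF lands_in_BH_right])
    fix k p q r :: int
    have e: "p + - 1 + 1 = p" "q - - 1 = q + 1" "r + 0 = r" "p + - 1 = p - 1" by simp_all
    have "ci p * wt p q r = - ci (q + 1) * wt (p - 1) (q + 1) r" using wt_pq[of "p - 1" "q + 1" r] by (simp only: diff_add_cancel add_diff_cancel_right')
    then show "ci (q + 1) * wt (p + - 1) (q - - 1) (r + 0) + ci (p + - 1 + 1) * wt p q r = 0"
      unfolding e(1) unfolding e(2-) by (simp del: of_int_diff of_int_add)
  qed (simp_all add: right_op.simps)
  moreover have "invariant (right_op 2 2)"
    by (rule invariant_one_quad[where s = 0 and u = 0 and c = "\<lambda>k p q r. ci (k + q)", OF lands_in_BH_right])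
      (simp_all add: right_op.simps algebra_simps)
  ultimately show ?thesis using exhaust_2[of a] exhaust_2[of b] by auto
qed

section \<open>The derived action of the Lie algebra\<close>

lemma matrix_inv_nonsingular:
  fixes A :: "complex^'n^'n"
  assumes "det A \<noteq> 0" shows "A ** matrix_inv A = mat 1" "matrix_inv A ** A = mat 1"
proof -
  have "\<exists>A'. A ** A' = mat 1 \<and> A' ** A = mat 1" using assms unfolding invertible_det_nz[symmetric] invertible_def .
  then have "A ** matrix_inv A = mat 1 \<and> matrix_inv A ** A = mat 1" unfolding matrix_inv_def by (rule someI_ex)
  then show "A ** matrix_inv A = mat 1" "matrix_inv A ** A = mat 1" by auto
qed

lemma tendsto_det:
  fixes A :: "'b \<Rightarrow> complex^'n^'n"
  assumes "\<And>i j. ((\<lambda>x. A x $ i $ j) \<longlongrightarrow> B $ i $ j) F"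
  shows "((\<lambda>x. det (A x)) \<longlongrightarrow> det B) F"
  unfolding det_def by (intro tendsto_sum tendsto_mult tendsto_prod tendsto_const assms)

lemma matrix_inv_cramer:
  fixes A :: "complex^'n^'n"
  assumes "det A \<noteq> 0"
  shows "matrix_inv A $ k $ l = det (\<chi> i j. if j = k then (if i = l then 1 else 0) else A $ i $ j) / det A"
proof -
  define b :: "complex^'n" where "b = (\<chi> i. if i = l then 1 else 0)"
  have "A *v (\<chi> k. matrix_inv A $ k $ l) = b"
    using matrix_inv_nonsingular(1)[OF assms]
    by (simp add: vec_eq_iff matrix_vector_mult_def matrix_matrix_mult_def b_def mat_def)
  then show ?thesis unfolding cramer[OF assms] by (simp add: vec_eq_iff b_def cong: if_cong)
qed

text \<open>Cramer's rule gives continuity of the inverse. The difference quotient is minus that of \<open>A\<close> times the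
  inverse, so continuity suffices for the derivative.\<close>
lemma matrix_inv_DERIV:
  fixes A :: "complex \<Rightarrow> complex^'n^'n"
  assumes A0: "A 0 = mat 1" and der: "\<And>i j. ((\<lambda>s. A s $ i $ j) has_field_derivative X $ i $ j) (at 0)"
  shows "eventually (\<lambda>s. det (A s) \<noteq> 0) (nhds 0)"
    "((\<lambda>s. matrix_inv (A s) $ i $ j) has_field_derivative - X $ i $ j) (at 0)"
proof -
  have lim: "((\<lambda>s. A s $ i $ j) \<longlongrightarrow> A 0 $ i $ j) (nhds 0)" for i j
    using DERIV_isCont[OF der[of i j]] by (simp add: continuous_at tendsto_nhds_iff)
  have limdet: "((\<lambda>s. det (A s)) \<longlongrightarrow> det (A 0)) (nhds 0)" by (rule tendsto_det[OF lim])
  show ev: "eventually (\<lambda>s. det (A s) \<noteq> 0) (nhds 0)"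
    by (rule tendsto_imp_eventually_ne[OF limdet]) (simp add: A0)
  have inv0: "matrix_inv (A 0) = mat 1" unfolding A0 by (rule matrix_inv_eqI) simp_all
  have liminv: "((\<lambda>s. matrix_inv (A s) $ k $ l) \<longlongrightarrow> mat 1 $ k $ l) (nhds 0)" for k l
  proof -
    let ?c = "\<lambda>s. det (\<chi> i j. if j = k then (if i = l then 1 else 0) else A s $ i $ j) / det (A s)"
    have "(?c \<longlongrightarrow> ?c 0) (nhds 0)"
      by (intro tendsto_divide limdet tendsto_det) (use lim in \<open>auto simp: A0 if_distrib\<close>)
    moreover have "?c 0 = mat 1 $ k $ l" using matrix_inv_cramer[of "A 0" k l] by (simp add: A0 inv0[unfolded A0])
    moreover have "eventually (\<lambda>s. ?c s = matrix_inv (A s) $ k $ l) (nhds 0)"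
      using ev by eventually_elim (simp add: matrix_inv_cramer)
    ultimately show ?thesis by (simp cong: filterlim_cong)
  qed
  have "((\<lambda>h. - (\<Sum>l\<in>UNIV. (A h $ i $ l - A 0 $ i $ l) / h * matrix_inv (A h) $ l $ j)) \<longlongrightarrow> - (\<Sum>l\<in>UNIV. X $ i $ l * mat 1 $ l $ j)) (at 0)"
  proof (intro tendsto_minus tendsto_sum tendsto_mult)
    fix l
    show "((\<lambda>h. (A h $ i $ l - A 0 $ i $ l) / h) \<longlongrightarrow> X $ i $ l) (at 0)" using der[of i l] by (simp add: DERIV_def)
    show "((\<lambda>h. matrix_inv (A h) $ l $ j) \<longlongrightarrow> mat 1 $ l $ j) (at 0)" using liminv[of l j] by (simp add: tendsto_nhds_iff)
  qed
  moreover have "(\<Sum>l\<in>UNIV. X $ i $ l * mat 1 $ l $ j) = X $ i $ j" by (simp add: mat_def if_distrib cong: if_cong)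
  moreover have "eventually (\<lambda>h. - (\<Sum>l\<in>UNIV. (A h $ i $ l - A 0 $ i $ l) / h * matrix_inv (A h) $ l $ j) =
      (matrix_inv (A (0 + h)) $ i $ j - matrix_inv (A 0) $ i $ j) / h) (at 0)"
    using ev[unfolded eventually_nhds_conv_at, THEN conjunct1]
  proof eventually_elim
    case (elim h)
    have "(\<Sum>l\<in>UNIV. A h $ i $ l * matrix_inv (A h) $ l $ j) = mat 1 $ i $ j"
      using matrix_inv_nonsingular(1)[OF elim] by (simp add: vec_eq_iff matrix_matrix_mult_def)
    moreover have "(\<Sum>l\<in>UNIV. A 0 $ i $ l * matrix_inv (A h) $ l $ j) = matrix_inv (A h) $ i $ j"
      by (simp add: A0 mat_def if_distrib[of "\<lambda>x. x * _"] cong: if_cong)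
    ultimately have "(\<Sum>l\<in>UNIV. (A h $ i $ l - A 0 $ i $ l) * matrix_inv (A h) $ l $ j) = mat 1 $ i $ j - matrix_inv (A h) $ i $ j"
      by (simp add: left_diff_distrib sum_subtractf)
    then have "(\<Sum>l\<in>UNIV. (A h $ i $ l - A 0 $ i $ l) / h * matrix_inv (A h) $ l $ j) = (mat 1 $ i $ j - matrix_inv (A h) $ i $ j) / h"
      by (simp add: sum_divide_distrib[symmetric])
    then show ?case by (simp add: inv0 diff_divide_distrib)
  qed
  ultimately show "((\<lambda>s. matrix_inv (A s) $ i $ j) has_field_derivative - X $ i $ j) (at 0)"
    unfolding DERIV_def by (simp only: Lim_transform_eventually)
qed

text \<open>This elementary bound makes the exponential series converge entrywise.\<close>
lemma matrix_power_entry_bound: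
  fixes X :: "complex^'n^'n"
  shows "cmod ((((**) X) ^^ k) (mat 1) $ i $ j) \<le> (\<Sum>i\<in>UNIV. \<Sum>j\<in>UNIV. cmod (X $ i $ j)) ^ k"
proof (induction k arbitrary: i)
  case 0
  show ?case by (simp add: mat_def)
next
  case (Suc k)
  let ?M = "\<Sum>i\<in>UNIV. \<Sum>j\<in>UNIV. cmod (X $ i $ j)"
  have "cmod ((((**) X) ^^ Suc k) (mat 1) $ i $ j) \<le> (\<Sum>l\<in>UNIV. cmod (X $ i $ l) * cmod ((((**) X) ^^ k) (mat 1) $ l $ j))"
    by (simp add: matrix_matrix_mult_def) (rule sum_norm_le, simp add: norm_mult)
  also have "\<dots> \<le> (\<Sum>l\<in>UNIV. cmod (X $ i $ l) * ?M ^ k)" by (intro sum_mono mult_left_mono Suc.IH) auto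
  also have "\<dots> = (\<Sum>l\<in>UNIV. cmod (X $ i $ l)) * ?M ^ k" by (simp add: sum_distrib_right)
  also have "\<dots> \<le> ?M * ?M ^ k"
    by (intro mult_right_mono member_le_sum[of i UNIV "\<lambda>i. \<Sum>j\<in>UNIV. cmod (X $ i $ j)"] zero_le_power sum_nonneg) auto
  finally show ?case by simp
qed

definition exp_coeff :: "complex^'n^'n \<Rightarrow> 'n \<Rightarrow> 'n \<Rightarrow> nat \<Rightarrow> complex" where
  "exp_coeff X i j k = inverse (fact k) * (((**) X) ^^ k) (mat 1) $ i $ j"

text \<open>The exponential along a complex line, entry by entry. A complex parameter makes the theory of complex
  power series available for the derivative.\<close>
definition cexp :: "complex^'n^'n \<Rightarrow> complex \<Rightarrow> complex^'n^'n" where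
  "cexp X s = (\<chi> i j. \<Sum>k. exp_coeff X i j k * s ^ k)"

lemma exp_coeff_summable: "summable (\<lambda>k. exp_coeff X i j k * s ^ k)"
proof (rule summable_comparison_test)
  let ?M = "\<Sum>i\<in>UNIV. \<Sum>j\<in>UNIV. cmod (X $ i $ j)"
  show "summable (\<lambda>k. inverse (fact k) * (?M * cmod s) ^ k)" by (rule summable_exp)
  have "cmod (exp_coeff X i j k * s ^ k) \<le> inverse (fact k) * (?M * cmod s) ^ k" for k
    unfolding exp_coeff_def norm_mult norm_power norm_inverse norm_fact mult.assoc power_mult_distrib
    by (intro mult_left_mono mult_right_mono matrix_power_entry_bound) auto
  then show "\<exists>N. \<forall>k\<ge>N. cmod (exp_coeff X i j k * s ^ k) \<le> inverse (fact k) * (?M * cmod s) ^ k" by blast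
qed

lemma matrix_power_scaleR:
  fixes X :: "complex^'n^'n"
  shows "(((**) (t *\<^sub>R X)) ^^ k) (mat 1) = t ^ k *\<^sub>R (((**) X) ^^ k) (mat 1 :: complex^'n^'n)"
proof (induction k)
  case (Suc k)
  have "(t *\<^sub>R X) ** (c *\<^sub>R A) = (t * c) *\<^sub>R (X ** A)" for c and A :: "complex^'n^'n"
    by (simp add: vec_eq_iff matrix_matrix_mult_def scaleR_sum_right mult.commute)
  then show ?case by (simp add: Suc.IH)
qed simp

lemma mexp_cexp: "mexp (t *\<^sub>R X) = cexp X (of_real t)"
proof -
  have "(\<lambda>k. (((**) (t *\<^sub>R X)) ^^ k) (mat 1) /\<^sub>R fact k) sums cexp X (of_real t)"
    unfolding sums_def
  proof (intro vec_tendstoI)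
    fix i j
    have "(\<lambda>k. exp_coeff X i j k * of_real t ^ k) sums (cexp X (of_real t) $ i $ j)"
      unfolding cexp_def using summable_sums[OF exp_coeff_summable[of X i j "of_real t"]] by simp
    moreover have "exp_coeff X i j k * of_real t ^ k = ((((**) (t *\<^sub>R X)) ^^ k) (mat 1) /\<^sub>R fact k) $ i $ j" for k
      by (simp only: matrix_power_scaleR exp_coeff_def vector_scaleR_component, simp add: scaleR_conv_of_real[where 'a = complex] mult_ac)
    ultimately show "(\<lambda>n. (\<Sum>k<n. (((**) (t *\<^sub>R X)) ^^ k) (mat 1) /\<^sub>R fact k) $ i $ j) \<longlonglongrightarrow> cexp X (of_real t) $ i $ j"
      unfolding sums_def by (simp add: sum_component)
  qed
  then show ?thesis unfolding mexp_def by (rule sums_unique[symmetric])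
qed

lemma cexp_0: "cexp X 0 = mat 1" by (simp add: cexp_def vec_eq_iff exp_coeff_def)

lemma cexp_DERIV: "((\<lambda>s. cexp X s $ i $ j) has_field_derivative X $ i $ j) (at 0)"
proof -
  have "((\<lambda>s. cexp X s $ i $ j) has_field_derivative (\<Sum>k. diffs (exp_coeff X i j) k * 0 ^ k)) (at 0)"
    unfolding cexp_def vec_lambda_beta by (rule termdiffs_strong_converges_everywhere[OF exp_coeff_summable])
  then show ?thesis by (simp add: diffs_def exp_coeff_def)
qed

text \<open>The derivative at \<open>0\<close> of \<open>(aZ+b)(cZ+d)\<^sup>-\<^sup>1\<close>, where \<open>a, b, c, d\<close> are the blocks of \<open>exp (-tX)\<close>.\<close>
definition vfield :: "HC22 \<Rightarrow> HC \<Rightarrow> HC" where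
  "vfield X Z = Z ** (block_c X ** Z + block_d X) - (block_a X ** Z + block_b X)"

text \<open>The chain rule along the curve \<open>t \<mapsto> (aZ+b)(cZ+d)\<^sup>-\<^sup>1\<close>, which is defined for small \<open>t\<close>. Inverting the
  exponential accounts for the signs.\<close>
lemma drho_eq:
  assumes f: "(f has_derivative D) (at Z)" and Z: "det Z \<noteq> 0"
  shows "drho X f Z = D (vfield X Z)"
proof -
  define K where "K = (\<lambda>s. matrix_inv (cexp X s))"
  have K0: "K 0 = mat 1" unfolding K_def cexp_0 by (rule matrix_inv_eqI) simp_all
  have K: "((\<lambda>s. K s $ i $ j) has_field_derivative - X $ i $ j) (at 0)" for i j
    unfolding K_def by (rule matrix_inv_DERIV(2)[where A = "cexp X", OF cexp_0 cexp_DERIV])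
  define P where "P = (\<lambda>s. block_a (K s) ** Z + block_b (K s))"
  define Q where "Q = (\<lambda>s. block_c (K s) ** Z + block_d (K s))"
  have P: "((\<lambda>s. P s $ i $ j) has_field_derivative - (block_a X ** Z + block_b X) $ i $ j) (at 0)" for i j
    unfolding P_def block_a_def block_b_def vector_add_component mult_2_entry vec_lambda_beta
    by (rule derivative_eq_intros K refl)+ (simp add: algebra_simps)
  have Q': "((\<lambda>s. Q s $ i $ j) has_field_derivative - (block_c X ** Z + block_d X) $ i $ j) (at 0)" for i j
    unfolding Q_def block_c_def block_d_def vector_add_component mult_2_entry vec_lambda_beta
    by (rule derivative_eq_intros K refl)+ (simp add: algebra_simps)
  have PQ0: "P 0 = Z" "Q 0 = mat 1" by (simp_all add: P_def Q_def K0 block_mat1)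
  have Q: "((\<lambda>s. Q s $ i $ j) has_field_derivative (- (block_c X ** Z + block_d X)) $ i $ j) (at 0)" for i j
    using Q' by simp
  note Qi = matrix_inv_DERIV[where A = Q, OF PQ0(2) Q]
  have Qi0: "matrix_inv (Q 0) = mat 1" unfolding PQ0 by (rule matrix_inv_eqI) simp_all
  define W where "W = (\<lambda>s. P s ** matrix_inv (Q s))"
  have W0: "W 0 = Z" by (simp add: W_def PQ0 Qi0[unfolded PQ0])
  have WD: "((\<lambda>s. W s $ i $ j) has_field_derivative vfield X Z $ i $ j) (at 0)" for i j
    unfolding W_def mult_2_entry
    apply (rule derivative_eq_intros P Qi(2) refl)+
    apply (simp only: PQ0 Qi0[unfolded PQ0])
    using exhaust_2[of j] by (auto simp: vfield_def mult_2_entry mat_def algebra_simps)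
  have 1: "((\<lambda>t. W (of_real t)) has_vector_derivative vfield X Z) (at 0)"
  proof (rule HC_has_vector_derivative)
    fix i j
    have "((\<lambda>s. W s $ i $ j) has_field_derivative vfield X Z $ i $ j) (at (of_real 0))" unfolding of_real_0 by (rule WD)
    then show "((\<lambda>t. W (of_real t) $ i $ j) has_vector_derivative vfield X Z $ i $ j) (at 0)"
      by (rule has_vector_derivative_real_field)
  qed
  have 2: "(f has_derivative D) (at (W (of_real 0)))" unfolding of_real_0 W0 by (rule f)
  have 3: "((f \<circ> (\<lambda>t. W (of_real t))) has_vector_derivative D (vfield X Z)) (at 0)"
    by (rule vector_derivative_diff_chain_within[OF 1 has_derivative_at_withinI[OF 2]])
  have "((\<lambda>t. complex_of_real t) \<longlongrightarrow> of_real 0) (nhds 0)" by (intro tendsto_of_real filterlim_ident)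
  then have lim0: "filterlim complex_of_real (nhds 0) (nhds 0)" unfolding of_real_0 .
  have "eventually (\<lambda>t. det (Q (complex_of_real t)) \<noteq> 0) (nhds 0)"
    by (rule eventually_compose_filterlim[OF Qi(1) lim0])
  then have "eventually (\<lambda>t. (f \<circ> (\<lambda>t. W (of_real t))) t = rho (mexp (t *\<^sub>R X)) f Z) (nhds (0::real))"
    by eventually_elim (simp add: rho_def on_units_def Z Let_def mexp_cexp W_def P_def Q_def K_def)
  then obtain S where S: "open S" "0 \<in> S" "\<And>t. t \<in> S \<Longrightarrow> (f \<circ> (\<lambda>t. W (of_real t))) t = rho (mexp (t *\<^sub>R X)) f Z"
    unfolding eventually_nhds by auto
  have "((\<lambda>t. rho (mexp (t *\<^sub>R X)) f Z) has_vector_derivative D (vfield X Z)) (at 0)"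
    by (rule has_vector_derivative_transform_within_open[OF 3 S])
  then show ?thesis unfolding drho_def by (rule vector_derivative_at)
qed

lemma drho_singular: "det Z = 0 \<Longrightarrow> drho X f Z = 0"
  by (simp add: drho_def rho_def on_units_def)

section \<open>Invariance under the Lie algebra\<close>

definition scl :: "complex \<Rightarrow> (complex \<times> idx) list \<Rightarrow> (complex \<times> idx) list" where
  "scl c xs = map (\<lambda>x. (c * fst x, snd x)) xs"

lemma lin_scl: "lin (scl c xs) Z = c * lin xs Z"
  by (induction xs) (simp_all add: scl_def lin_def split_beta algebra_simps)

lemma dual_form_lin_scl: "dual_form_lin (scl c xs) j = c * dual_form_lin xs j"
  by (induction xs) (simp_all add: scl_def dual_form_lin_def algebra_simps)

lemma lands_in_BH_scl: "lands_in_BH xs \<Longrightarrow> lands_in_BH (scl c xs)"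
  by (auto simp: lands_in_BH_def scl_def)

lemma invariant_scl: "invariant op \<Longrightarrow> invariant (\<lambda>i. scl c (op i))"
  unfolding invariant_def dual_form_lin_scl by (simp add: lands_in_BH_scl distrib_left[symmetric])

lemma invariant_append: "invariant op \<Longrightarrow> invariant op' \<Longrightarrow> invariant (\<lambda>i. op i @ op' i)"
  unfolding invariant_def
proof (intro conjI ballI; elim conjE)
  fix i j assume "i \<in> BI" "j \<in> BI" "\<forall>i\<in>BI. \<forall>j\<in>BI. dual_form_lin (op i) j + dual_form_lin (op j) i = 0" "\<forall>i\<in>BI. \<forall>j\<in>BI. dual_form_lin (op' i) j + dual_form_lin (op' j) i = 0"
  then have "dual_form_lin (op i) j + dual_form_lin (op j) i = 0" "dual_form_lin (op' i) j + dual_form_lin (op' j) i = 0" by blast+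
  moreover have "dual_form_lin (op i @ op' i) j + dual_form_lin (op j @ op' j) i = (dual_form_lin (op i) j + dual_form_lin (op j) i) + (dual_form_lin (op' i) j + dual_form_lin (op' j) i)" by simp
  ultimately show "dual_form_lin (op i @ op' i) j + dual_form_lin (op j @ op' j) i = 0" by simp
qed simp

definition comb :: "HC \<Rightarrow> (2 \<Rightarrow> 2 \<Rightarrow> idx \<Rightarrow> (complex \<times> idx) list) \<Rightarrow> idx \<Rightarrow> (complex \<times> idx) list" where
  "comb A op i = scl (A$1$1) (op 1 1 i) @ scl (A$1$2) (op 1 2 i) @ scl (A$2$1) (op 2 1 i) @ scl (A$2$2) (op 2 2 i)"

lemma invariant_comb: "(\<And>a b. invariant (op a b)) \<Longrightarrow> invariant (comb A op)"
  unfolding comb_def[abs_def] by (intro invariant_append invariant_scl)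

lemma dE_comb:
  assumes add: "\<And>A B. V (A + B) = V A + V B" and smul: "\<And>c A. V (smul c A) = smul c (V A)"
    and op: "\<And>a b. dE i Z (V (U a b)) = lin (op a b i) Z"
  shows "dE i Z (V A) = lin (comb A op i) Z"
proof -
  have A: "A = smul (A$1$1) (U 1 1) + smul (A$1$2) (U 1 2) + smul (A$2$1) (U 2 1) + smul (A$2$2) (U 2 2)"
    by (rule matrix_entries_eqI) simp_all
  show ?thesis
    by (subst A) (simp only: add smul dE_add dE_smul op comb_def lin_append lin_scl, simp add: algebra_simps)
qed

text \<open>The vector field of \<open>drho_eq\<close> decomposed into matrix units. The left operators are transposed because
  \<open>left_op a b\<close> belongs to \<open>U b a\<close>.\<close>
definition gl_op :: "HC22 \<Rightarrow> idx \<Rightarrow> (complex \<times> idx) list" where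
  "gl_op X i = comb (block_c X) spec_op i @ comb (block_d X) right_op i
     @ comb (- block_a X) (\<lambda>a b. left_op b a) i @ comb (- block_b X) trans_op i"

lemma invariant_gl_op: "invariant (gl_op X)"
  unfolding gl_op_def[abs_def]
  by (intro invariant_append invariant_comb invariant_spec invariant_right invariant_left invariant_trans)

text \<open>Each of the four parts of the vector field depends linearly on one block, so it suffices to know it for
  matrix units.\<close>
lemma gl_op_dE:
  assumes Z: "det Z \<noteq> 0" and i: "i \<in> II"
  shows "dE i Z (vfield X Z) = lin (gl_op X i) Z"
proof -
  obtain k p q r where ii: "i = (k,p,q,r)" by (cases i)
  have pq: "p + q + 1 \<noteq> 0" using i by (auto simp: ii II_def)
  have m: "A ** (- B) = - (A ** B)" "(- B) ** A = - (B ** A)" for A B :: HC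
    by (rule matrix_entries_eqI; simp add: mult_2_entry)+
  have v: "vfield X Z = Z ** block_c X ** Z + Z ** block_d X + (- block_a X) ** Z + (- block_b X)"
    unfolding vfield_def add_mult matrix_mul_assoc m by (simp add: algebra_simps)
  have 1: "dE i Z (Z ** block_c X ** Z) = lin (comb (block_c X) spec_op i) Z"
    by (rule dE_comb[where V = "\<lambda>A. Z ** A ** Z"]) (simp_all only: add_mult smul_mult ii spec_op_dE[OF Z pq])
  have 2: "dE i Z (Z ** block_d X) = lin (comb (block_d X) right_op i) Z"
    by (rule dE_comb[where V = "\<lambda>A. Z ** A"]) (simp_all only: add_mult smul_mult ii right_op_dE[OF Z pq])
  have 3: "dE i Z ((- block_a X) ** Z) = lin (comb (- block_a X) (\<lambda>a b. left_op b a) i) Z"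
    by (rule dE_comb[where V = "\<lambda>A. A ** Z"]) (simp_all only: add_mult smul_mult ii left_op_dE[OF Z pq])
  have 4: "dE i Z (- block_b X) = lin (comb (- block_b X) trans_op i) Z"
    by (rule dE_comb[where V = "\<lambda>A. A"]) (simp_all only: ii trans_op_dE[OF Z pq])
  show ?thesis unfolding v dE_add 1 2 3 4 gl_op_def lin_append by (simp only: add.assoc)
qed

lemma BH_has_derivative:
  assumes "f \<in> BH" "det Z \<noteq> 0" obtains D where "(f has_derivative D) (at Z)"
  using span_is_lin[of f BI] lin_has_derivative[OF assms(2)] assms(1) unfolding BH_eq by metis

lemma drho_add:
  assumes f: "f \<in> BH" and g: "g \<in> BH"
  shows "drho X (\<lambda>Z. f Z + g Z) = (\<lambda>Z. drho X f Z + drho X g Z)"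
proof
  fix Z show "drho X (\<lambda>Z. f Z + g Z) Z = drho X f Z + drho X g Z"
  proof (cases "det Z = 0")
    case False
    obtain D D' where D: "(f has_derivative D) (at Z)" "(g has_derivative D') (at Z)"
      using BH_has_derivative[OF f False] BH_has_derivative[OF g False] by metis
    show ?thesis unfolding drho_eq[OF D(1) False] drho_eq[OF D(2) False] drho_eq[OF has_derivative_add[OF D] False] ..
  qed (simp add: drho_singular)
qed

lemma drho_scale:
  assumes f: "f \<in> BH"
  shows "drho X (\<lambda>Z. c * f Z) = (\<lambda>Z. c * drho X f Z)"
proof
  fix Z show "drho X (\<lambda>Z. c * f Z) Z = c * drho X f Z"
  proof (cases "det Z = 0")
    case False
    obtain D where D: "(f has_derivative D) (at Z)" by (rule BH_has_derivative[OF f False])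
    show ?thesis unfolding drho_eq[OF D False] drho_eq[OF has_derivative_mult_right[OF D] False] ..
  qed (simp add: drho_singular)
qed

lemma drho_E:
  assumes i: "i \<in> BI" shows "drho X (E i) = lin (gl_op X i)"
proof
  fix Z show "drho X (E i) Z = lin (gl_op X i) Z"
  proof (cases "det Z = 0")
    case True
    then have "lin xs Z = 0" for xs by (induction xs) (auto simp: lin_Cons E_sing)
    then show ?thesis using True by (simp add: drho_singular)
  next
    case False
    have "i \<in> II" using i BI_II by blast
    then show ?thesis unfolding drho_eq[OF E_has_derivative[OF False] False] by (rule gl_op_dE[OF False])
  qed
qed

text \<open>On basis functions the action is \<open>gl_op\<close>, which is skew for the formal pairing; bilinearity does the rest.\<close>
lemma gl_invariance:
  shows "f \<in> BH \<Longrightarrow> drho X f \<in> BH" "f \<in> BH \<Longrightarrow> g \<in> BH \<Longrightarrow> pairing (drho X f) g + pairing f (drho X g) = 0"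
proof -
  have lands_in_BH: "lands_in_BH (gl_op X i)" and inv: "j \<in> BI \<Longrightarrow> dual_form_lin (gl_op X i) j + dual_form_lin (gl_op X j) i = 0" if "i \<in> BI" for i j
    using invariant_gl_op[of X] that unfolding invariant_def by blast+
  have TE: "drho X (E i) \<in> BH" if "i \<in> BI" for i unfolding drho_E[OF that] by (rule lands_in_BH_lin_BH[OF lands_in_BH[OF that]])
  show T: "drho X f \<in> BH" if "f \<in> BH" for f by (rule operator_BH[of "drho X", OF TE drho_add drho_scale that])
  assume f: "f \<in> BH" and g: "g \<in> BH"
  have z: "bilinear_on BH (\<lambda>f g. 0)" by (simp add: bilinear_on_def)
  show "pairing (drho X f) g + pairing f (drho X g) = 0"
  proof (rule bilinear_ext[OF bilinear_comp(2)[of "drho X", OF T drho_add drho_scale] z _ f g])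
    fix i j assume i: "i \<in> BI" and j: "j \<in> BI"
    have "pairing (E i) (drho X (E j)) = pairing (drho X (E j)) (E i)"
      using pairing_symmetric E_BH[OF i] TE[OF j] unfolding symmetric_on_def by blast
    then show "pairing (drho X (E i)) (E j) + pairing (E i) (drho X (E j)) = 0"
      using inv[OF i j] unfolding drho_E[OF i] drho_E[OF j] by (simp add: pairing_lin[OF lands_in_BH[OF i] j] pairing_lin[OF lands_in_BH[OF j] i])
  qed
qed

theorem proposition7:
  fixes R :: real
  assumes "R > 0"
  shows
    "is_BH_pairing R (BH_pairing R) \<and>
     (\<forall>h\<in>SU2_SU2. (\<forall>f\<in>BH. rho h f \<in> BH) \<and>
        (\<forall>f\<in>BH. \<forall>g\<in>BH. BH_pairing R (rho h f) (rho h g) = BH_pairing R f g)) \<and>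
     (\<forall>X :: HC22. (\<forall>f\<in>BH. drho X f \<in> BH) \<and>
        (\<forall>f\<in>BH. \<forall>g\<in>BH. BH_pairing R (drho X f) g + BH_pairing R f (drho X g) = 0)) \<and>
     (\<forall>R'>0. BH_pairing R' = BH_pairing R) \<and>
     (\<forall>(l, m, n) \<in> indices 1. \<forall>(l', m', n') \<in> indices 1.
        BH_pairing R (phi 1 l m n) (phi_t 1 l' m' n') =
          (if l = l' \<and> m = m' \<and> n = n' then complex_of_real (2 * l) else 0) \<and>
        BH_pairing R (phi_t 1 l m n) (phi 1 l' m' n') =
          (if l = l' \<and> m = m' \<and> n = n' then complex_of_real (2 * l) else 0)) \<and>
     (\<forall>(l, m, n) \<in> indices 2. \<forall>(l', m', n') \<in> indices 2.
        BH_pairing R (phi 2 l m n) (phi_t 2 l' m' n') =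
          (if l = l' \<and> m = m' \<and> n = n' then - complex_of_real (2 * l) else 0) \<and>
        BH_pairing R (phi_t 2 l m n) (phi 2 l' m' n') =
          (if l = l' \<and> m = m' \<and> n = n' then - complex_of_real (2 * l) else 0)) \<and>
     (\<forall>\<alpha> \<in> {1, 2}. \<forall>\<alpha>' \<in> {1, 2}.
        \<forall>(l, m, n) \<in> indices \<alpha>. \<forall>(l', m', n') \<in> indices \<alpha>'.
        BH_pairing R (phi \<alpha> l m n) (phi \<alpha>' l' m' n') = 0 \<and>
        BH_pairing R (phi_t \<alpha> l m n) (phi_t \<alpha>' l' m' n') = 0 \<and>
        (\<alpha> \<noteq> \<alpha>' \<longrightarrow>
           BH_pairing R (phi \<alpha> l m n) (phi_t \<alpha>' l' m' n') = 0 \<and>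
           BH_pairing R (phi_t \<alpha> l m n) (phi \<alpha>' l' m' n') = 0)) \<and>
     (\<forall>f\<in>BH. rho inversion f \<in> BH) \<and>
     (\<forall>f\<in>BH. \<forall>g\<in>BH.
        BH_pairing R (rho inversion f) (rho inversion g) = BH_pairing R f g)"
proof -
  note B = BH_pairing_eq[OF assms] and is_pairing = is_BH_pairing_pairing[OF assms]
  have indep: "BH_pairing R' = BH_pairing R" if "R' > 0" for R' using BH_pairing_eq[OF that] B by simp
  have vanish: "pairing f g = 0" if "f \<in> BH_plus \<and> g \<in> BH_plus \<or> f \<in> BH_minus \<and> g \<in> BH_minus" for f g
    using is_pairing that unfolding is_BH_pairing_def by blast
  have sym: "pairing (phi_t \<alpha> l m n) (phi \<alpha>' l' m' n') = pairing (phi \<alpha>' l' m' n') (phi_t \<alpha> l m n)"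
    if "\<alpha> \<in> {1,2}" "(l,m,n) \<in> indices \<alpha>" "\<alpha>' \<in> {1,2}" "(l',m',n') \<in> indices \<alpha>'" for \<alpha> l m n \<alpha>' l' m' n'
    using pairing_symmetric phi_in_BH(2)[OF that(1,2)] phi_in_BH(1)[OF that(3,4)] unfolding symmetric_on_def by blast
  have dual_bases:
    "pairing (phi 1 l m n) (phi_t 1 l' m' n') = (if l = l' \<and> m = m' \<and> n = n' then complex_of_real (2 * l) else 0) \<and>
     pairing (phi_t 1 l m n) (phi 1 l' m' n') = (if l = l' \<and> m = m' \<and> n = n' then complex_of_real (2 * l) else 0)"
    if "(l,m,n) \<in> indices 1" "(l',m',n') \<in> indices 1" for l m n l' m' n'
    using that by (auto simp: sym pairing_phi)
  have dual_bases2: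
    "pairing (phi 2 l m n) (phi_t 2 l' m' n') = (if l = l' \<and> m = m' \<and> n = n' then - complex_of_real (2 * l) else 0) \<and>
     pairing (phi_t 2 l m n) (phi 2 l' m' n') = (if l = l' \<and> m = m' \<and> n = n' then - complex_of_real (2 * l) else 0)"
    if "(l,m,n) \<in> indices 2" "(l',m',n') \<in> indices 2" for l m n l' m' n'
    using that by (auto simp: sym pairing_phi)
  have zeros: "pairing (phi \<alpha> l m n) (phi \<alpha>' l' m' n') = 0 \<and> pairing (phi_t \<alpha> l m n) (phi_t \<alpha>' l' m' n') = 0 \<and>
      (\<alpha> \<noteq> \<alpha>' \<longrightarrow> pairing (phi \<alpha> l m n) (phi_t \<alpha>' l' m' n') = 0 \<and> pairing (phi_t \<alpha> l m n) (phi \<alpha>' l' m' n') = 0)"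
    if a: "\<alpha> \<in> {1,2}" "\<alpha>' \<in> {1,2}" "(l,m,n) \<in> indices \<alpha>" "(l',m',n') \<in> indices \<alpha>'" for \<alpha> l m n \<alpha>' l' m' n'
    unfolding sym[OF a(1,3,2,4)] pairing_phi[OF a(1,3,2,4)] pairing_phi[OF a(2,4,1,3)]
    using vanish phi_BH_plus[OF a(1,3)] phi_BH_plus[OF a(2,4)] phi_t_BH_minus[OF a(1,3)] phi_t_BH_minus[OF a(2,4)] by auto
  show ?thesis
    apply (intro conjI)
    subgoal unfolding B by (rule is_pairing)
    subgoal unfolding B using SU2_invariance by blast
    subgoal unfolding B using gl_invariance by blast
    subgoal using indep by blast
    subgoal unfolding B using dual_bases by (intro ballI case_prodI2) simp
    subgoal unfolding B using dual_bases2 by (intro ballI case_prodI2) simp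
    subgoal unfolding B using zeros by (intro ballI case_prodI2) simp
    subgoal using inversion_invariance(1) by blast
    subgoal unfolding B using inversion_invariance(2) by blast
    done
qed

end
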